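(* Let $\mathcal H$ be a homogeneous foliation of degree $d\ge3$ on $\mathbb P^2_{\mathbb C}$. Then the $d$-web $\mathrm{Leg}\,\mathcal H$ is flat if and only if its curvature $K(\mathrm{Leg}\,\mathcal H)$ is holomorphic on $\mathcal G_{\mathcal H}(\mathrm I_{\mathcal H}^{\mathrm{tr}})$.
   Context: Foliations. A foliation $\mathcal F$ of degree $d$ on $\mathbb P^2_{\mathbb C}$ is given in homogeneous coordinates $[x:y:z]$, up to a nonzero scalar, by a $1$-form $\Omega=a\,\mathrm dx+b\,\mathrm dy+c\,\mathrm dz$ with $a,b,c$ homogeneous polynomials of degree $d+1$ without common factor satisfying $xa+yb+zc=0$. Equivalently it is given by a homogeneous vector field $Z$ on $\mathbb C^3$ with coefficients of degree $d$ without common factor, with $\Omega=i_{\mathrm R}i_Z(\mathrm dx\wedge\mathrm dy\wedge\mathrm dz)$, $\mathrm R=x\partial_x+y\partial_y+z\partial_z$. In the affine chart $z=1$ it is described by a polynomial $1$-form $A\,\mathrm dx+B\,\mathrm dy$ with $\gcd(A,B)=1$. It is homogeneous if there is an affine chart $(x,y)$ in which it is invariant under all homotheties $(x,y)\mapsto\lambda(x,y)$, $\lambda\in\mathbb C^*$; it is then described in that chart by $\omega=A\,\mathrm dx+B\,\mathrm dy$ with $A,B$ homogeneous polynomials of degree $d$ without common factor. Inflection divisor. $\mathrm I_{\mathcal F}$ is the divisor given by the vanishing of the determinant of the $3\times3$ matrix with rows $(x,Z(x),Z^2(x))$, $(y,Z(y),Z^2(y))$, $(z,Z(z),Z^2(z))$.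 It decomposes as $\mathrm I_{\mathcal F}=\mathrm I_{\mathcal F}^{\mathrm{inv}}+\mathrm I_{\mathcal F}^{\mathrm{tr}}$, where the support of $\mathrm I_{\mathcal F}^{\mathrm{inv}}$ is the set of $\mathcal F$-invariant lines and $\mathrm I_{\mathcal F}^{\mathrm{tr}}$ (the transverse part) consists of the components that are not $\mathcal F$-invariant. Gauss map. $\mathcal G_{\mathcal F}:\mathbb P^2_{\mathbb C}\dashrightarrow\check{\mathbb P}^2_{\mathbb C}$ sends a non-singular point $m$ to the line tangent at $m$ to the leaf of $\mathcal F$ through $m$. For a curve $\mathcal C$, $\mathcal G_{\mathcal F}(\mathcal C)$ denotes the closure of $\mathcal G_{\mathcal F}(\mathcal C\setminus\mathrm{Sing}\,\mathcal F)$. Webs and Legendre transform. A $k$-web on a complex surface is given locally by a $k$-symmetric holomorphic $1$-form with isolated zeros (well defined up to units, compatible on overlaps) which at a generic point factors as a product of $k$ pairwise non-collinear linear forms. The set where this fails is the discriminant $\Delta(\mathcal W)$. The Legendre transform $\mathrm{Leg}\,\mathcal F$ of a degree $d$ foliation is the $d$-web on $\check{\mathbb P}^2_{\mathbb C}$ whose leaves are the families of tangent lines to the leaves of $\mathcal F$. If $\mathcal F$ is described by $A\,\mathrm dx+B\,\mathrm dy$ and $(p,q)$ is the affine chart of $\check{\mathbb P}^2_{\mathbb C}$ corresponding to the line $\{y=px-q\}$, then $\mathrm{Leg}\,\mathcal F$ is given by $A(x,px-q)+pB(x,px-q)=0$ with $x=\frac{\mathrm dq}{\mathrm dp}$. Curvature.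 For a germ of web $\mathcal W=\mathcal F_1\boxtimes\cdots\boxtimes\mathcal F_k$ superposed from foliations defined by $1$-forms $\theta_i$ in coordinates $(u,v)$, write $\theta_i\wedge\theta_j=\delta_{ij}\,\mathrm du\wedge\mathrm dv$. For $r<s<t$ let $\eta_{rst}$ be the unique meromorphic $1$-form with $\mathrm d(\delta_{st}\theta_r)=\eta_{rst}\wedge\delta_{st}\theta_r$, $\mathrm d(\delta_{tr}\theta_s)=\eta_{rst}\wedge\delta_{tr}\theta_s$, $\mathrm d(\delta_{rs}\theta_t)=\eta_{rst}\wedge\delta_{rs}\theta_t$. The curvature $K(\mathcal W)=\mathrm d(\sum_{r<s<t}\eta_{rst})$ does not depend on choices. For a general web these local forms glue to a global meromorphic $2$-form with poles in $\Delta(\mathcal W)$. The web is flat if $K(\mathcal W)\equiv0$. "Holomorphic on (along) a curve" means holomorphic in a neighbourhood of the generic points of each irreducible component of that curve (an empty condition if the curve is empty). *)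

theory Defs
  imports "HOL-Analysis.Analysis" "HOL-Computational_Algebra.Polynomial_Factorial"
begin

section \<open>Polynomials in three variables\<close>

text \<open>The ring \<open>\<complex>[x,y,z]\<close> is \<open>\<complex>[x][y][z]\<close>: the innermost variable is \<open>x\<close>, the outermost \<open>z\<close>.\<close>

type_synonym poly3 = "complex poly poly poly"

definition const3 :: "complex \<Rightarrow> poly3" where
  "const3 c = [:[:[:c:]:]:]"

definition xyz :: "poly3^3" where
  "xyz = vector [[:[:[:0, 1:]:]:], [:[:0, 1:]:], [:0, 1:]]"

text \<open>\<open>subst3 h P v\<close> is the value of \<open>P\<close> at \<open>v\<close> in a ring whose scalars are embedded by \<open>h\<close>.\<close>

definition subst3 :: "(complex \<Rightarrow> 'a::comm_ring_1) \<Rightarrow> poly3 \<Rightarrow> 'a^3 \<Rightarrow> 'a" where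
  "subst3 h P v =
     poly (map_poly (\<lambda>Q. poly (map_poly (\<lambda>R. poly (map_poly h R) (v$1)) Q) (v$2)) P) (v$3)"

definition eval3 :: "poly3 \<Rightarrow> complex^3 \<Rightarrow> complex" where
  "eval3 = subst3 (\<lambda>c. c)"

definition homogeneous3 :: "nat \<Rightarrow> poly3 \<Rightarrow> bool" where
  "homogeneous3 n P \<longleftrightarrow> (\<forall>i j k. coeff (coeff (coeff P k) j) i \<noteq> 0 \<longrightarrow> i + j + k = n)"

definition no_common_factor :: "poly3^3 \<Rightarrow> bool" where
  "no_common_factor V \<longleftrightarrow> (\<forall>f. (\<forall>i. f dvd V$i) \<longrightarrow> f dvd 1)"

definition grad3 :: "poly3 \<Rightarrow> poly3^3" where
  "grad3 P = vector [map_poly (map_poly pderiv) P, map_poly pderiv P, pderiv P]"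

definition cross :: "'a::comm_ring_1^3 \<Rightarrow> 'a^3 \<Rightarrow> 'a^3" where
  "cross u v = vector [u$2 * v$3 - u$3 * v$2, u$3 * v$1 - u$1 * v$3, u$1 * v$2 - u$2 * v$1]"


section \<open>Foliations of the projective plane\<close>

text \<open>
  A point of the projective plane (or of its dual) is represented by its nonzero homogeneous
  coordinate vectors, and a subset by the cone of all coordinate vectors of its points,
  the origin excluded. The vector \<open>l\<close> represents the line \<open>l$1 x + l$2 y + l$3 z = 0\<close>.
  A foliation is represented by the coefficients \<open>(a, b, c)\<close> of its form
  \<open>a dx + b dy + c dz\<close>, and a vector field by its components.
\<close>

definition foliation :: "nat \<Rightarrow> poly3^3 \<Rightarrow> bool" where
  "foliation d \<Omega> \<longleftrightarrow>
     (\<forall>i. homogeneous3 (d + 1) (\<Omega>$i)) \<and> no_common_factor \<Omega> \<and> (\<Sum>i\<in>UNIV. xyz$i * \<Omega>$i) = 0"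

text \<open>The pullback of the form by the linear map \<open>v \<mapsto> g v\<close>, i.e. its expression in the
  projective coordinates \<open>v'\<close> with \<open>v = g v'\<close>.\<close>

definition pullback :: "complex^3^3 \<Rightarrow> poly3^3 \<Rightarrow> poly3^3" where
  "pullback g \<Omega> =
     (let G = (\<chi> i j. const3 (g$i$j)) in (\<chi> i. subst3 const3 (\<Omega>$i) (G *v xyz)) v* G)"

definition homothety :: "complex \<Rightarrow> complex^3^3" where
  "homothety t = vector [vector [t, 0, 0], vector [0, t, 0], vector [0, 0, 1]]"

definition homogeneous_foliation :: "poly3^3 \<Rightarrow> bool" where
  "homogeneous_foliation \<Omega> \<longleftrightarrow>
     (\<exists>g. invertible g \<and>
        (\<forall>t. t \<noteq> 0 \<longrightarrow>
           (\<exists>\<mu>. \<mu> \<noteq> 0 \<and> pullback (homothety t) (pullback g \<Omega>) = const3 \<mu> *s pullback g \<Omega>)))"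

text \<open>The contraction \<open>i\<^sub>R i\<^sub>Z (dx \<and> dy \<and> dz)\<close> is the form \<open>w \<mapsto> det (Z, R, w)\<close>,
  whose coefficients are those of the cross product of \<open>Z\<close> and \<open>R = (x, y, z)\<close>.\<close>

definition describes :: "nat \<Rightarrow> poly3^3 \<Rightarrow> poly3^3 \<Rightarrow> bool" where
  "describes d Z \<Omega> \<longleftrightarrow>
     (\<forall>i. homogeneous3 d (Z$i)) \<and> no_common_factor Z \<and> \<Omega> = cross Z xyz"

text \<open>The field is unique up to adding a multiple of \<open>R\<close>, which does not change the
  inflection divisor.\<close>

definition foliation_field :: "nat \<Rightarrow> poly3^3 \<Rightarrow> poly3^3" where
  "foliation_field d \<Omega> = (SOME Z. describes d Z \<Omega>)"

definition lie :: "poly3^3 \<Rightarrow> poly3 \<Rightarrow> poly3" where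
  "lie Z f = (\<Sum>i\<in>UNIV. Z$i * grad3 f$i)"

definition inflection_poly :: "nat \<Rightarrow> poly3^3 \<Rightarrow> poly3" where
  "inflection_poly d \<Omega> =
     (let Z = foliation_field d \<Omega>
      in det (\<chi> i. vector [xyz$i, lie Z (xyz$i), lie Z (lie Z (xyz$i))]))"

text \<open>The curve \<open>f = 0\<close> is invariant iff \<open>f\<close> divides the 2-form \<open>\<Omega> \<and> df\<close>.\<close>

definition invariant_curve :: "poly3^3 \<Rightarrow> poly3 \<Rightarrow> bool" where
  "invariant_curve \<Omega> f \<longleftrightarrow> (\<forall>i. f dvd cross \<Omega> (grad3 f)$i)"

definition zeros :: "poly3 \<Rightarrow> (complex^3) set" where
  "zeros f = {v. v \<noteq> 0 \<and> eval3 f v = 0}"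

text \<open>The support of the transverse part of the inflection divisor.\<close>

definition transverse_inflection :: "nat \<Rightarrow> poly3^3 \<Rightarrow> (complex^3) set" where
  "transverse_inflection d \<Omega> =
     (\<Union>f \<in> {f. irreducible f \<and> f dvd inflection_poly d \<Omega> \<and> \<not> invariant_curve \<Omega> f}. zeros f)"

text \<open>The tangent line at a point \<open>v\<close> with \<open>\<Omega>(v) \<noteq> 0\<close> is the kernel of \<open>\<Omega>(v)\<close>.\<close>

definition eval_form :: "poly3^3 \<Rightarrow> complex^3 \<Rightarrow> complex^3" where
  "eval_form \<Omega> v = (\<chi> i. eval3 (\<Omega>$i) v)"

definition gauss_image :: "poly3^3 \<Rightarrow> (complex^3) set \<Rightarrow> (complex^3) set" where
  "gauss_image \<Omega> C =
     closure {\<mu> *s eval_form \<Omega> v | \<mu> v. v \<in> C \<and> eval_form \<Omega> v \<noteq> 0 \<and> \<mu> \<noteq> 0} - {0}"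


section \<open>Webs in two complex variables and their curvature\<close>

text \<open>
  The pair \<open>(a, b)\<close> is the covector \<open>a du + b dv\<close>; 2-forms are identified with their
  coefficient of \<open>du \<and> dv\<close>. A symmetric form of degree \<open>k\<close> is given by its value at a
  point and a tangent vector.
\<close>

type_synonym c2 = "complex \<times> complex"
type_synonym one_form = "c2 \<Rightarrow> c2"
type_synonym sym_form = "c2 \<Rightarrow> c2 \<Rightarrow> complex"

definition holomorphic2_on :: "(c2 \<Rightarrow> complex) \<Rightarrow> c2 set \<Rightarrow> bool" where
  "holomorphic2_on f U \<longleftrightarrow>
     open U \<and> (\<forall>m\<in>U. \<exists>a b. (f has_derivative (\<lambda>h. a * fst h + b * snd h)) (at m))"

definition wedge :: "c2 \<Rightarrow> c2 \<Rightarrow> complex" where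
  "wedge \<alpha> \<beta> = fst \<alpha> * snd \<beta> - snd \<alpha> * fst \<beta>"

definition scale2 :: "complex \<Rightarrow> c2 \<Rightarrow> c2" where
  "scale2 c \<alpha> = (c * fst \<alpha>, c * snd \<alpha>)"

definition ext_deriv :: "one_form \<Rightarrow> c2 \<Rightarrow> complex" where
  "ext_deriv \<theta> m =
     deriv (\<lambda>u. snd (\<theta> (u, snd m))) (fst m) - deriv (\<lambda>v. fst (\<theta> (fst m, v))) (snd m)"

text \<open>\<open>\<W>\<close> is, on the open set \<open>N\<close>, the superposition of the foliations of the
  \<open>\<theta> i\<close>, \<open>i < k\<close>.\<close>

definition decomposes :: "nat \<Rightarrow> sym_form \<Rightarrow> c2 set \<Rightarrow> (nat \<Rightarrow> one_form) \<Rightarrow> bool" where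
  "decomposes k \<W> N \<theta> \<longleftrightarrow>
     open N \<and>
     (\<forall>i<k. holomorphic2_on (\<lambda>m. fst (\<theta> i m)) N \<and> holomorphic2_on (\<lambda>m. snd (\<theta> i m)) N) \<and>
     (\<forall>m\<in>N. \<forall>i<k. \<forall>j<k. i \<noteq> j \<longrightarrow> wedge (\<theta> i m) (\<theta> j m) \<noteq> 0) \<and>
     (\<forall>m\<in>N. \<forall>\<xi>. \<W> m \<xi> = (\<Prod>i<k. fst (\<theta> i m) * fst \<xi> + snd (\<theta> i m) * snd \<xi>))"

definition discriminant :: "nat \<Rightarrow> sym_form \<Rightarrow> c2 set" where
  "discriminant k \<W> = {m. \<not> (\<exists>N \<theta>. decomposes k \<W> N \<theta> \<and> m \<in> N)}"

text \<open>\<open>weighted \<theta> r s t\<close> is \<open>\<delta>\<^sub>s\<^sub>t \<theta>\<^sub>r\<close>.\<close>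

definition weighted :: "(nat \<Rightarrow> one_form) \<Rightarrow> nat \<Rightarrow> nat \<Rightarrow> nat \<Rightarrow> one_form" where
  "weighted \<theta> r s t m = scale2 (wedge (\<theta> s m) (\<theta> t m)) (\<theta> r m)"

definition eta :: "(nat \<Rightarrow> one_form) \<Rightarrow> nat \<Rightarrow> nat \<Rightarrow> nat \<Rightarrow> one_form" where
  "eta \<theta> r s t m =
     (THE e. ext_deriv (weighted \<theta> r s t) m = wedge e (weighted \<theta> r s t m) \<and>
             ext_deriv (weighted \<theta> s t r) m = wedge e (weighted \<theta> s t r m) \<and>
             ext_deriv (weighted \<theta> t r s) m = wedge e (weighted \<theta> t r s m))"

definition superposition_curvature :: "nat \<Rightarrow> (nat \<Rightarrow> one_form) \<Rightarrow> c2 \<Rightarrow> complex" where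
  "superposition_curvature k \<theta> =
     ext_deriv (\<lambda>m. \<Sum>(r, s, t) \<in> {(r, s, t). r < s \<and> s < t \<and> t < k}. eta \<theta> r s t m)"

text \<open>Meaningful off the discriminant, where the curvature does not depend on the
  decomposition.\<close>

definition curvature :: "nat \<Rightarrow> sym_form \<Rightarrow> c2 \<Rightarrow> complex" where
  "curvature k \<W> m =
     (THE \<kappa>. \<exists>N \<theta>. decomposes k \<W> N \<theta> \<and> m \<in> N \<and> \<kappa> = superposition_curvature k \<theta> m)"


section \<open>Webs on the dual projective plane\<close>

text \<open>
  Projective coordinates \<open>v'\<close> on the plane, \<open>v = g v'\<close> with \<open>g\<close> invertible, give an affine
  chart \<open>(p, q)\<close> of the dual plane, in which \<open>(p, q)\<close> is the line \<open>y' = p x' - q z'\<close>.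
  A web on the dual plane is given by a symmetric form in each of these charts.
\<close>

type_synonym dual_web = "complex^3^3 \<Rightarrow> sym_form"

definition in_dual_chart :: "complex^3^3 \<Rightarrow> complex^3 \<Rightarrow> c2 \<Rightarrow> bool" where
  "in_dual_chart g l m \<longleftrightarrow> (\<exists>\<mu>. \<mu> \<noteq> 0 \<and> l v* g = \<mu> *s vector [fst m, -1, - snd m])"

text \<open>
  For \<open>\<Omega>\<close> described by \<open>A dx + B dy\<close> in the chart \<open>z = 1\<close>, this is the polynomial
  \<open>A(X, p X - q) + p B(X, p X - q)\<close> in \<open>X\<close>. Its degree is at most the degree of the foliation.
\<close>

definition legendre_poly :: "poly3^3 \<Rightarrow> c2 \<Rightarrow> complex poly" where
  "legendre_poly \<Omega> m =
     (let \<gamma> = vector [[:0, 1:], [:- snd m, fst m:], 1]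
      in subst3 (\<lambda>c. [:c:]) (\<Omega>$1) \<gamma> + [:fst m:] * subst3 (\<lambda>c. [:c:]) (\<Omega>$2) \<gamma>)"

text \<open>The substitution \<open>X = dq / dp\<close>, multiplied by \<open>dp\<^sup>d\<close>.\<close>

definition legendre_transform :: "nat \<Rightarrow> poly3^3 \<Rightarrow> dual_web" where
  "legendre_transform d \<Omega> g m \<xi> =
     (\<Sum>j\<le>d. coeff (legendre_poly (pullback g \<Omega>) m) j * snd \<xi> ^ j * fst \<xi> ^ (d - j))"

definition flat_web :: "nat \<Rightarrow> dual_web \<Rightarrow> bool" where
  "flat_web k \<W> \<longleftrightarrow>
     (\<forall>g. invertible g \<longrightarrow> (\<forall>m. m \<notin> discriminant k (\<W> g) \<longrightarrow> curvature k (\<W> g) m = 0))"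

definition curvature_holomorphic_at :: "nat \<Rightarrow> dual_web \<Rightarrow> complex^3 \<Rightarrow> bool" where
  "curvature_holomorphic_at k \<W> l \<longleftrightarrow>
     (\<exists>g m N f. invertible g \<and> in_dual_chart g l m \<and> m \<in> N \<and> holomorphic2_on f N \<and>
        (\<forall>x \<in> N - discriminant k (\<W> g). curvature k (\<W> g) x = f x))"

text \<open>
  The irreducible components of a curve \<open>C\<close> are the irreducible curves \<open>h = 0\<close> contained
  in it; a property holds at the generic points of such a component if it holds off the zero
  locus of a form that does not vanish identically on it.
\<close>

definition curvature_holomorphic_along :: "nat \<Rightarrow> dual_web \<Rightarrow> (complex^3) set \<Rightarrow> bool" where
  "curvature_holomorphic_along k \<W> C \<longleftrightarrow>
     (\<forall>n h. homogeneous3 n h \<and> irreducible h \<and> zeros h \<subseteq> C \<longrightarrow>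
        (\<exists>n' r. homogeneous3 n' r \<and> \<not> h dvd r \<and>
           (\<forall>l \<in> zeros h - zeros r. curvature_holomorphic_at k \<W> l)))"

end

theory Submission
  imports Defs "HOL-Complex_Analysis.Conformal_Mappings"
    "HOL-Computational_Algebra.Fundamental_Theorem_Algebra"
begin

text \<open>
  In suitable affine coordinates the foliation is \<open>A dx + B dy\<close> with \<open>A\<close>, \<open>B\<close> homogeneous of degree
  \<open>d\<close>; put \<open>a(s) = A(1, s)\<close> and \<open>b(s) = B(1, s)\<close>. The line \<open>y = p x - q\<close> is tangent to the foliation at
  the points whose direction \<open>s = y/x\<close> from the centre satisfies \<open>a(s) + p b(s) = 0\<close>. If
  \<open>\<sigma>\<^sub>1(p), \<dots>, \<sigma>\<^sub>d(p)\<close> are these directions, the Legendre transform is the superposition of the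
  foliations \<open>(p - \<sigma>\<^sub>i(p)) dq/q - dp\<close>, which are invariant under \<open>q \<mapsto> c q\<close>. For a web with this symmetry
  the equations for \<open>\<eta>\<^sub>r\<^sub>s\<^sub>t\<close> can be solved explicitly (\<open>pencil_curvature\<close>), and the curvature is
  \<open>S'(p) dp \<and> dq/q\<close> (\<open>curvature_normal_chart\<close>), where \<open>S\<close> is a symmetric rational expression in the
  \<open>\<sigma>\<^sub>i\<close> and their derivatives, called \<open>total_height\<close> below. It is a holomorphic function of \<open>p\<close> away
  from the critical values of the map \<open>s \<mapsto> - a(s)/b(s)\<close>, which is the Gauss map. Flatness means \<open>S' = 0\<close>.

  Let \<open>p0\<close> be a critical value. If some critical point \<open>s0\<close> over \<open>p0\<close> differs from \<open>p0\<close>, the line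
  \<open>y = s0 x\<close> consists of inflection points and is not invariant, and the Gauss map sends it onto the
  line \<open>p = p0\<close> of the dual plane (\<open>critical_slope_in_gauss_image\<close>). The hypothesis says that the
  curvature is holomorphic along this line, so \<open>S'\<close> has a finite limit at \<open>p0\<close>
  (\<open>limit_at_inflection_slope\<close>). If all critical points over \<open>p0\<close> are equal to \<open>p0\<close>, that is, if the
  corresponding line is invariant, the terms \<open>p - \<sigma>\<^sub>i(p)\<close> vanish at the critical point together
  with the differences of the \<open>\<sigma>\<^sub>i\<close>, and an estimate shows that \<open>(p - p0) S(p)\<close> tends to \<open>0\<close>
  (\<open>radial_limit\<close>); so \<open>S\<close> itself extends holomorphically.

  These arguments need that the fibre over \<open>p0\<close> does not contain the vertical direction \<open>s = \<infinity>\<close>, which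
  a linear change of the affine coordinates achieves, for \<open>p0 = \<infinity>\<close> too. The curvature does not
  depend on these coordinates, so \<open>S'\<close> extends to an entire function that tends to \<open>0\<close> at infinity;
  it vanishes by Liouville's theorem (\<open>total_height_constant\<close>). The converse implication holds because
  \<open>0\<close> is holomorphic.
\<close>

section \<open>Evaluation of polynomials in three variables\<close>

definition unital_hom :: "('a::comm_ring_1 \<Rightarrow> 'b::comm_ring_1) \<Rightarrow> bool" where
  "unital_hom h \<longleftrightarrow> h 0 = 0 \<and> h 1 = 1 \<and> (\<forall>a b. h (a + b) = h a + h b) \<and> (\<forall>a b. h (a * b) = h a * h b)"

lemma unital_homD:
  assumes "unital_hom h"
  shows "h 0 = 0" "h 1 = 1" "h (a + b) = h a + h b" "h (a * b) = h a * h b"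
    "h (- a) = - h a" "h (a - b) = h a - h b"
proof -
  show *: "h 0 = 0" "h 1 = 1" "h (a + b) = h a + h b" "h (a * b) = h a * h b" for a b
    using assms by (auto simp: unital_hom_def)
  have "h a + h (- a) = 0" for a using *(3)[of a "-a"] *(1) by simp
  then show "h (- a) = - h a" for a by (metis add.inverse_unique)
  then show "h (a - b) = h a - h b" using *(3)[of a "-b"] by simp
qed

lemma unital_hom_map_poly:
  assumes h: "unital_hom h"
  shows "unital_hom (\<lambda>R. poly (map_poly h R) x)"
proof -
  note hD = unital_homD[OF h]
  have add: "map_poly h (p + q) = map_poly h p + map_poly h q" for p q
    by (rule poly_eqI) (simp add: coeff_map_poly hD)
  have sm: "map_poly h (smult a q) = smult (h a) (map_poly h q)" for a q
    by (rule poly_eqI) (simp add: coeff_map_poly hD)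
  have "map_poly h (p * q) = map_poly h p * map_poly h q" for p q
    by (induct p) (simp_all add: hD map_poly_pCons add sm)
  with add show ?thesis
    by (auto simp: unital_hom_def hD map_poly_1)
qed

lemma unital_hom_id: "unital_hom (\<lambda>c. c)"
  by (simp add: unital_hom_def)

lemma unital_hom_const3: "unital_hom const3"
  by (simp add: unital_hom_def const3_def one_pCons)

lemma unital_hom_const_poly: "unital_hom (\<lambda>c. [:c:])"
  by (simp add: unital_hom_def one_pCons)

lemma unital_hom_subst3:
  assumes "unital_hom h"
  shows "unital_hom (\<lambda>P. subst3 h P v)"
  unfolding subst3_def by (intro unital_hom_map_poly assms)

lemma unital_hom_eval3: "unital_hom (\<lambda>P. eval3 P v)"
  unfolding eval3_def by (intro unital_hom_subst3 unital_hom_id)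

lemmas eval3_simps [simp] = unital_homD[OF unital_hom_eval3]

lemma eval3_sum: "eval3 (sum f A) v = (\<Sum>i\<in>A. eval3 (f i) v)"
  by (induct A rule: infinite_finite_induct) auto

lemma subst3_const3: "unital_hom h \<Longrightarrow> subst3 h (const3 c) v = h c"
  by (simp add: subst3_def const3_def map_poly_pCons unital_homD)

lemma subst3_xyz: "unital_hom h \<Longrightarrow> subst3 h (xyz$i) v = v$i"
  using exhaust_3[of i]
  by (auto simp: subst3_def xyz_def vector_3 map_poly_pCons unital_homD)

lemma eval3_const3 [simp]: "eval3 (const3 c) v = c"
  by (simp add: eval3_def subst3_const3 unital_hom_id)

lemma eval3_xyz [simp]: "eval3 (xyz$i) v = v$i"
  by (simp add: eval3_def subst3_xyz unital_hom_id)

lemma hom_poly_map_poly: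
  assumes "unital_hom \<phi>" "F 0 = 0"
  shows "\<phi> (poly (map_poly F P) x) = poly (map_poly (\<lambda>R. \<phi> (F R)) P) (\<phi> x)"
  by (induct P) (simp_all add: unital_homD[OF assms(1)] assms(2) map_poly_pCons)

lemma hom_subst3:
  assumes \<phi>: "unital_hom \<phi>" and h: "unital_hom h"
  shows "\<phi> (subst3 h P v) = subst3 (\<lambda>c. \<phi> (h c)) P (\<chi> i. \<phi> (v$i))"
  unfolding subst3_def using h
  by (simp add: hom_poly_map_poly[OF \<phi>] unital_homD[OF h])

lemma eval3_subst3: "eval3 (subst3 const3 P w) v = eval3 P (\<chi> i. eval3 (w$i) v)"
  using hom_subst3[where \<phi>="\<lambda>P. eval3 P v" and P=P and v=w, OF unital_hom_eval3 unital_hom_const3,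
      unfolded eval3_const3]
  by (simp add: eval3_def)

lemma poly_subst3: "poly (subst3 (\<lambda>c. [:c:]) P w) t = eval3 P (\<chi> i. poly (w$i) t)"
proof -
  have "unital_hom (\<lambda>p. poly p t)" by (simp add: unital_hom_def)
  from hom_subst3[OF this unital_hom_const_poly, of P w] show ?thesis
    by (simp add: eval3_def)
qed

text \<open>Restricting a polynomial to a line reduces questions about three variables to one.\<close>

lemma eval3_on_line: "\<exists>p. \<forall>t. poly p t = eval3 P (u + t *s w)"
proof (intro exI allI)
  fix t show "poly (subst3 (\<lambda>c. [:c:]) P (\<chi> i. [:u$i, w$i:])) t = eval3 P (u + t *s w)"
    unfolding poly_subst3 by (rule arg_cong[where f="eval3 P"]) (simp add: vec_eq_iff)
qed

lemma eval3_eq_0_imp: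
  assumes "\<And>v. eval3 P v = 0"
  shows "P = 0"
proof -
  have vec: "subst3 (\<lambda>c. c) P (vector [x, y, z]) = 0" for x y z
    using assms by (simp add: eval3_def)
  have 1: "poly (map_poly (\<lambda>R. poly R x) (coeff P k)) y = 0" for x y k
  proof -
    have "map_poly (\<lambda>Q. poly (map_poly (\<lambda>R. poly R x) Q) y) P = 0"
      using vec[of x y] by (intro poly_all_0_iff_0[THEN iffD1] allI) (simp add: subst3_def vector_3)
    then have "coeff (map_poly (\<lambda>Q. poly (map_poly (\<lambda>R. poly R x) Q) y) P) k = 0" by simp
    then show ?thesis by (subst (asm) coeff_map_poly) simp_all
  qed
  then have "map_poly (\<lambda>R. poly R x) (coeff P k) = 0" for x k
    by (intro poly_all_0_iff_0[THEN iffD1] allI)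
  then have "poly (coeff (coeff P k) j) x = 0" for x j k
    by (metis coeff_0 coeff_map_poly poly_0)
  then have "coeff (coeff P k) j = 0" for j k
    by (intro poly_all_0_iff_0[THEN iffD1] allI)
  then show ?thesis by (intro poly_eqI) (metis coeff_0 poly_eqI)
qed

lemma eval3_eqI:
  assumes "\<And>v. eval3 P v = eval3 Q v"
  shows "P = Q"
  using eval3_eq_0_imp[of "P - Q"] assms by simp

lemma poly_map_poly_sum:
  fixes h :: "'a::comm_ring_1 \<Rightarrow> 'b::comm_ring_1"
  assumes "h 0 = 0"
  shows "poly (map_poly h R) x = (\<Sum>i\<le>degree R. h (coeff R i) * x ^ i)"
proof -
  have "poly (map_poly h R) x = (\<Sum>i\<le>degree (map_poly h R). h (coeff R i) * x ^ i)"
    by (simp add: poly_altdef coeff_map_poly assms)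
  also have "\<dots> = (\<Sum>i\<le>degree R. h (coeff R i) * x ^ i)"
  proof (rule sum.mono_neutral_left)
    show "\<forall>i\<in>{..degree R} - {..degree (map_poly h R)}. h (coeff R i) * x ^ i = 0"
    proof
      fix i assume "i \<in> {..degree R} - {..degree (map_poly h R)}"
      then have "coeff (map_poly h R) i = 0" by (intro coeff_eq_0) auto
      then show "h (coeff R i) * x ^ i = 0" by (simp add: coeff_map_poly assms)
    qed
  qed (auto simp: map_poly_degree_leq)
  finally show ?thesis .
qed

lemma eval3_sum_coeffs:
  "eval3 P v = (\<Sum>k\<le>degree P. \<Sum>j\<le>degree (coeff P k). \<Sum>i\<le>degree (coeff (coeff P k) j).
      coeff (coeff (coeff P k) j) i * v$1 ^ i * v$2 ^ j * v$3 ^ k)"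
  unfolding eval3_def subst3_def
  by (simp add: poly_map_poly_sum sum_distrib_right poly_altdef[of "coeff _ _"])

lemma eval3_scale:
  assumes "homogeneous3 n P"
  shows "eval3 P (t *s v) = t ^ n * eval3 P v"
  unfolding eval3_sum_coeffs sum_distrib_left
proof (intro sum.cong refl)
  fix i j k
  let ?c = "coeff (coeff (coeff P k) j) i"
  show "?c * (t *s v) $ 1 ^ i * (t *s v) $ 2 ^ j * (t *s v) $ 3 ^ k
      = t ^ n * (?c * v $ 1 ^ i * v $ 2 ^ j * v $ 3 ^ k)"
  proof (cases "?c = 0")
    case False
    then have "n = i + j + k" using assms by (auto simp: homogeneous3_def)
    then show ?thesis by (simp add: power_mult_distrib power_add)
  qed simp
qed

lemma has_field_derivative_poly_map_poly:
  fixes F :: "'a::idom \<Rightarrow> complex \<Rightarrow> complex"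
  assumes hom: "\<And>t. unital_hom (\<lambda>Q. F Q t)"
    and F': "\<And>Q. ((\<lambda>t. F Q t) has_field_derivative F' Q) (at t)" and F0: "F' 0 = 0"
    and x: "(x has_field_derivative x') (at t)"
  shows "((\<lambda>t. poly (map_poly (\<lambda>Q. F Q t) P) (x t)) has_field_derivative
      poly (map_poly F' P) (x t) + x' * poly (map_poly (\<lambda>Q. F Q t) (pderiv P)) (x t)) (at t)"
proof (induct P)
  case 0 then show ?case by simp
next
  case (pCons a p)
  note h = unital_homD[OF hom]
  have add: "map_poly (\<lambda>Q. F Q t) (p + q) = map_poly (\<lambda>Q. F Q t) p + map_poly (\<lambda>Q. F Q t) q" for p q
    by (rule poly_eqI) (simp add: coeff_map_poly h)
  show ?case
    by (rule derivative_eq_intros refl F' pCons x | simp add: map_poly_pCons h F0)+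
       (simp add: pderiv_pCons add map_poly_pCons h algebra_simps)
qed

lemma eval3_grad3:
  "eval3 (grad3 P $ 1) v = poly (map_poly (\<lambda>Q. poly (map_poly (\<lambda>R. poly (pderiv R) (v$1)) Q) (v$2)) P) (v$3)"
  "eval3 (grad3 P $ 2) v = poly (map_poly (\<lambda>Q. poly (map_poly (\<lambda>R. poly R (v$1)) (pderiv Q)) (v$2)) P) (v$3)"
  "eval3 (grad3 P $ 3) v = poly (map_poly (\<lambda>Q. poly (map_poly (\<lambda>R. poly R (v$1)) Q) (v$2)) (pderiv P)) (v$3)"
  by (simp_all add: eval3_def subst3_def grad3_def vector_3 map_poly_map_poly o_def)

text \<open>The formal gradient computes directional derivatives; this transports the chain rule
  to formal polynomials.\<close>

lemma eval3_has_field_derivative: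
  "((\<lambda>t. eval3 P (v + t *s w)) has_field_derivative
      (\<Sum>i\<in>UNIV. w$i * eval3 (grad3 P $ i) (v + t *s w))) (at t)"
proof -
  have lin: "((\<lambda>t. (v + t *s w) $ i) has_field_derivative w$i) (at t)" for t i
    by (auto intro!: derivative_eq_intros)
  have hom1: "unital_hom (\<lambda>R. poly R ((v + t *s w) $ 1))" for t
    using unital_hom_map_poly[OF unital_hom_id] by simp
  have d1: "((\<lambda>t. poly R ((v + t *s w) $ 1)) has_field_derivative
      w$1 * poly (pderiv R) ((v + t *s w) $ 1)) (at t)" for R t
    using DERIV_chain2[OF poly_DERIV lin[of 1 t]] by (simp add: mult.commute)
  have sm: "poly (map_poly (\<lambda>R. c * f R) Q) x = c * poly (map_poly f Q) x"
    if "f 0 = 0" for c x :: complex and f :: "'a::comm_ring_1 \<Rightarrow> complex" and Q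
    by (simp add: poly_map_poly_sum that sum_distrib_left mult_ac)
  have ad: "poly (map_poly (\<lambda>R. f R + g R) Q) x = poly (map_poly f Q) x + poly (map_poly g Q) x"
    if "f 0 = 0" "g 0 = 0" for x :: complex and f g :: "'a::comm_ring_1 \<Rightarrow> complex" and Q
    by (simp add: poly_map_poly_sum that sum.distrib algebra_simps)
  define F where "F = (\<lambda>Q t. poly (map_poly (\<lambda>R. poly R ((v + t *s w) $ 1)) Q) ((v + t *s w) $ 2))"
  have d2: "((\<lambda>t. F Q t) has_field_derivative
      poly (map_poly (\<lambda>R. w$1 * poly (pderiv R) ((v + t *s w) $ 1)) Q) ((v + t *s w) $ 2)
      + w$2 * F (pderiv Q) t) (at t)" for Q t
    unfolding F_def by (rule has_field_derivative_poly_map_poly[OF hom1 d1 _ lin]) simp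
  have hom2: "unital_hom (\<lambda>Q. F Q t)" for t
    unfolding F_def by (rule unital_hom_map_poly[OF hom1])
  have d3: "((\<lambda>t. poly (map_poly (\<lambda>Q. F Q t) P) ((v + t *s w) $ 3)) has_field_derivative
      poly (map_poly (\<lambda>Q. poly (map_poly (\<lambda>R. w$1 * poly (pderiv R) ((v + t *s w) $ 1)) Q) ((v + t *s w) $ 2)
        + w$2 * F (pderiv Q) t) P) ((v + t *s w) $ 3)
      + w$3 * poly (map_poly (\<lambda>Q. F Q t) (pderiv P)) ((v + t *s w) $ 3)) (at t)"
    by (rule has_field_derivative_poly_map_poly[OF hom2 d2 _ lin]) (simp add: F_def)
  have "(\<lambda>t. eval3 P (v + t *s w)) = (\<lambda>t. poly (map_poly (\<lambda>Q. F Q t) P) ((v + t *s w) $ 3))"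
    by (simp add: eval3_def subst3_def F_def)
  then show ?thesis
    using d3 by (simp add: sum_3 eval3_grad3 sm ad F_def)
qed

lemma dvd_poly_map_poly_diff:
  fixes f a b :: "'b::comm_ring_1" and F G :: "'a::comm_ring_1 \<Rightarrow> 'b"
  assumes "f dvd a - b" "\<And>Q. f dvd F Q - G Q" "F 0 = 0" "G 0 = 0"
  shows "f dvd poly (map_poly F P) a - poly (map_poly G P) b"
proof (induct P)
  case 0 then show ?case by simp
next
  case (pCons c p)
  have "poly (map_poly F (pCons c p)) a - poly (map_poly G (pCons c p)) b
      = (F c - G c) + (a - b) * poly (map_poly F p) a
        + b * (poly (map_poly F p) a - poly (map_poly G p) b)"
    by (simp add: map_poly_pCons assms algebra_simps)
  then show ?case using pCons assms by (simp add: dvd_add dvd_mult dvd_mult2)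
qed

lemma dvd_subst3_diff:
  fixes f :: "'a::comm_ring_1"
  assumes "\<And>i. f dvd v$i - w$i" "unital_hom h"
  shows "f dvd subst3 h P v - subst3 h P w"
  unfolding subst3_def
  by (intro dvd_poly_map_poly_diff assms) (simp_all add: unital_homD[OF assms(2)])

section \<open>Linear forms and planes\<close>

definition dot3 :: "complex^3 \<Rightarrow> complex^3 \<Rightarrow> complex" where
  "dot3 l v = l$1 * v$1 + l$2 * v$2 + l$3 * v$3"

definition linear_form :: "complex^3 \<Rightarrow> poly3" where
  "linear_form l = const3 (l$1) * xyz$1 + const3 (l$2) * xyz$2 + const3 (l$3) * xyz$3"

lemma eval3_linear_form [simp]: "eval3 (linear_form l) v = dot3 l v"
  by (simp add: linear_form_def dot3_def)

lemma dot3_eq_1: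
  assumes "l \<noteq> 0"
  obtains e where "dot3 l e = 1"
proof -
  obtain i where "l$i \<noteq> 0" using assms by (auto simp: vec_eq_iff)
  then have "dot3 l (\<chi> j. if j = i then 1 / l$i else 0) = 1"
    using exhaust_3[of i] by (auto simp: dot3_def)
  then show thesis by (rule that)
qed

text \<open>The Nullstellensatz for a plane. Choose \<open>e\<close> with \<open>l(e) = 1\<close>; modulo the linear form \<open>l\<close>,
  substituting \<open>v - l(v) e\<close> for \<open>v\<close> changes nothing, and the substituted polynomial only sees the
  values on the plane.\<close>

lemma linear_form_dvd_iff:
  assumes l: "l \<noteq> 0"
  shows "linear_form l dvd P \<longleftrightarrow> (\<forall>v. dot3 l v = 0 \<longrightarrow> eval3 P v = 0)"
proof
  assume "linear_form l dvd P"
  then show "\<forall>v. dot3 l v = 0 \<longrightarrow> eval3 P v = 0" by (auto elim!: dvdE)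
next
  assume *: "\<forall>v. dot3 l v = 0 \<longrightarrow> eval3 P v = 0"
  obtain e where e: "dot3 l e = 1" using dot3_eq_1[OF l] .
  let ?w = "\<chi> i. xyz$i - linear_form l * const3 (e$i)"
  have "linear_form l dvd subst3 const3 P xyz - subst3 const3 P ?w"
    by (intro dvd_subst3_diff unital_hom_const3) simp
  moreover have "subst3 const3 P xyz = P"
    by (rule eval3_eqI) (simp add: eval3_subst3)
  moreover have "subst3 const3 P ?w = 0"
  proof (rule eval3_eq_0_imp)
    fix v
    have "dot3 l (\<chi> i. v$i - dot3 l v * e$i) = dot3 l v - dot3 l v * dot3 l e"
      by (simp add: dot3_def algebra_simps)
    then show "eval3 (subst3 const3 P ?w) v = 0"
      using * by (simp add: eval3_subst3 e)
  qed
  ultimately show "linear_form l dvd P" by simp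
qed

lemma linear_form_prime:
  assumes l: "l \<noteq> 0"
  shows "prime_elem (linear_form l)"
proof (rule prime_elemI)
  obtain e where e: "dot3 l e = 1" using dot3_eq_1[OF l] .
  then show "linear_form l \<noteq> 0" by (metis eval3_linear_form eval3_simps(1) zero_neq_one)
  show "\<not> linear_form l dvd 1"
    unfolding linear_form_dvd_iff[OF l] by (auto simp: dot3_def intro!: exI[of _ 0])
next
  fix P Q assume PQ: "linear_form l dvd P * Q"
  show "linear_form l dvd P \<or> linear_form l dvd Q"
  proof (rule ccontr)
    assume "\<not> ?thesis"
    then obtain u w where uw: "dot3 l u = 0" "eval3 P u \<noteq> 0" "dot3 l w = 0" "eval3 Q w \<noteq> 0"
      by (auto simp: linear_form_dvd_iff[OF l])
    obtain p where p: "\<And>t. poly p t = eval3 P (u + t *s (w - u))" using eval3_on_line by blast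
    obtain q where q: "\<And>t. poly q t = eval3 Q (u + t *s (w - u))" using eval3_on_line by blast
    have "poly (p * q) t = 0" for t
    proof -
      have "dot3 l (u + t *s (w - u)) = (1 - t) * dot3 l u + t * dot3 l w"
        by (simp add: dot3_def algebra_simps)
      then show ?thesis using PQ uw by (auto simp: linear_form_dvd_iff[OF l] p q)
    qed
    then have "p * q = 0" by (intro poly_all_0_iff_0[THEN iffD1] allI)
    moreover have "poly p 0 \<noteq> 0" "poly q 1 \<noteq> 0" using uw by (simp_all add: p q)
    ultimately show False by auto
  qed
qed

lemma linear_form_irreducible: "l \<noteq> 0 \<Longrightarrow> irreducible (linear_form l)"
  by (intro prime_elem_imp_irreducible linear_form_prime)

lemma linear_form_explicit:
  "linear_form l = [:[:[:0, l$1:], [:l$2:]:], [:[:l$3:]:]:]"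
  by (simp add: linear_form_def const3_def xyz_def vector_3)

lemma homogeneous3_linear_form: "homogeneous3 1 (linear_form l)"
  by (auto simp: homogeneous3_def linear_form_explicit coeff_pCons split: nat.splits)

lemma grad3_linear_form: "grad3 (linear_form l) $ i = const3 (l$i)"
  using exhaust_3[of i]
  by (auto simp: linear_form_explicit grad3_def vector_3 const3_def map_poly_pCons pderiv_pCons)

lemma homogeneous3_1: "homogeneous3 0 1"
  by (auto simp: homogeneous3_def one_pCons coeff_pCons split: nat.splits)

section \<open>Differential calculus in two complex variables\<close>

definition has_grad :: "(c2 \<Rightarrow> complex) \<Rightarrow> c2 \<Rightarrow> c2 \<Rightarrow> bool" where
  "has_grad f c m \<longleftrightarrow> (f has_derivative (\<lambda>h. fst c * fst h + snd c * snd h)) (at m)"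

definition differentiable_form :: "one_form \<Rightarrow> c2 \<Rightarrow> bool" where
  "differentiable_form \<theta> m \<longleftrightarrow>
     (\<exists>a. has_grad (\<lambda>x. fst (\<theta> x)) a m) \<and> (\<exists>b. has_grad (\<lambda>x. snd (\<theta> x)) b m)"

definition closed_form :: "one_form \<Rightarrow> c2 \<Rightarrow> bool" where
  "closed_form \<theta> m \<longleftrightarrow> differentiable_form \<theta> m \<and> ext_deriv \<theta> m = 0"

lemma scale2_simps [simp]:
  "fst (scale2 c a) = c * fst a" "snd (scale2 c a) = c * snd a" "scale2 1 a = a"
  by (simp_all add: scale2_def)

lemma scale2_scale2: "scale2 a (scale2 b v) = scale2 (a * b) v"
  by (simp add: scale2_def)

lemma holomorphic2_on_iff: "holomorphic2_on f U \<longleftrightarrow> open U \<and> (\<forall>m\<in>U. \<exists>c. has_grad f c m)"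
  by (auto simp: holomorphic2_on_def has_grad_def)

lemma has_grad_const [simp]: "has_grad (\<lambda>_. c) 0 m"
  by (simp add: has_grad_def)

lemma has_grad_add:
  "has_grad f a m \<Longrightarrow> has_grad g b m \<Longrightarrow> has_grad (\<lambda>x. f x + g x) (a + b) m"
  unfolding has_grad_def by (auto intro!: derivative_eq_intros simp: algebra_simps)

lemma has_grad_diff:
  "has_grad f a m \<Longrightarrow> has_grad g b m \<Longrightarrow> has_grad (\<lambda>x. f x - g x) (a - b) m"
  unfolding has_grad_def by (auto intro!: derivative_eq_intros simp: algebra_simps)

lemma has_grad_minus: "has_grad f a m \<Longrightarrow> has_grad (\<lambda>x. - f x) (- a) m"
  unfolding has_grad_def by (auto intro!: derivative_eq_intros simp: algebra_simps)

lemma has_grad_mult: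
  "has_grad f a m \<Longrightarrow> has_grad g b m \<Longrightarrow>
     has_grad (\<lambda>x. f x * g x) (scale2 (g m) a + scale2 (f m) b) m"
  unfolding has_grad_def by (auto intro!: derivative_eq_intros simp: algebra_simps)

lemma has_grad_chain:
  assumes "has_grad f a m" "(\<phi> has_field_derivative D) (at (f m))"
  shows "has_grad (\<lambda>x. \<phi> (f x)) (scale2 D a) m"
  using has_derivative_compose[OF assms(1)[unfolded has_grad_def]
      assms(2)[unfolded has_field_derivative_def]]
  by (simp add: has_grad_def algebra_simps)

lemma has_grad_inverse:
  assumes "has_grad f a m" "f m \<noteq> 0"
  shows "has_grad (\<lambda>x. inverse (f x)) (scale2 (- (inverse (f m) ^ 2)) a) m"
  by (rule has_grad_chain[OF assms(1)])
     (use assms(2) in \<open>auto intro!: derivative_eq_intros simp: power2_eq_square\<close>)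

lemma has_grad_unique: "has_grad f a m \<Longrightarrow> has_grad f b m \<Longrightarrow> a = b"
proof -
  assume "has_grad f a m" "has_grad f b m"
  then have "(\<lambda>h. fst a * fst h + snd a * snd h) = (\<lambda>h. fst b * fst h + snd b * snd h)"
    unfolding has_grad_def by (rule has_derivative_unique)
  from fun_cong[OF this, of "(1, 0)"] fun_cong[OF this, of "(0, 1)"] show "a = b"
    by (simp add: prod_eq_iff)
qed

lemma has_grad_isCont: "has_grad f a m \<Longrightarrow> isCont f m"
  unfolding has_grad_def by (rule has_derivative_continuous)

lemma has_grad_cong:
  assumes "\<forall>\<^sub>F x in nhds m. f x = g x" "has_grad f a m"
  shows "has_grad g a m"
proof -
  have "\<forall>\<^sub>F x in at m. f x = g x" "f m = g m"
    using assms(1) eventually_nhds_x_imp_x[OF assms(1)]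
    by (auto simp: eventually_at_filter elim: eventually_mono)
  then show ?thesis
    using has_derivative_transform_eventually[OF assms(2)[unfolded has_grad_def]]
    unfolding has_grad_def by blast
qed

lemma has_grad_partial:
  assumes "has_grad f a m"
  shows "((\<lambda>u. f (u, snd m)) has_field_derivative fst a) (at (fst m))"
    and "((\<lambda>v. f (fst m, v)) has_field_derivative snd a) (at (snd m))"
proof -
  have f: "(f has_derivative (\<lambda>h. fst a * fst h + snd a * snd h)) (at (fst m, snd m))"
    using assms by (simp add: has_grad_def)
  have "((\<lambda>u. (u, snd m)) has_derivative (\<lambda>h. (h, 0))) (at (fst m))"
    by (auto intro!: derivative_eq_intros)
  from has_derivative_compose[OF this f]
  show "((\<lambda>u. f (u, snd m)) has_field_derivative fst a) (at (fst m))"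
    by (simp add: has_field_derivative_def)
  have "((\<lambda>v. (fst m, v)) has_derivative (\<lambda>h. (0, h))) (at (snd m))"
    by (auto intro!: derivative_eq_intros)
  from has_derivative_compose[OF this f]
  show "((\<lambda>v. f (fst m, v)) has_field_derivative snd a) (at (snd m))"
    by (simp add: has_field_derivative_def)
qed

lemma ext_deriv_eq:
  assumes "has_grad (\<lambda>x. fst (\<theta> x)) a m" "has_grad (\<lambda>x. snd (\<theta> x)) b m"
  shows "ext_deriv \<theta> m = fst b - snd a"
  using has_grad_partial(2)[OF assms(1)] has_grad_partial(1)[OF assms(2)]
  by (simp add: ext_deriv_def DERIV_imp_deriv)

lemma ext_deriv_cong:
  assumes "\<forall>\<^sub>F x in nhds m. \<theta> x = \<theta>' x"
  shows "ext_deriv \<theta> m = ext_deriv \<theta>' m"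
proof -
  have c: "filterlim (\<lambda>u. (u, snd m)) (nhds m) (nhds (fst m))"
      "filterlim (\<lambda>v. (fst m, v)) (nhds m) (nhds (snd m))"
    using tendsto_Pair[OF tendsto_ident_at[of "fst m" UNIV] tendsto_const[of "snd m"]]
      tendsto_Pair[OF tendsto_const[of "fst m"] filterlim_ident[of "nhds (snd m)"]]
      tendsto_Pair[OF filterlim_ident[of "nhds (fst m)"] tendsto_const[of "snd m"]]
    by simp_all
  have "\<forall>\<^sub>F u in nhds (fst m). snd (\<theta> (u, snd m)) = snd (\<theta>' (u, snd m))"
       "\<forall>\<^sub>F v in nhds (snd m). fst (\<theta> (fst m, v)) = fst (\<theta>' (fst m, v))"
    using eventually_compose_filterlim[OF assms c(1)] eventually_compose_filterlim[OF assms c(2)]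
    by (auto elim: eventually_mono)
  then show ?thesis unfolding ext_deriv_def by (simp add: deriv_cong_ev)
qed

lemma ext_deriv_add:
  assumes "differentiable_form \<theta> m" "differentiable_form \<theta>' m"
  shows "ext_deriv (\<lambda>x. \<theta> x + \<theta>' x) m = ext_deriv \<theta> m + ext_deriv \<theta>' m"
    and "differentiable_form (\<lambda>x. \<theta> x + \<theta>' x) m"
proof -
  obtain a b a' b' where g: "has_grad (\<lambda>x. fst (\<theta> x)) a m" "has_grad (\<lambda>x. snd (\<theta> x)) b m"
    "has_grad (\<lambda>x. fst (\<theta>' x)) a' m" "has_grad (\<lambda>x. snd (\<theta>' x)) b' m"
    using assms by (auto simp: differentiable_form_def)
  have s: "has_grad (\<lambda>x. fst (\<theta> x + \<theta>' x)) (a + a') m"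
    "has_grad (\<lambda>x. snd (\<theta> x + \<theta>' x)) (b + b') m"
    using has_grad_add[OF g(1,3)] has_grad_add[OF g(2,4)] by simp_all
  show "ext_deriv (\<lambda>x. \<theta> x + \<theta>' x) m = ext_deriv \<theta> m + ext_deriv \<theta>' m"
    using ext_deriv_eq[OF s] ext_deriv_eq[OF g(1,2)] ext_deriv_eq[OF g(3,4)] by simp
  show "differentiable_form (\<lambda>x. \<theta> x + \<theta>' x) m"
    unfolding differentiable_form_def using s by blast
qed

lemma ext_deriv_scale2:
  assumes "has_grad k c m" "differentiable_form \<theta> m"
  shows "ext_deriv (\<lambda>x. scale2 (k x) (\<theta> x)) m = wedge c (\<theta> m) + k m * ext_deriv \<theta> m"
    and "differentiable_form (\<lambda>x. scale2 (k x) (\<theta> x)) m"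
proof -
  obtain a b where g: "has_grad (\<lambda>x. fst (\<theta> x)) a m" "has_grad (\<lambda>x. snd (\<theta> x)) b m"
    using assms by (auto simp: differentiable_form_def)
  have s: "has_grad (\<lambda>x. fst (scale2 (k x) (\<theta> x))) (scale2 (fst (\<theta> m)) c + scale2 (k m) a) m"
    "has_grad (\<lambda>x. snd (scale2 (k x) (\<theta> x))) (scale2 (snd (\<theta> m)) c + scale2 (k m) b) m"
    using has_grad_mult[OF assms(1) g(1)] has_grad_mult[OF assms(1) g(2)] by simp_all
  show "ext_deriv (\<lambda>x. scale2 (k x) (\<theta> x)) m = wedge c (\<theta> m) + k m * ext_deriv \<theta> m"
    unfolding ext_deriv_eq[OF s] ext_deriv_eq[OF g] by (simp add: wedge_def algebra_simps)
  show "differentiable_form (\<lambda>x. scale2 (k x) (\<theta> x)) m"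
    unfolding differentiable_form_def using s by blast
qed

lemma differentiable_form_const: "differentiable_form (\<lambda>_. c) m"
  unfolding differentiable_form_def using has_grad_const by blast

lemma ext_deriv_const: "ext_deriv (\<lambda>_. c) m = 0"
  by (simp add: ext_deriv_def)

lemma closed_form_add:
  "closed_form \<theta> m \<Longrightarrow> closed_form \<theta>' m \<Longrightarrow> closed_form (\<lambda>x. \<theta> x + \<theta>' x) m"
  by (simp add: closed_form_def ext_deriv_add)

lemma closed_form_const_scale:
  "closed_form \<theta> m \<Longrightarrow> closed_form (\<lambda>x. scale2 c (\<theta> x)) m"
  using ext_deriv_scale2[OF has_grad_const, of \<theta> m c]
  by (simp add: closed_form_def wedge_def)

lemma closed_form_cong:
  assumes "\<forall>\<^sub>F x in nhds m. \<theta> x = \<theta>' x" "closed_form \<theta> m"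
  shows "closed_form \<theta>' m"
proof -
  have "\<forall>\<^sub>F x in nhds m. fst (\<theta> x) = fst (\<theta>' x)" "\<forall>\<^sub>F x in nhds m. snd (\<theta> x) = snd (\<theta>' x)"
    using assms(1) by (auto elim: eventually_mono)
  note ev = this
  have "differentiable_form \<theta> m \<Longrightarrow> differentiable_form \<theta>' m"
    unfolding differentiable_form_def using has_grad_cong[OF ev(1)] has_grad_cong[OF ev(2)] by blast
  then show ?thesis using assms(2) ext_deriv_cong[OF assms(1)] by (simp add: closed_form_def)
qed

section \<open>The connection form of a web and its dependence on the decomposition\<close>

lemma wedge_simps:
  "wedge (a + b) c = wedge a c + wedge b c" "wedge c (a + b) = wedge c a + wedge c b"
  "wedge (a - b) c = wedge a c - wedge b c" "wedge c (a - b) = wedge c a - wedge c b"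
  "wedge (scale2 t a) c = t * wedge a c" "wedge c (scale2 t a) = t * wedge c a"
  "wedge a a = 0"
  by (simp_all add: wedge_def algebra_simps)

lemma wedge_flip: "wedge b a = - wedge a b"
  by (simp add: wedge_def)

lemma covector_eqI:
  assumes "wedge e \<alpha> = wedge e' \<alpha>" "wedge e \<beta> = wedge e' \<beta>" "wedge \<alpha> \<beta> \<noteq> 0"
  shows "e = e'"
proof -
  have "(fst e - fst e') * wedge \<alpha> \<beta> = 0" "(snd e - snd e') * wedge \<alpha> \<beta> = 0"
    using assms(1,2) unfolding wedge_def by algebra+
  then show ?thesis using assms(3) by (simp add: prod_eq_iff)
qed

definition transverse_at :: "(nat \<Rightarrow> one_form) \<Rightarrow> c2 \<Rightarrow> nat \<Rightarrow> nat \<Rightarrow> nat \<Rightarrow> bool" where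
  "transverse_at \<theta> m r s t \<longleftrightarrow>
     (\<forall>i\<in>{r,s,t}. differentiable_form (\<theta> i) m) \<and>
     wedge (\<theta> r m) (\<theta> s m) \<noteq> 0 \<and> wedge (\<theta> s m) (\<theta> t m) \<noteq> 0 \<and> wedge (\<theta> t m) (\<theta> r m) \<noteq> 0"

definition is_eta :: "(nat \<Rightarrow> one_form) \<Rightarrow> nat \<Rightarrow> nat \<Rightarrow> nat \<Rightarrow> c2 \<Rightarrow> c2 \<Rightarrow> bool" where
  "is_eta \<theta> r s t m e \<longleftrightarrow>
     ext_deriv (weighted \<theta> r s t) m = wedge e (weighted \<theta> r s t m) \<and>
     ext_deriv (weighted \<theta> s t r) m = wedge e (weighted \<theta> s t r m) \<and>
     ext_deriv (weighted \<theta> t r s) m = wedge e (weighted \<theta> t r s m)"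

lemma wedge_weighted:
  "wedge (weighted \<theta> r s t m) (weighted \<theta> s t r m)
   = wedge (\<theta> s m) (\<theta> t m) * wedge (\<theta> t m) (\<theta> r m) * wedge (\<theta> r m) (\<theta> s m)"
  by (simp add: weighted_def wedge_simps)

lemma eta_eqI:
  assumes "transverse_at \<theta> m r s t" "is_eta \<theta> r s t m e"
  shows "eta \<theta> r s t m = e"
  unfolding eta_def
proof (rule the_equality)
  show "ext_deriv (weighted \<theta> r s t) m = wedge e (weighted \<theta> r s t m) \<and>
        ext_deriv (weighted \<theta> s t r) m = wedge e (weighted \<theta> s t r m) \<and>
        ext_deriv (weighted \<theta> t r s) m = wedge e (weighted \<theta> t r s m)"
    using assms(2) by (simp add: is_eta_def)
next
  fix e' assume "ext_deriv (weighted \<theta> r s t) m = wedge e' (weighted \<theta> r s t m) \<and>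
        ext_deriv (weighted \<theta> s t r) m = wedge e' (weighted \<theta> s t r m) \<and>
        ext_deriv (weighted \<theta> t r s) m = wedge e' (weighted \<theta> t r s m)"
  then show "e' = e"
    using assms
    by (intro covector_eqI[of e' "weighted \<theta> r s t m" e "weighted \<theta> s t r m"])
       (auto simp: is_eta_def wedge_weighted transverse_at_def)
qed

lemma has_grad_wedge:
  assumes "differentiable_form \<alpha> m" "differentiable_form \<beta> m"
  shows "\<exists>c. has_grad (\<lambda>x. wedge (\<alpha> x) (\<beta> x)) c m"
proof -
  obtain a b a' b' where "has_grad (\<lambda>x. fst (\<alpha> x)) a m" "has_grad (\<lambda>x. snd (\<alpha> x)) b m"
    "has_grad (\<lambda>x. fst (\<beta> x)) a' m" "has_grad (\<lambda>x. snd (\<beta> x)) b' m"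
    using assms unfolding differentiable_form_def by blast
  then show ?thesis
    unfolding wedge_def by (intro exI) (rule has_grad_diff; rule has_grad_mult; assumption)
qed

lemma differentiable_form_weighted:
  assumes "\<And>i. i \<in> {r,s,t} \<Longrightarrow> differentiable_form (\<theta> i) m"
  shows "differentiable_form (weighted \<theta> r s t) m"
proof -
  obtain c where "has_grad (\<lambda>x. wedge (\<theta> s x) (\<theta> t x)) c m"
    using has_grad_wedge[of "\<theta> s" m "\<theta> t"] assms by blast
  then show ?thesis
    using ext_deriv_scale2(2) assms unfolding weighted_def[abs_def] by blast
qed

text \<open>The three equations for \<open>\<eta>\<^sub>r\<^sub>s\<^sub>t\<close> are compatible because the weighted forms add up to zero.\<close>

lemma is_eta_eta:
  assumes tr: "transverse_at \<theta> m r s t"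
  shows "is_eta \<theta> r s t m (eta \<theta> r s t m)"
proof -
  let ?\<alpha> = "weighted \<theta> r s t m" and ?\<beta> = "weighted \<theta> s t r m"
  let ?x = "ext_deriv (weighted \<theta> r s t) m" and ?y = "ext_deriv (weighted \<theta> s t r) m"
  define w where "w = wedge ?\<alpha> ?\<beta>"
  have w: "w \<noteq> 0" using tr by (simp add: w_def wedge_weighted transverse_at_def)
  define e where "e = (scale2 (?x / w) ?\<beta> - scale2 (?y / w) ?\<alpha>) "
  have e1: "wedge (- e) ?\<alpha> = ?x"
    using w wedge_flip[of ?\<beta> ?\<alpha>] by (simp add: e_def wedge_simps w_def)
  have e2: "wedge (- e) ?\<beta> = ?y"
    using w by (simp add: e_def wedge_simps w_def)
  have diff: "differentiable_form (weighted \<theta> r s t) m" "differentiable_form (weighted \<theta> s t r) m"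
    using tr by (auto simp: transverse_at_def intro!: differentiable_form_weighted)
  have sum0: "weighted \<theta> t r s x = scale2 (-1) (weighted \<theta> r s t x + weighted \<theta> s t r x)" for x
    by (simp add: weighted_def wedge_def scale2_def prod_eq_iff algebra_simps)
  have "ext_deriv (weighted \<theta> t r s) m
      = ext_deriv (\<lambda>x. scale2 (-1) (weighted \<theta> r s t x + weighted \<theta> s t r x)) m"
    using sum0 by presburger
  also have "\<dots> = - (?x + ?y)"
    using ext_deriv_scale2(1)[OF has_grad_const[of "-1"] ext_deriv_add(2)[OF diff]]
      ext_deriv_add(1)[OF diff] by (simp add: wedge_def)
  finally have e3: "ext_deriv (weighted \<theta> t r s) m = wedge (- e) (weighted \<theta> t r s m)"
    unfolding sum0 wedge_simps e1 e2 by simp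
  have "is_eta \<theta> r s t m (- e)" by (simp add: is_eta_def e1 e2 e3)
  then show ?thesis using eta_eqI[OF tr] by simp
qed

lemma is_eta_rotate: "is_eta \<theta> s t r m e \<longleftrightarrow> is_eta \<theta> r s t m e"
  by (auto simp: is_eta_def)

lemma is_eta_swap:
  assumes tr: "transverse_at \<theta> m r s t"
  shows "is_eta \<theta> r t s m e \<longleftrightarrow> is_eta \<theta> r s t m e"
proof -
  have w: "weighted \<theta> i k j = (\<lambda>x. scale2 (-1) (weighted \<theta> i j k x))" for i j k
    by (rule ext) (simp add: weighted_def wedge_def scale2_def prod_eq_iff algebra_simps)
  have d: "ext_deriv (weighted \<theta> i k j) m = - ext_deriv (weighted \<theta> i j k) m"
    if "{i, j, k} \<subseteq> {r, s, t}" for i j k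
  proof -
    have "differentiable_form (weighted \<theta> i j k) m"
      using tr that by (intro differentiable_form_weighted) (auto simp: transverse_at_def)
    from ext_deriv_scale2(1)[OF has_grad_const[of "-1"] this] show ?thesis
      unfolding w[of i k j] by (simp add: wedge_def)
  qed
  show ?thesis
    unfolding is_eta_def using d[of r s t] d[of t r s] d[of s t r]
    by (auto simp: w[of r t s] w[of t s r] w[of s r t] wedge_simps)
qed

lemma eta_rotate: "eta \<theta> s t r m = eta \<theta> r s t m"
  using is_eta_rotate[of \<theta> s t r m] unfolding eta_def is_eta_def[symmetric] by simp

lemma eta_swap: "transverse_at \<theta> m r s t \<Longrightarrow> eta \<theta> r t s m = eta \<theta> r s t m"
  using is_eta_swap[of \<theta> m r s t] unfolding eta_def is_eta_def[symmetric] by simp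

lemma eta_reindex: "eta (\<lambda>i. \<theta> (\<sigma> i)) r s t m = eta \<theta> (\<sigma> r) (\<sigma> s) (\<sigma> t) m"
  by (simp add: eta_def weighted_def[abs_def])

lemma eta_scale:
  assumes tr: "transverse_at \<theta> m r s t"
    and eq: "\<And>i. i \<in> {r,s,t} \<Longrightarrow> \<forall>\<^sub>F x in nhds m. \<theta>' i x = scale2 (h i x) (\<theta> i x)"
    and h: "\<And>i. i \<in> {r,s,t} \<Longrightarrow> has_grad (h i) (c i) m" "\<And>i. i \<in> {r,s,t} \<Longrightarrow> h i m \<noteq> 0"
    and tr': "transverse_at \<theta>' m r s t"
  shows "eta \<theta>' r s t m = eta \<theta> r s t m
      + (scale2 (1 / h r m) (c r) + scale2 (1 / h s m) (c s) + scale2 (1 / h t m) (c t))"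
    (is "_ = ?e + ?l")
proof (rule eta_eqI[OF tr'])
  define H where "H = (\<lambda>x. h r x * h s x * h t x)"
  define c' where "c' = scale2 (h t m) (scale2 (h s m) (c r) + scale2 (h r m) (c s)) + scale2 (h r m * h s m) (c t)"
  have H: "has_grad H c' m"
    unfolding H_def c'_def by (intro has_grad_mult h) auto
  have H0: "H m \<noteq> 0" using h(2) by (simp add: H_def)
  have c': "c' = scale2 (H m) ?l"
    using h(2) by (simp add: c'_def H_def scale2_def prod_eq_iff field_simps)
  have key: "ext_deriv (weighted \<theta>' i j k) m = wedge (?e + ?l) (weighted \<theta>' i j k m)"
    if ijk: "(i, j, k) \<in> {(r,s,t), (s,t,r), (t,r,s)}"
      and e: "ext_deriv (weighted \<theta> i j k) m = wedge ?e (weighted \<theta> i j k m)" for i j k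
  proof -
    have sub: "i \<in> {r,s,t}" "j \<in> {r,s,t}" "k \<in> {r,s,t}" and Hx: "H x = h i x * h j x * h k x" for x
      using ijk by (auto simp: H_def)
    have ev: "\<forall>\<^sub>F x in nhds m. weighted \<theta>' i j k x = scale2 (H x) (weighted \<theta> i j k x)"
      using eq[OF sub(1)] eq[OF sub(2)] eq[OF sub(3)]
      by eventually_elim (simp add: weighted_def Hx wedge_simps scale2_scale2 mult_ac)
    have "differentiable_form (weighted \<theta> i j k) m"
      using tr sub by (intro differentiable_form_weighted) (auto simp: transverse_at_def)
    from ext_deriv_scale2(1)[OF H this] ext_deriv_cong[OF ev]
    have "ext_deriv (weighted \<theta>' i j k) m
        = wedge c' (weighted \<theta> i j k m) + H m * wedge ?e (weighted \<theta> i j k m)"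
      by (simp add: e)
    then show ?thesis
      using eventually_nhds_x_imp_x[OF ev] by (simp add: c' wedge_simps algebra_simps)
  qed
  show "is_eta \<theta>' r s t m (?e + ?l)"
    using is_eta_eta[OF tr] key unfolding is_eta_def by auto
qed

definition distinct_triples :: "'a set \<Rightarrow> ('a \<times> 'a \<times> 'a) set" where
  "distinct_triples A = {(r, s, t). r \<in> A \<and> s \<in> A \<and> t \<in> A \<and> r \<noteq> s \<and> s \<noteq> t \<and> t \<noteq> r}"

lemma sum_distinct_triples:
  fixes f :: "nat \<Rightarrow> nat \<Rightarrow> nat \<Rightarrow> 'a::real_vector"
  assumes rot: "\<And>r s t. (r, s, t) \<in> distinct_triples {..<k} \<Longrightarrow> f s t r = f r s t"
    and swap: "\<And>r s t. (r, s, t) \<in> distinct_triples {..<k} \<Longrightarrow> f r t s = f r s t"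
  shows "(\<Sum>(r, s, t)\<in>distinct_triples {..<k}. f r s t)
      = 6 *\<^sub>R (\<Sum>(r, s, t)\<in>{(r, s, t). r < s \<and> s < t \<and> t < k}. f r s t)"
proof -
  have flip12: "f s r t = f r s t" if "(r, s, t) \<in> distinct_triples {..<k}" for r s t
    using rot[of s r t] swap[of r s t] that by (auto simp: distinct_triples_def)
  have flip13: "f t s r = f r s t" if "(r, s, t) \<in> distinct_triples {..<k}" for r s t
    using rot[of r t s] swap[of r s t] that by (auto simp: distinct_triples_def)
  have rot2: "f t r s = f r s t" if "(r, s, t) \<in> distinct_triples {..<k}" for r s t
    using rot[of t r s] that by (auto simp: distinct_triples_def)
  define S where "S = (\<lambda>A. \<Sum>(r, s, t)\<in>A. f r s t)"
  define A1 A2 A3 A4 A5 A6 where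
    "A1 = {(r, s, t). r < s \<and> s < t \<and> t < k}" "A2 = {(r, s, t). r < t \<and> t < s \<and> s < k}"
    "A3 = {(r, s, t). s < r \<and> r < t \<and> t < k}" "A4 = {(r, s, t). s < t \<and> t < r \<and> r < k}"
    "A5 = {(r, s, t). t < r \<and> r < s \<and> s < k}" "A6 = {(r, s, t). t < s \<and> s < r \<and> r < k}"
  note A = this
  have fin: "finite A1" "finite A2" "finite A3" "finite A4" "finite A5" "finite A6"
    unfolding A by (rule finite_subset[of _ "{..<k} \<times> {..<k} \<times> {..<k}"]; auto)+
  have D: "distinct_triples {..<k} = A1 \<union> (A2 \<union> (A3 \<union> (A4 \<union> (A5 \<union> A6))))"
  proof (intro equalityI subsetI)
    fix x assume "x \<in> distinct_triples {..<k}"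
    then obtain r s t where x: "x = (r, s, t)" "r < k" "s < k" "t < k" "r \<noteq> s" "s \<noteq> t" "t \<noteq> r"
      by (auto simp: distinct_triples_def)
    then consider "r < s \<and> s < t" | "r < t \<and> t < s" | "s < r \<and> r < t" | "s < t \<and> t < r"
      | "t < r \<and> r < s" | "t < s \<and> s < r" by linarith
    then show "x \<in> A1 \<union> (A2 \<union> (A3 \<union> (A4 \<union> (A5 \<union> A6))))"
      by cases (simp_all add: A x)
  qed (auto simp: A distinct_triples_def)
  have dj: "A5 \<inter> A6 = {}" "A4 \<inter> (A5 \<union> A6) = {}" "A3 \<inter> (A4 \<union> (A5 \<union> A6)) = {}"
    "A2 \<inter> (A3 \<union> (A4 \<union> (A5 \<union> A6))) = {}" "A1 \<inter> (A2 \<union> (A3 \<union> (A4 \<union> (A5 \<union> A6)))) = {}"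
    unfolding A by auto
  have un: "S (A \<union> B) = S A + S B" if "finite A" "finite B" "A \<inter> B = {}" for A B
    unfolding S_def using that by (rule sum.union_disjoint)
  have "S (distinct_triples {..<k}) = S A1 + (S A2 + (S A3 + (S A4 + (S A5 + S A6))))"
    unfolding D by (simp only: un fin dj finite_Un simp_thms)
  moreover have "S A2 = S A1"
    unfolding S_def A
    by (rule sum.reindex_bij_witness[of _ "\<lambda>(r, s, t). (r, t, s)" "\<lambda>(r, s, t). (r, t, s)"])
       (auto simp: distinct_triples_def intro!: swap)
  moreover have "S A4 = S A1"
    unfolding S_def A
    by (rule sum.reindex_bij_witness[of _ "\<lambda>(r, s, t). (t, r, s)" "\<lambda>(r, s, t). (s, t, r)"])
       (auto simp: distinct_triples_def intro!: rot)
  moreover have "S A5 = S A1"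
    unfolding S_def A
    by (rule sum.reindex_bij_witness[of _ "\<lambda>(r, s, t). (s, t, r)" "\<lambda>(r, s, t). (t, r, s)"])
       (auto simp: distinct_triples_def intro!: rot2)
  moreover have "S A3 = S A1"
    unfolding S_def A
    by (rule sum.reindex_bij_witness[of _ "\<lambda>(r, s, t). (s, r, t)" "\<lambda>(r, s, t). (s, r, t)"])
       (auto simp: distinct_triples_def intro!: flip12)
  moreover have "S A6 = S A1"
    unfolding S_def A
    by (rule sum.reindex_bij_witness[of _ "\<lambda>(r, s, t). (t, s, r)" "\<lambda>(r, s, t). (t, s, r)"])
       (auto simp: distinct_triples_def intro!: flip13)
  ultimately have "S (distinct_triples {..<k}) = S A1 + (S A1 + (S A1 + (S A1 + (S A1 + S A1))))"
    by simp
  also have "\<dots> = (1 + (1 + (1 + (1 + (1 + 1))))) *\<^sub>R S A1"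
    by (simp only: scaleR_add_left scaleR_one)
  finally have "S (distinct_triples {..<k}) = 6 *\<^sub>R S A1" by simp
  then show ?thesis unfolding S_def A .
qed

declare split_paired_All [simp del] split_paired_Ex [simp del]

lemma decomposesD:
  assumes "decomposes k W N \<theta>" "m \<in> N"
  shows "i < k \<Longrightarrow> differentiable_form (\<theta> i) m"
    "i < k \<Longrightarrow> j < k \<Longrightarrow> i \<noteq> j \<Longrightarrow> wedge (\<theta> i m) (\<theta> j m) \<noteq> 0"
    "W m \<xi> = (\<Prod>i<k. fst (\<theta> i m) * fst \<xi> + snd (\<theta> i m) * snd \<xi>)"
    "\<forall>\<^sub>F x in nhds m. x \<in> N"
proof -
  have N: "open N"
    and h: "\<And>i. i < k \<Longrightarrow> holomorphic2_on (\<lambda>m. fst (\<theta> i m)) N \<and> holomorphic2_on (\<lambda>m. snd (\<theta> i m)) N"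
    using assms(1) by (simp_all add: decomposes_def)
  show "i < k \<Longrightarrow> differentiable_form (\<theta> i) m"
    using h[of i] assms(2) by (simp add: holomorphic2_on_iff differentiable_form_def del: split_paired_Ex)
  show "\<forall>\<^sub>F x in nhds m. x \<in> N" using N assms(2) by (rule eventually_nhds_in_open)
  show "i < k \<Longrightarrow> j < k \<Longrightarrow> i \<noteq> j \<Longrightarrow> wedge (\<theta> i m) (\<theta> j m) \<noteq> 0"
    "W m \<xi> = (\<Prod>i<k. fst (\<theta> i m) * fst \<xi> + snd (\<theta> i m) * snd \<xi>)"
    using assms unfolding decomposes_def by blast+
qed

lemma transverse_at_decomposes:
  assumes "decomposes k W N \<theta>" "m \<in> N" "(r, s, t) \<in> distinct_triples {..<k}"
  shows "transverse_at \<theta> m r s t"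
  using assms(3) decomposesD(1,2)[OF assms(1,2)]
  by (auto simp: transverse_at_def distinct_triples_def)

lemma wedge_collinear:
  assumes "wedge a c = 0" "wedge b c = 0" "c \<noteq> 0"
  shows "wedge a b = 0"
proof (rule ccontr)
  assume "wedge a b \<noteq> 0"
  moreover have "fst c * wedge a b = 0" "snd c * wedge a b = 0"
    using assms(1,2) unfolding wedge_def by algebra+
  ultimately show False using assms(3) by (simp add: prod_eq_iff)
qed

lemma wedge_zero_flip: "wedge a b = 0 \<Longrightarrow> wedge b a = 0"
  using wedge_flip[of b a] by simp

lemma isCont_form:
  assumes "differentiable_form \<alpha> m" "differentiable_form \<beta> m"
  shows "isCont (\<lambda>x. wedge (\<alpha> x) (\<beta> x)) m"
  using has_grad_wedge[OF assms] has_grad_isCont by blast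

lemma decomposes_nonzero:
  assumes k: "2 \<le> k" and d: "decomposes k W N \<theta>" "m \<in> N" and i: "i < k"
  shows "\<theta> i m \<noteq> 0"
proof -
  define j where "j = (if i = 0 then 1 else 0::nat)"
  have "j < k" "i \<noteq> j" using k by (auto simp: j_def)
  then have "wedge (\<theta> i m) (\<theta> j m) \<noteq> 0" using decomposesD(2)[OF d i] by blast
  then show ?thesis by (auto simp: wedge_def)
qed

lemma decomposes_nonvanishing:
  assumes k: "2 \<le> k" and d: "decomposes k W N \<theta>" "m \<in> N"
  shows "\<exists>t. W m (1, t) \<noteq> 0"
proof -
  have "finite ((\<lambda>j. - fst (\<theta> j m) / snd (\<theta> j m)) ` {..<k} \<union> {0})" by simp
  then obtain t :: complex where t: "t \<notin> (\<lambda>j. - fst (\<theta> j m) / snd (\<theta> j m)) ` {..<k} \<union> {0}"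
    by (metis ex_new_if_finite infinite_UNIV_char_0)
  have "fst (\<theta> j m) * fst (1, t) + snd (\<theta> j m) * snd (1, t) \<noteq> 0" if j: "j < k" for j
  proof
    assume *: "fst (\<theta> j m) * fst (1, t) + snd (\<theta> j m) * snd (1, t) = 0"
    have nz: "\<theta> j m \<noteq> 0" by (rule decomposes_nonzero[OF k d j])
    then have s: "snd (\<theta> j m) \<noteq> 0" using * by (auto simp: prod_eq_iff)
    have "t * snd (\<theta> j m) = - fst (\<theta> j m)" using * by (simp add: add_eq_0_iff mult.commute)
    then have "t = - fst (\<theta> j m) / snd (\<theta> j m)" using s by (simp add: field_simps)
    then show False using t j by blast
  qed
  then have "W m (1, t) \<noteq> 0" unfolding decomposesD(3)[OF d] by simp
  then show ?thesis by blast
qed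

lemma eventually_nonzero_isCont:
  fixes f :: "c2 \<Rightarrow> complex"
  assumes "f m \<noteq> 0" "isCont f m"
  shows "\<forall>\<^sub>F x in nhds m. f x \<noteq> 0"
proof -
  have "\<forall>\<^sub>F x in at m. f x \<noteq> 0"
    using assms(2)[unfolded isCont_def] assms(1) by (rule tendsto_imp_eventually_ne)
  then show ?thesis using assms(1) by (auto simp: eventually_at_filter elim: eventually_mono)
qed

text \<open>Unique factorisation of binary forms: at a point, the factors of the two decompositions agree
  up to scaling and a permutation; since collinear factors stay isolated from the others, the
  permutation is locally constant.\<close>

lemma decomposition_matching:
  assumes k: "2 \<le> k" and d: "decomposes k W N \<theta>" "m \<in> N" and d': "decomposes k W' N' \<theta>'" "m \<in> N'"
    and u: "\<forall>\<^sub>F x in nhds m. u x \<noteq> 0 \<and> (\<forall>\<xi>. W' x \<xi> = u x * W x \<xi>)"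
  obtains \<sigma> where "bij_betw \<sigma> {..<k} {..<k}"
    "\<forall>\<^sub>F x in nhds m. \<forall>i<k. wedge (\<theta> (\<sigma> i) x) (\<theta>' i x) = 0"
proof -
  have ex: "\<exists>j<k. wedge (\<theta> j x) (\<theta>' i x) = 0"
    if x: "x \<in> N" "x \<in> N'" "u x \<noteq> 0 \<and> (\<forall>\<xi>. W' x \<xi> = u x * W x \<xi>)" "i < k" for i x
  proof -
    let ?\<xi> = "(- snd (\<theta>' i x), fst (\<theta>' i x))"
    have "W' x ?\<xi> = 0"
      unfolding decomposesD(3)[OF d'(1) x(2)] by (rule prod_zero) (auto intro!: bexI[of _ i] x)
    then have "W x ?\<xi> = 0" using x(3) by simp
    then obtain j where "j < k" "fst (\<theta> j x) * fst ?\<xi> + snd (\<theta> j x) * snd ?\<xi> = 0"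
      unfolding decomposesD(3)[OF d(1) x(1)] by (auto simp: prod_zero_iff)
    then show ?thesis by (intro exI[of _ j]) (auto simp: wedge_def algebra_simps)
  qed
  have "\<forall>i\<in>{..<k}. \<exists>j. j < k \<and> wedge (\<theta> j m) (\<theta>' i m) = 0"
    using ex[OF d(2) d'(2) eventually_nhds_x_imp_x[OF u]] by blast
  then obtain \<sigma> where "\<forall>i\<in>{..<k}. \<sigma> i < k \<and> wedge (\<theta> (\<sigma> i) m) (\<theta>' i m) = 0"
    by (rule bchoice[THEN exE])
  then have \<sigma>: "\<And>i. i < k \<Longrightarrow> \<sigma> i < k" "\<And>i. i < k \<Longrightarrow> wedge (\<theta> (\<sigma> i) m) (\<theta>' i m) = 0"
    by auto
  have "inj_on \<sigma> {..<k}"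
  proof (rule inj_onI, rule ccontr)
    fix i j assume ij: "i \<in> {..<k}" "j \<in> {..<k}" "\<sigma> i = \<sigma> j" "i \<noteq> j"
    have "wedge (\<theta>' i m) (\<theta> (\<sigma> i) m) = 0" "wedge (\<theta>' j m) (\<theta> (\<sigma> i) m) = 0"
      using \<sigma>(2)[of i] \<sigma>(2)[of j] ij by (simp_all add: wedge_zero_flip)
    then have "wedge (\<theta>' i m) (\<theta>' j m) = 0"
      by (rule wedge_collinear) (use decomposes_nonzero[OF k d, of "\<sigma> i"] \<sigma>(1)[of i] ij in auto)
    then show False using decomposesD(2)[OF d', of i j] ij by auto
  qed
  then have bij: "bij_betw \<sigma> {..<k} {..<k}"
    using \<sigma>(1) by (simp add: bij_betw_def endo_inj_surj image_subset_iff)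
  have iso: "\<forall>\<^sub>F x in nhds m. j \<noteq> \<sigma> i \<longrightarrow> wedge (\<theta> j x) (\<theta>' i x) \<noteq> 0" if ij: "i < k" "j < k" for i j
  proof (cases "j = \<sigma> i")
    case False
    have "wedge (\<theta> j m) (\<theta>' i m) \<noteq> 0"
    proof
      assume "wedge (\<theta> j m) (\<theta>' i m) = 0"
      from wedge_collinear[OF this \<sigma>(2)[OF ij(1)] decomposes_nonzero[OF k d' ij(1)]]
      have "wedge (\<theta> j m) (\<theta> (\<sigma> i) m) = 0" .
      then show False using decomposesD(2)[OF d, of j "\<sigma> i"] ij False \<sigma>(1) by auto
    qed
    moreover have "isCont (\<lambda>x. wedge (\<theta> j x) (\<theta>' i x)) m"
      using decomposesD(1)[OF d] decomposesD(1)[OF d'] ij by (intro isCont_form) auto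
    ultimately have "\<forall>\<^sub>F x in nhds m. wedge (\<theta> j x) (\<theta>' i x) \<noteq> 0"
      by (rule eventually_nonzero_isCont)
    then show ?thesis by (rule eventually_mono) simp
  qed simp
  have iso': "\<forall>\<^sub>F x in nhds m. \<forall>i\<in>{..<k}. \<forall>j\<in>{..<k}. j \<noteq> \<sigma> i \<longrightarrow> wedge (\<theta> j x) (\<theta>' i x) \<noteq> 0"
    by (intro eventually_ball_finite ballI finite_lessThan iso) simp_all
  have "\<forall>\<^sub>F x in nhds m. \<forall>i<k. wedge (\<theta> (\<sigma> i) x) (\<theta>' i x) = 0"
    using iso' decomposesD(4)[OF d] decomposesD(4)[OF d'] u
  proof eventually_elim
    case (elim x)
    show ?case
    proof (intro allI impI)
      fix i assume i: "i < k"
      obtain j where "j < k" "wedge (\<theta> j x) (\<theta>' i x) = 0"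
        using ex[OF elim(2,3,4) i] by blast
      then show "wedge (\<theta> (\<sigma> i) x) (\<theta>' i x) = 0" using elim(1) i by (cases "j = \<sigma> i") auto
    qed
  qed
  with bij show thesis by (rule that)
qed

lemma collinear_scaling:
  assumes "\<forall>\<^sub>F x in nhds m. differentiable_form \<alpha> x \<and> differentiable_form \<beta> x
      \<and> wedge (\<alpha> x) (\<beta> x) = 0 \<and> \<beta> x \<noteq> 0" and "\<alpha> m \<noteq> 0"
  shows "\<exists>h c. \<forall>\<^sub>F x in nhds m. \<beta> x = scale2 (h x) (\<alpha> x) \<and> h x \<noteq> 0 \<and> has_grad h (c x) x"
proof -
  have main: "\<exists>h c. \<forall>\<^sub>F x in nhds m. \<beta> x = scale2 (h x) (\<alpha> x) \<and> h x \<noteq> 0 \<and> has_grad h (c x) x"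
    if p: "p = fst \<and> q = snd \<or> p = snd \<and> q = fst" and p0: "p (\<alpha> m) \<noteq> 0" for p q :: "c2 \<Rightarrow> complex"
  proof -
    let ?P = "\<lambda>x. differentiable_form \<alpha> x \<and> differentiable_form \<beta> x
      \<and> wedge (\<alpha> x) (\<beta> x) = 0 \<and> \<beta> x \<noteq> 0"
    have dp: "\<exists>c. has_grad (\<lambda>x. p (\<gamma> x)) c x" if "differentiable_form \<gamma> x" for \<gamma> x
      using p that unfolding differentiable_form_def by blast
    have "differentiable_form \<alpha> m" using eventually_nhds_x_imp_x[OF assms(1)] by blast
    then have "isCont (\<lambda>x. p (\<alpha> x)) m" using dp has_grad_isCont by blast
    then have "\<forall>\<^sub>F x in nhds m. p (\<alpha> x) \<noteq> 0"
      by (rule eventually_nonzero_isCont[where f="\<lambda>x. p (\<alpha> x)", OF p0])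
    with assms(1) have ev: "\<forall>\<^sub>F x in nhds m. ?P x \<and> p (\<alpha> x) \<noteq> 0" by (rule eventually_conj)
    define h where "h = (\<lambda>x. p (\<beta> x) * inverse (p (\<alpha> x)))"
    have "\<exists>c. has_grad h c x" if x: "?P x \<and> p (\<alpha> x) \<noteq> 0" for x
    proof -
      obtain a b where "has_grad (\<lambda>x. p (\<alpha> x)) a x" "has_grad (\<lambda>x. p (\<beta> x)) b x"
        using dp[of \<alpha> x] dp[of \<beta> x] x by blast
      then show ?thesis unfolding h_def
        using has_grad_mult has_grad_inverse x by blast
    qed
    then have "\<forall>x. \<exists>c. ?P x \<and> p (\<alpha> x) \<noteq> 0 \<longrightarrow> has_grad h c x" by blast
    then obtain c where c: "\<And>x. ?P x \<and> p (\<alpha> x) \<noteq> 0 \<Longrightarrow> has_grad h (c x) x" by metis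
    have key: "\<beta> x = scale2 (h x) (\<alpha> x) \<and> h x \<noteq> 0 \<and> has_grad h (c x) x"
      if x: "?P x \<and> p (\<alpha> x) \<noteq> 0" for x
    proof (intro conjI)
      show "has_grad h (c x) x" by (rule c[OF x])
      have w: "fst (\<alpha> x) * snd (\<beta> x) = snd (\<alpha> x) * fst (\<beta> x)"
        using x by (simp add: wedge_def)
      show b: "\<beta> x = scale2 (h x) (\<alpha> x)"
        using p x w by (auto simp: h_def prod_eq_iff field_simps)
      show "h x \<noteq> 0"
      proof
        assume "h x = 0"
        then have "\<beta> x = 0" using b by (simp add: scale2_def zero_prod_def)
        then show False using x by blast
      qed
    qed
    have "\<forall>\<^sub>F x in nhds m. \<beta> x = scale2 (h x) (\<alpha> x) \<and> h x \<noteq> 0 \<and> has_grad h (c x) x"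
      using ev by (rule eventually_mono) (rule key)
    then show ?thesis by blast
  qed
  show ?thesis
  proof (cases "fst (\<alpha> m) = 0")
    case True
    then have "snd (\<alpha> m) \<noteq> 0" using assms(2) by (simp add: prod_eq_iff)
    then show ?thesis by (intro main[of snd fst]) simp_all
  next
    case False
    then show ?thesis by (intro main[of fst snd]) simp_all
  qed
qed

lemma has_grad_prod:
  assumes "finite A" "\<And>i. i \<in> A \<Longrightarrow> has_grad (h i) (c i) m" "\<And>i. i \<in> A \<Longrightarrow> h i m \<noteq> 0"
  shows "has_grad (\<lambda>x. \<Prod>i\<in>A. h i x) (scale2 (\<Prod>i\<in>A. h i m) (\<Sum>i\<in>A. scale2 (1 / h i m) (c i))) m"
  using assms
proof (induct A rule: finite_induct)
  case empty then show ?case by (simp add: scale2_def zero_prod_def[symmetric])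
next
  case (insert i A)
  from has_grad_mult[OF insert(4)[of i] insert(3)] insert
  have "has_grad (\<lambda>x. h i x * (\<Prod>i\<in>A. h i x)) (scale2 (\<Prod>i\<in>A. h i m) (c i) +
      scale2 (h i m) (scale2 (\<Prod>i\<in>A. h i m) (\<Sum>i\<in>A. scale2 (1 / h i m) (c i)))) m" by simp
  moreover have "scale2 (\<Prod>i\<in>A. h i m) (c i) +
      scale2 (h i m) (scale2 (\<Prod>i\<in>A. h i m) (\<Sum>i\<in>A. scale2 (1 / h i m) (c i)))
    = scale2 (\<Prod>i\<in>insert i A. h i m) (\<Sum>i\<in>insert i A. scale2 (1 / h i m) (c i))"
    using insert(1,2) insert(5)[of i] by (simp add: prod_eq_iff field_simps)
  ultimately show ?case using insert by simp
qed

lemma sum_distinct_triples_first: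
  fixes g :: "'a \<Rightarrow> 'b::real_vector"
  assumes A: "finite A"
  shows "(\<Sum>(r, s, t)\<in>distinct_triples A. g r) = real ((card A - 1) * (card A - 2)) *\<^sub>R (\<Sum>r\<in>A. g r)"
proof -
  have D: "distinct_triples A = (SIGMA r:A. SIGMA s:A - {r}. A - {r, s})"
    by (auto simp: distinct_triples_def)
  have "(\<Sum>(r, s, t)\<in>distinct_triples A. g r) = (\<Sum>r\<in>A. \<Sum>(s, t)\<in>(SIGMA s:A - {r}. A - {r, s}). g r)"
    unfolding D using A by (subst sum.Sigma) (auto simp: split_def)
  also have "\<dots> = (\<Sum>r\<in>A. real ((card A - 1) * (card A - 2)) *\<^sub>R g r)"
  proof (rule sum.cong[OF refl])
    fix r assume r: "r \<in> A"
    have "card (A - {r, s}) = card A - 2" if "s \<in> A - {r}" for s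
      using A r that by (subst card_Diff_subset) auto
    then have "card (SIGMA s:A - {r}. A - {r, s}) = (card A - 1) * (card A - 2)"
      using A r by simp
    then show "(\<Sum>(s, t)\<in>(SIGMA s:A - {r}. A - {r, s}). g r) = real ((card A - 1) * (card A - 2)) *\<^sub>R g r"
      by (simp add: split_def sum_constant_scaleR)
  qed
  finally show ?thesis by (simp add: scaleR_sum_right)
qed

definition connection :: "nat \<Rightarrow> (nat \<Rightarrow> one_form) \<Rightarrow> one_form" where
  "connection k \<theta> m = (\<Sum>(r, s, t) \<in> {(r, s, t). r < s \<and> s < t \<and> t < k}. eta \<theta> r s t m)"

lemma connection_distinct_triples:
  assumes "\<And>r s t. (r, s, t) \<in> distinct_triples {..<k} \<Longrightarrow> transverse_at \<theta> m r s t"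
  shows "(\<Sum>(r, s, t)\<in>distinct_triples {..<k}. eta \<theta> r s t m) = 6 *\<^sub>R connection k \<theta> m"
  unfolding connection_def
  by (rule sum_distinct_triples) (simp_all add: eta_rotate eta_swap assms)

lemma bij_betw_distinct_triples:
  assumes "bij_betw \<sigma> A B"
  shows "bij_betw (\<lambda>(r, s, t). (\<sigma> r, \<sigma> s, \<sigma> t)) (distinct_triples A) (distinct_triples B)"
proof -
  define \<tau> where "\<tau> = inv_into A \<sigma>"
  have \<tau>: "\<And>r. r \<in> A \<Longrightarrow> \<tau> (\<sigma> r) = r" "\<And>r. r \<in> B \<Longrightarrow> \<sigma> (\<tau> r) = r" "\<And>r. r \<in> B \<Longrightarrow> \<tau> r \<in> A"
    "\<And>r. r \<in> A \<Longrightarrow> \<sigma> r \<in> B"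
    using assms bij_betw_inv_into[OF assms]
    by (auto simp: \<tau>_def bij_betw_inv_into_left bij_betw_inv_into_right bij_betw_apply)
  show ?thesis
    by (rule bij_betw_byWitness[where f'="\<lambda>(r, s, t). (\<tau> r, \<tau> s, \<tau> t)"])
       (auto simp: distinct_triples_def \<tau> dest: \<tau>(1) arg_cong[where f=\<tau>] arg_cong[where f=\<sigma>])
qed

text \<open>Multiplying the symmetric form by a unit \<open>u\<close> changes the connection by a multiple of
  \<open>d log u\<close>. With \<open>u = 1\<close> this is the independence of the decomposition. The factors of the
  two decompositions differ by units \<open>h\<^sub>i\<close>, which enter the connection only through their product
  \<open>u\<close>.\<close>

lemma connection_scale:
  assumes k: "2 \<le> k" and d: "decomposes k W N \<theta>" "m \<in> N" and d': "decomposes k W' N' \<theta>'" "m \<in> N'"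
    and u: "\<forall>\<^sub>F x in nhds m. u x \<noteq> 0 \<and> has_grad u (du x) x \<and> (\<forall>\<xi>. W' x \<xi> = u x * W x \<xi>)"
  shows "\<forall>\<^sub>F x in nhds m. connection k \<theta>' x
      = connection k \<theta> x + (real ((k - 1) * (k - 2)) / 2) *\<^sub>R scale2 (1 / u x) (du x)"
proof -
  obtain \<sigma> where \<sigma>: "bij_betw \<sigma> {..<k} {..<k}"
    and col: "\<forall>\<^sub>F x in nhds m. \<forall>i<k. wedge (\<theta> (\<sigma> i) x) (\<theta>' i x) = 0"
    by (rule decomposition_matching[OF k d d', of u]) (use u in \<open>auto elim: eventually_mono\<close>)
  have \<sigma>k: "i < k \<Longrightarrow> \<sigma> i < k" for i using \<sigma> by (auto simp: bij_betw_def)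
  have ex: "\<exists>h c. \<forall>\<^sub>F x in nhds m. \<theta>' i x = scale2 (h x) (\<theta> (\<sigma> i) x) \<and> h x \<noteq> 0 \<and> has_grad h (c x) x"
    if i: "i < k" for i
  proof (rule collinear_scaling)
    show "\<forall>\<^sub>F x in nhds m. differentiable_form (\<theta> (\<sigma> i)) x \<and> differentiable_form (\<theta>' i) x
        \<and> wedge (\<theta> (\<sigma> i) x) (\<theta>' i x) = 0 \<and> \<theta>' i x \<noteq> 0"
      using col decomposesD(4)[OF d] decomposesD(4)[OF d']
    proof eventually_elim
      case (elim x)
      then show ?case
        using decomposesD(1)[OF d(1) elim(2) \<sigma>k[OF i]] decomposesD(1)[OF d'(1) elim(3) i]
          decomposes_nonzero[OF k d'(1) elim(3) i] i by blast
    qed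
    show "\<theta> (\<sigma> i) m \<noteq> 0" by (rule decomposes_nonzero[OF k d \<sigma>k[OF i]])
  qed
  define Q where "Q i h c = (\<forall>\<^sub>F x in nhds m. \<theta>' i x = scale2 (h x) (\<theta> (\<sigma> i) x)
      \<and> h x \<noteq> 0 \<and> has_grad h (c x) x)" for i h c
  have "\<forall>i\<in>{..<k}. \<exists>h. \<exists>c. Q i h c" using ex by (simp add: Q_def)
  then obtain h where "\<forall>i\<in>{..<k}. \<exists>c. Q i (h i) c" by (rule bchoice[THEN exE])
  then obtain c where "\<forall>i\<in>{..<k}. Q i (h i) (c i)" by (rule bchoice[THEN exE])
  then have hc: "\<forall>\<^sub>F x in nhds m. \<theta>' i x = scale2 (h i x) (\<theta> (\<sigma> i) x)
      \<and> h i x \<noteq> 0 \<and> has_grad (h i) (c i x) x" if "i < k" for i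
    using that by (simp add: Q_def)
  have "\<forall>\<^sub>F x in nhds m. \<forall>i\<in>{..<k}. \<theta>' i x = scale2 (h i x) (\<theta> (\<sigma> i) x)
      \<and> h i x \<noteq> 0 \<and> has_grad (h i) (c i x) x"
    by (intro eventually_ball_finite finite_lessThan ballI hc) simp
  then have "\<forall>\<^sub>F x in nhds m. (\<forall>i\<in>{..<k}. \<theta>' i x = scale2 (h i x) (\<theta> (\<sigma> i) x)
      \<and> h i x \<noteq> 0 \<and> has_grad (h i) (c i x) x) \<and> (u x \<noteq> 0 \<and> has_grad u (du x) x
      \<and> (\<forall>\<xi>. W' x \<xi> = u x * W x \<xi>)) \<and> x \<in> N \<and> x \<in> N'"
    using u decomposesD(4)[OF d] decomposesD(4)[OF d'] by eventually_elim blast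
  then have "\<forall>\<^sub>F x in nhds m. \<forall>\<^sub>F y in nhds x. (\<forall>i\<in>{..<k}. \<theta>' i y = scale2 (h i y) (\<theta> (\<sigma> i) y)
      \<and> h i y \<noteq> 0 \<and> has_grad (h i) (c i y) y) \<and> (u y \<noteq> 0 \<and> has_grad u (du y) y
      \<and> (\<forall>\<xi>. W' y \<xi> = u y * W y \<xi>)) \<and> y \<in> N \<and> y \<in> N'"
    by (simp only: eventually_eventually)
  then show ?thesis
  proof (rule eventually_mono)
    fix x
    assume ev: "\<forall>\<^sub>F y in nhds x. (\<forall>i\<in>{..<k}. \<theta>' i y = scale2 (h i y) (\<theta> (\<sigma> i) y)
      \<and> h i y \<noteq> 0 \<and> has_grad (h i) (c i y) y) \<and> (u y \<noteq> 0 \<and> has_grad u (du y) y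
      \<and> (\<forall>\<xi>. W' y \<xi> = u y * W y \<xi>)) \<and> y \<in> N \<and> y \<in> N'"
    note at = eventually_nhds_x_imp_x[OF ev]
    have N: "x \<in> N" "x \<in> N'" using at by blast+
    define l where "l i = scale2 (1 / h i x) (c i x)" for i
    have prod: "\<forall>\<^sub>F y in nhds x. (\<Prod>i<k. h i y) = u y"
      using ev
    proof (rule eventually_mono)
      fix y
      assume y: "(\<forall>i\<in>{..<k}. \<theta>' i y = scale2 (h i y) (\<theta> (\<sigma> i) y)
      \<and> h i y \<noteq> 0 \<and> has_grad (h i) (c i y) y) \<and> (u y \<noteq> 0 \<and> has_grad u (du y) y
      \<and> (\<forall>\<xi>. W' y \<xi> = u y * W y \<xi>)) \<and> y \<in> N \<and> y \<in> N'"
      then have Ny: "y \<in> N" "y \<in> N'" by blast+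
      obtain \<xi> where \<xi>: "W y \<xi> \<noteq> 0"
        using decomposes_nonvanishing[OF k d(1) Ny(1)] by blast
      have "u y * W y \<xi> = W' y \<xi>" using y by simp
      also have "\<dots> = (\<Prod>i<k. h i y * (fst (\<theta> (\<sigma> i) y) * fst \<xi> + snd (\<theta> (\<sigma> i) y) * snd \<xi>))"
        unfolding decomposesD(3)[OF d'(1) Ny(2)]
        by (rule prod.cong) (use y in \<open>auto simp: algebra_simps\<close>)
      also have "\<dots> = (\<Prod>i<k. h i y) * (\<Prod>i<k. fst (\<theta> (\<sigma> i) y) * fst \<xi> + snd (\<theta> (\<sigma> i) y) * snd \<xi>)"
        by (rule prod.distrib)
      also have "(\<Prod>i<k. fst (\<theta> (\<sigma> i) y) * fst \<xi> + snd (\<theta> (\<sigma> i) y) * snd \<xi>) = W y \<xi>"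
        unfolding decomposesD(3)[OF d(1) Ny(1)] by (rule prod.reindex_bij_betw[OF \<sigma>])
      finally show "(\<Prod>i<k. h i y) = u y" using \<xi> by simp
    qed
    have "has_grad (\<lambda>y. \<Prod>i<k. h i y) (scale2 (\<Prod>i<k. h i x) (\<Sum>i<k. l i)) x"
      unfolding l_def by (rule has_grad_prod) (use at in auto)
    from has_grad_cong[OF prod this] have "scale2 (u x) (\<Sum>i<k. l i) = du x"
      using has_grad_unique at eventually_nhds_x_imp_x[OF prod] by metis
    then have suml: "(\<Sum>i<k. l i) = scale2 (1 / u x) (du x)"
      using at by (auto simp: scale2_scale2 simp flip: \<open>scale2 (u x) (\<Sum>i<k. l i) = du x\<close>)
    have tr': "transverse_at \<theta>' x r s t" if "(r, s, t) \<in> distinct_triples {..<k}" for r s t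
      by (rule transverse_at_decomposes[OF d'(1) N(2) that])
    have tr: "transverse_at \<theta> x r s t" if "(r, s, t) \<in> distinct_triples {..<k}" for r s t
      by (rule transverse_at_decomposes[OF d(1) N(1) that])
    have eq: "eta \<theta>' r s t x = eta \<theta> (\<sigma> r) (\<sigma> s) (\<sigma> t) x + (l r + l s + l t)"
      if D: "(r, s, t) \<in> distinct_triples {..<k}" for r s t
      unfolding l_def eta_reindex[symmetric]
    proof (rule eta_scale)
      have "(\<sigma> r, \<sigma> s, \<sigma> t) \<in> distinct_triples {..<k}"
        using bij_betw_apply[OF bij_betw_distinct_triples[OF \<sigma>] D] by simp
      from tr[OF this] show "transverse_at (\<lambda>i. \<theta> (\<sigma> i)) x r s t"
        by (auto simp: transverse_at_def)
      show "transverse_at \<theta>' x r s t" by (rule tr'[OF D])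
      fix i assume "i \<in> {r, s, t}"
      then have i: "i \<in> {..<k}" using D by (auto simp: distinct_triples_def)
      show "\<forall>\<^sub>F y in nhds x. \<theta>' i y = scale2 (h i y) (\<theta> (\<sigma> i) y)"
        using ev by (rule eventually_mono) (use i in blast)
      show "has_grad (h i) (c i x) x" "h i x \<noteq> 0" using at i by blast+
    qed
    have rot: "bij_betw (\<lambda>(r, s, t). (s, t, r)) (distinct_triples {..<k}) (distinct_triples {..<k})"
      by (rule bij_betw_byWitness[where f'="\<lambda>(r, s, t). (t, r, s)"]) (auto simp: distinct_triples_def)
    have l1: "(\<Sum>(r, s, t)\<in>distinct_triples {..<k}. l r) = real ((k - 1) * (k - 2)) *\<^sub>R (\<Sum>i<k. l i)"
      using sum_distinct_triples_first[of "{..<k}" l] by simp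
    have l2: "(\<Sum>(r, s, t)\<in>distinct_triples {..<k}. l s) = (\<Sum>(r, s, t)\<in>distinct_triples {..<k}. l r)"
      using sum.reindex_bij_betw[OF rot, of "\<lambda>(r, s, t). l r"] by (simp add: split_def)
    have l3: "(\<Sum>(r, s, t)\<in>distinct_triples {..<k}. l t) = (\<Sum>(r, s, t)\<in>distinct_triples {..<k}. l s)"
      using sum.reindex_bij_betw[OF rot, of "\<lambda>(r, s, t). l s"] by (simp add: split_def)
    have "6 *\<^sub>R connection k \<theta>' x = (\<Sum>(r, s, t)\<in>distinct_triples {..<k}. eta \<theta>' r s t x)"
      using connection_distinct_triples[OF tr'] by simp
    also have "\<dots> = (\<Sum>(r, s, t)\<in>distinct_triples {..<k}. eta \<theta> (\<sigma> r) (\<sigma> s) (\<sigma> t) x + (l r + l s + l t))"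
      by (rule sum.cong) (auto simp: eq)
    also have "\<dots> = (\<Sum>(r, s, t)\<in>distinct_triples {..<k}. eta \<theta> (\<sigma> r) (\<sigma> s) (\<sigma> t) x)
        + 3 *\<^sub>R (\<Sum>(r, s, t)\<in>distinct_triples {..<k}. l r)"
      using l2 l3 by (simp add: split_def sum.distrib scaleR_add_left[of 1 2, simplified] scaleR_2 add_ac)
    also have "(\<Sum>(r, s, t)\<in>distinct_triples {..<k}. eta \<theta> (\<sigma> r) (\<sigma> s) (\<sigma> t) x)
        = (\<Sum>(r, s, t)\<in>distinct_triples {..<k}. eta \<theta> r s t x)"
      using sum.reindex_bij_betw[OF bij_betw_distinct_triples[OF \<sigma>], of "\<lambda>(r, s, t). eta \<theta> r s t x"]
      by (simp add: split_def)
    also have "\<dots> = 6 *\<^sub>R connection k \<theta> x"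
      by (rule connection_distinct_triples[OF tr])
    finally have "6 *\<^sub>R connection k \<theta>' x
        = 6 *\<^sub>R (connection k \<theta> x + (real ((k - 1) * (k - 2)) / 2) *\<^sub>R scale2 (1 / u x) (du x))"
      unfolding l1 suml by (simp add: scaleR_add_right)
    then show "connection k \<theta>' x
        = connection k \<theta> x + (real ((k - 1) * (k - 2)) / 2) *\<^sub>R scale2 (1 / u x) (du x)"
      by (rule scaleR_left_imp_eq[rotated]) simp
  qed
qed

lemma superposition_curvature_connection: "superposition_curvature k \<theta> = ext_deriv (connection k \<theta>)"
  by (simp add: superposition_curvature_def connection_def[abs_def])

lemma curvature_eq:
  assumes k: "2 \<le> k" and d: "decomposes k W N \<theta>" "m \<in> N"
  shows "curvature k W m = ext_deriv (connection k \<theta>) m"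
  unfolding curvature_def
proof (rule the_equality)
  show "\<exists>N \<theta>'. decomposes k W N \<theta>' \<and> m \<in> N \<and> ext_deriv (connection k \<theta>) m = superposition_curvature k \<theta>' m"
    using d by (auto simp: superposition_curvature_connection)
next
  fix \<kappa> assume "\<exists>N \<theta>'. decomposes k W N \<theta>' \<and> m \<in> N \<and> \<kappa> = superposition_curvature k \<theta>' m"
  then obtain N' \<theta>' where d': "decomposes k W N' \<theta>'" "m \<in> N'"
    and \<kappa>: "\<kappa> = ext_deriv (connection k \<theta>') m"
    unfolding superposition_curvature_connection by blast
  have "\<forall>\<^sub>F x in nhds m. connection k \<theta>' x = connection k \<theta> x + (real ((k - 1) * (k - 2)) / 2) *\<^sub>R scale2 (1 / 1) 0"
    by (rule connection_scale[OF k d d', of "\<lambda>_. 1" "\<lambda>_. 0"]) simp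
  then have "\<forall>\<^sub>F x in nhds m. connection k \<theta>' x = connection k \<theta> x"
    by (rule eventually_mono) (simp add: scale2_def flip: zero_prod_def)
  then show "\<kappa> = ext_deriv (connection k \<theta>) m" unfolding \<kappa> by (rule ext_deriv_cong)
qed

text \<open>A web given by its factors up to a unit: the unit can be absorbed in one factor.\<close>

lemma curvature_unit_multiple:
  assumes k: "2 \<le> k" and N: "open N" and m: "m \<in> N"
    and diff: "\<And>x i. x \<in> N \<Longrightarrow> i < k \<Longrightarrow> differentiable_form (\<omega> i) x"
    and tr: "\<And>x i j. x \<in> N \<Longrightarrow> i < k \<Longrightarrow> j < k \<Longrightarrow> i \<noteq> j \<Longrightarrow> wedge (\<omega> i x) (\<omega> j x) \<noteq> 0"
    and u: "\<And>x. x \<in> N \<Longrightarrow> u x \<noteq> 0" "\<And>x. x \<in> N \<Longrightarrow> has_grad u (du x) x"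
    and W: "\<And>x \<xi>. x \<in> N \<Longrightarrow> W x \<xi> = u x * (\<Prod>i<k. fst (\<omega> i x) * fst \<xi> + snd (\<omega> i x) * snd \<xi>)"
  shows "m \<notin> discriminant k W"
    and "curvature k W m = ext_deriv (\<lambda>x. connection k \<omega> x
      + (real ((k - 1) * (k - 2)) / 2) *\<^sub>R scale2 (1 / u x) (du x)) m"
proof -
  define \<theta> where "\<theta> i = (if i = 0 then (\<lambda>x. scale2 (u x) (\<omega> i x)) else \<omega> i)" for i :: nat
  have decI: "decomposes k V N \<gamma>"
    if "\<And>x i. x \<in> N \<Longrightarrow> i < k \<Longrightarrow> differentiable_form (\<gamma> i) x"
      "\<And>x i j. x \<in> N \<Longrightarrow> i < k \<Longrightarrow> j < k \<Longrightarrow> i \<noteq> j \<Longrightarrow> wedge (\<gamma> i x) (\<gamma> j x) \<noteq> 0"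
      "\<And>x \<xi>. x \<in> N \<Longrightarrow> V x \<xi> = (\<Prod>i<k. fst (\<gamma> i x) * fst \<xi> + snd (\<gamma> i x) * snd \<xi>)" for V \<gamma>
    unfolding decomposes_def holomorphic2_on_iff
    using that N unfolding differentiable_form_def by blast
  define W0 where "W0 x \<xi> = (\<Prod>i<k. fst (\<omega> i x) * fst \<xi> + snd (\<omega> i x) * snd \<xi>)" for x \<xi>
  have d0: "decomposes k W0 N \<omega>"
    by (rule decI[OF diff tr]) (simp_all add: W0_def)
  have d: "decomposes k W N \<theta>"
  proof (rule decI)
    fix x i assume x: "x \<in> N" "i < k"
    show "differentiable_form (\<theta> i) x"
      using ext_deriv_scale2(2)[OF u(2)[OF x(1)] diff[OF x]] diff[OF x] by (cases "i = 0") (simp_all add: \<theta>_def)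
  next
    fix x i j assume x: "x \<in> N" "i < k" "j < k" "i \<noteq> j"
    show "wedge (\<theta> i x) (\<theta> j x) \<noteq> 0"
      using tr[OF x] u(1)[OF x(1)] x(4) by (cases "i = 0"; cases "j = 0") (simp_all add: \<theta>_def wedge_simps)
  next
    fix x \<xi> assume x: "x \<in> N"
    have "{..<k} = insert 0 {1..<k}" using k by auto
    then have split: "(\<Prod>i<k. f i) = f 0 * (\<Prod>i\<in>{1..<k}. f i)" for f :: "nat \<Rightarrow> complex" by simp
    show "W x \<xi> = (\<Prod>i<k. fst (\<theta> i x) * fst \<xi> + snd (\<theta> i x) * snd \<xi>)"
      unfolding W[OF x] split by (simp add: \<theta>_def algebra_simps)
  qed
  show "m \<notin> discriminant k W" using d m by (auto simp: discriminant_def)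
  have "\<forall>\<^sub>F x in nhds m. connection k \<theta> x = connection k \<omega> x
      + (real ((k - 1) * (k - 2)) / 2) *\<^sub>R scale2 (1 / u x) (du x)"
  proof (rule connection_scale[OF k d0 m d m])
    show "\<forall>\<^sub>F x in nhds m. u x \<noteq> 0 \<and> has_grad u (du x) x \<and> (\<forall>\<xi>. W x \<xi> = u x * W0 x \<xi>)"
      using eventually_nhds_in_open[OF N m] by (rule eventually_mono) (simp add: u W W0_def)
  qed
  then show "curvature k W m = ext_deriv (\<lambda>x. connection k \<omega> x
      + (real ((k - 1) * (k - 2)) / 2) *\<^sub>R scale2 (1 / u x) (du x)) m"
    unfolding curvature_eq[OF k d m] by (rule ext_deriv_cong)
qed

section \<open>Webs invariant under a one-parameter group\<close>

text \<open>The value at \<open>0\<close> of the quadratic polynomial with values \<open>u, v, w\<close> at \<open>x, y, z\<close>.\<close>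

definition interpolate0 :: "complex \<Rightarrow> complex \<Rightarrow> complex \<Rightarrow> complex \<Rightarrow> complex \<Rightarrow> complex \<Rightarrow> complex" where
  "interpolate0 x y z u v w = u * (y * z) / ((y - x) * (z - x)) + v * (x * z) / ((x - y) * (z - y))
     + w * (x * y) / ((x - z) * (y - z))"

text \<open>The coefficient of \<open>dP\<close> in \<open>\<eta>\<^sub>r\<^sub>s\<^sub>t\<close>; being a function of \<open>P\<close>, it yields a closed form.\<close>

definition eta_slope :: "complex \<Rightarrow> complex \<Rightarrow> complex \<Rightarrow> complex \<Rightarrow> complex \<Rightarrow> complex \<Rightarrow> complex" where
  "eta_slope x y z u v w = (let D = (v - u) / (y - x) in
     - 2 * D - ((w - u) / (z - x) - D) / (z - y) * (z - x - y))"

text \<open>Newton's form of the interpolating polynomial makes the three compatibility equations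
  polynomial identities.\<close>

lemma eta_coefficient_identities:
  fixes x y z x' y' z' :: complex
  assumes d: "x \<noteq> y" "y \<noteq> z" "z \<noteq> x"
  defines "\<alpha> \<equiv> eta_slope x y z (1 - x') (1 - y') (1 - z')"
    and "\<beta> \<equiv> 1 - interpolate0 x y z (1 - x') (1 - y') (1 - z')"
  shows "(y' - z') * x + (y - z) * x' = (y - z) * (\<alpha> * x + \<beta>)"
    "(z' - x') * y + (z - x) * y' = (z - x) * (\<alpha> * y + \<beta>)"
    "(x' - y') * z + (x - y) * z' = (x - y) * (\<alpha> * z + \<beta>)"
proof -
  define D where "D = ((1 - y') - (1 - x')) / (y - x)"
  define V where "V = (((1 - z') - (1 - x')) / (z - x) - D) / (z - y)"
  have y': "y' = x' - D * (y - x)" using d by (simp add: D_def field_simps)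
  have "((1 - z') - (1 - x')) / (z - x) = D + V * (z - y)" using d by (simp add: V_def)
  then have "(1 - z') - (1 - x') = (D + V * (z - y)) * (z - x)"
    using d by (metis eq_iff_diff_eq_0 nonzero_divide_eq_eq)
  then have z': "z' = x' - D * (z - x) - V * (z - x) * (z - y)" by (simp add: algebra_simps)
  have \<alpha>: "\<alpha> = - 2 * D - V * (z - x - y)"
    unfolding \<alpha>_def eta_slope_def Let_def D_def[symmetric] V_def[symmetric] ..
  define l m n where "l = 1 / ((y - x) * (z - x))" and "m = 1 / ((x - y) * (z - y))"
    and "n = 1 / ((x - z) * (y - z))"
  have "interpolate0 x y z (1 - x') (1 - y') (1 - z') = (1 - x') * (y * z) * l + (1 - y') * (x * z) * m
      + (1 - z') * (x * y) * n"
    by (simp add: interpolate0_def l_def m_def n_def)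
  also have "\<dots> = (1 - x') * (y * z * l + x * z * m + x * y * n)
      + D * ((y - x) * (x * z) * m + (z - x) * (x * y) * n)
      + V * ((z - x) * (z - y) * (x * y) * n)"
    unfolding y' z' by (simp add: algebra_simps)
  also have "y * z * l + x * z * m + x * y * n = 1"
    using d unfolding l_def m_def n_def by (simp add: divide_simps) (simp add: algebra_simps)
  also have "(y - x) * (x * z) * m + (z - x) * (x * y) * n = - x"
    using d unfolding m_def n_def by (simp add: divide_simps) (simp add: algebra_simps)
  also have "(z - x) * (z - y) * (x * y) * n = x * y"
    using d unfolding n_def by (simp add: divide_simps) (simp add: algebra_simps)
  finally have \<beta>: "\<beta> = 1 - ((1 - x') - D * x + V * (x * y))" by (simp add: \<beta>_def)
  show "(y' - z') * x + (y - z) * x' = (y - z) * (\<alpha> * x + \<beta>)"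
    unfolding \<alpha> \<beta> y' z' by algebra
  show "(z' - x') * y + (z - x) * y' = (z - x) * (\<alpha> * y + \<beta>)"
    unfolding \<alpha> \<beta> y' z' by algebra
  show "(x' - y') * z + (x - y) * z' = (x - y) * (\<alpha> * z + \<beta>)"
    unfolding \<alpha> \<beta> y' z' by algebra
qed

lemma scale2_add_left: "scale2 (a + b) v = scale2 a v + scale2 b v"
  by (simp add: scale2_def algebra_simps)

lemma scale2_sum_left: "finite A \<Longrightarrow> scale2 (\<Sum>i\<in>A. f i) v = (\<Sum>i\<in>A. scale2 (f i) v)"
  by (induct A rule: finite_induct) (simp_all add: scale2_add_left, simp add: scale2_def zero_prod_def)

lemma scale2_of_real: "scale2 (of_real r) v = r *\<^sub>R v"
  by (simp add: scale2_def prod_eq_iff scaleR_conv_of_real)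

definition increasing_triples :: "nat \<Rightarrow> (nat \<times> nat \<times> nat) set" where
  "increasing_triples k = {(r, s, t). r < s \<and> s < t \<and> t < k}"

lemma finite_increasing_triples [simp]: "finite (increasing_triples k)"
  by (rule finite_subset[of _ "{..<k} \<times> {..<k} \<times> {..<k}"]) (auto simp: increasing_triples_def)

definition pencil_slope :: "(nat \<Rightarrow> complex \<Rightarrow> complex) \<Rightarrow> (nat \<Rightarrow> complex \<Rightarrow> complex) \<Rightarrow>
    nat \<times> nat \<times> nat \<Rightarrow> complex \<Rightarrow> complex" where
  "pencil_slope a a' = (\<lambda>(r, s, t) p.
     eta_slope (a r p) (a s p) (a t p) (1 - a' r p) (1 - a' s p) (1 - a' t p))"

definition pencil_height :: "(nat \<Rightarrow> complex \<Rightarrow> complex) \<Rightarrow> (nat \<Rightarrow> complex \<Rightarrow> complex) \<Rightarrow>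
    nat \<times> nat \<times> nat \<Rightarrow> complex \<Rightarrow> complex" where
  "pencil_height a a' = (\<lambda>(r, s, t) p.
     1 - interpolate0 (a r p) (a s p) (a t p) (1 - a' r p) (1 - a' s p) (1 - a' t p))"

context
  fixes k :: nat and N :: "c2 set" and a a' :: "nat \<Rightarrow> complex \<Rightarrow> complex"
    and P J :: "c2 \<Rightarrow> complex" and \<pi> \<psi> dJ :: one_form and \<omega> :: "nat \<Rightarrow> one_form"
  assumes N: "open N"
    and P: "\<And>x. x \<in> N \<Longrightarrow> has_grad P (\<pi> x) x"
    and \<pi>: "\<And>x. x \<in> N \<Longrightarrow> closed_form \<pi> x" and \<psi>: "\<And>x. x \<in> N \<Longrightarrow> closed_form \<psi> x"
    and J: "\<And>x. J x = wedge (\<pi> x) (\<psi> x)" "\<And>x. x \<in> N \<Longrightarrow> J x \<noteq> 0"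
      "\<And>x. x \<in> N \<Longrightarrow> has_grad J (dJ x) x"
    and a: "\<And>x i. x \<in> N \<Longrightarrow> i < k \<Longrightarrow> (a i has_field_derivative a' i (P x)) (at (P x))"
    and inj: "\<And>x i j. x \<in> N \<Longrightarrow> i < k \<Longrightarrow> j < k \<Longrightarrow> i \<noteq> j \<Longrightarrow> a i (P x) \<noteq> a j (P x)"
    and \<omega>: "\<And>i x. \<omega> i x = scale2 (a i (P x)) (\<psi> x) + scale2 (-1) (\<pi> x)"
begin

lemma pencil_wedge: "wedge (\<omega> i x) (\<omega> j x) = (a i (P x) - a j (P x)) * J x"
  by (simp add: \<omega> J(1) wedge_simps wedge_flip[of "\<psi> x" "\<pi> x"] algebra_simps)

lemma pencil_differentiable: "x \<in> N \<Longrightarrow> i < k \<Longrightarrow> differentiable_form (\<omega> i) x"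
proof -
  assume x: "x \<in> N" "i < k"
  have "differentiable_form \<pi> x" "differentiable_form \<psi> x"
    using \<pi>[OF x(1)] \<psi>[OF x(1)] by (auto simp: closed_form_def)
  from ext_deriv_add(2)[OF ext_deriv_scale2(2)[OF has_grad_chain[OF P[OF x(1)] a[OF x]] this(2)]
      ext_deriv_scale2(2)[OF has_grad_const[of "-1"] this(1)]]
  show "differentiable_form (\<omega> i) x" unfolding \<omega>[abs_def] .
qed

lemma pencil_transverse:
  assumes "x \<in> N" "(r, s, t) \<in> distinct_triples {..<k}"
  shows "transverse_at \<omega> x r s t"
  using assms pencil_differentiable inj J(2)
  by (auto simp: transverse_at_def distinct_triples_def pencil_wedge)

lemma pencil_ext_deriv_weighted:
  assumes x: "x \<in> N" and i: "r < k" "s < k" "t < k"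
  shows "ext_deriv (weighted \<omega> r s t) x = wedge (scale2 (1 / J x) (dJ x)) (weighted \<omega> r s t x)
    + J x * J x * ((a' s (P x) - a' t (P x)) * a r (P x) + (a s (P x) - a t (P x)) * a' r (P x))"
proof -
  have d: "differentiable_form \<pi> x" "differentiable_form \<psi> x" "ext_deriv \<pi> x = 0" "ext_deriv \<psi> x = 0"
    using \<pi>[OF x] \<psi>[OF x] by (auto simp: closed_form_def)
  define f where "f p = (a s p - a t p) * a r p" for p
  define g where "g p = - (a s p - a t p)" for p
  define f' where "f' = (a' s (P x) - a' t (P x)) * a r (P x) + (a s (P x) - a t (P x)) * a' r (P x)"
  define g' where "g' = - (a' s (P x) - a' t (P x))"
  define \<tau> where "\<tau> y = scale2 (f (P y)) (\<psi> y) + scale2 (g (P y)) (\<pi> y)" for y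
  have w: "weighted \<omega> r s t = (\<lambda>y. scale2 (J y) (\<tau> y))"
    unfolding weighted_def[abs_def] unfolding pencil_wedge unfolding \<omega> \<tau>_def f_def g_def
    by (rule ext) (simp add: scale2_def prod_eq_iff algebra_simps)
  have "(f has_field_derivative f') (at (P x))" "(g has_field_derivative g') (at (P x))"
    unfolding f_def[abs_def] g_def[abs_def] f'_def g'_def
    by (rule derivative_eq_intros a[OF x] i refl | simp)+
  note c = has_grad_chain[OF P[OF x] this(1)] has_grad_chain[OF P[OF x] this(2)]
  note e = ext_deriv_scale2[OF c(1) d(2)] ext_deriv_scale2[OF c(2) d(1)]
  note e' = ext_deriv_add[OF e(2,4), folded \<tau>_def]
  have "ext_deriv \<tau> x = f' * J x"
    unfolding e'(1) e(1) e(3) d by (simp add: wedge_simps J(1))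
  with ext_deriv_scale2(1)[OF J(3)[OF x] e'(2)]
  have "ext_deriv (weighted \<omega> r s t) x = wedge (dJ x) (\<tau> x) + J x * (f' * J x)"
    unfolding w by simp
  then show ?thesis using J(2)[OF x] unfolding w f'_def by (simp add: wedge_simps)
qed

text \<open>For a web invariant under a one-parameter group the equations for \<open>\<eta>\<^sub>r\<^sub>s\<^sub>t\<close> can be solved in
  closed form.\<close>

lemma pencil_eta:
  assumes x: "x \<in> N" and D: "(r, s, t) \<in> distinct_triples {..<k}"
  shows "eta \<omega> r s t x = scale2 (1 / J x) (dJ x)
    + (scale2 (pencil_slope a a' (r, s, t) (P x)) (\<pi> x) + scale2 (pencil_height a a' (r, s, t) (P x)) (\<psi> x))"
    (is "_ = ?l + (scale2 ?\<alpha> _ + scale2 ?\<beta> _)")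
proof (rule eta_eqI[OF pencil_transverse[OF x D]])
  have i: "r < k" "s < k" "t < k" using D by (auto simp: distinct_triples_def)
  have ne: "a r (P x) \<noteq> a s (P x)" "a s (P x) \<noteq> a t (P x)" "a t (P x) \<noteq> a r (P x)"
    using inj[OF x] D by (auto simp: distinct_triples_def)
  have wd: "wedge (?l + (scale2 ?\<alpha> (\<pi> x) + scale2 ?\<beta> (\<psi> x))) (weighted \<omega> i j l x)
      = wedge ?l (weighted \<omega> i j l x)
        + J x * J x * ((a j (P x) - a l (P x)) * (?\<alpha> * a i (P x) + ?\<beta>))" for i j l
  proof -
    have "wedge (scale2 ?\<alpha> (\<pi> x) + scale2 ?\<beta> (\<psi> x)) (weighted \<omega> i j l x)
        = J x * J x * ((a j (P x) - a l (P x)) * (?\<alpha> * a i (P x) + ?\<beta>))"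
      unfolding weighted_def pencil_wedge \<omega>
      by (simp add: wedge_simps J(1)[symmetric] wedge_flip[of "\<psi> x" "\<pi> x"]) algebra
    then show ?thesis by (simp add: wedge_simps)
  qed
  note id = eta_coefficient_identities[OF ne, where x'="a' r (P x)" and y'="a' s (P x)" and z'="a' t (P x)"]
  show "is_eta \<omega> r s t x (?l + (scale2 ?\<alpha> (\<pi> x) + scale2 ?\<beta> (\<psi> x)))"
    unfolding is_eta_def wd pencil_ext_deriv_weighted[OF x i] pencil_ext_deriv_weighted[OF x i(2,3,1)]
      pencil_ext_deriv_weighted[OF x i(3,1,2)]
    using id by (simp add: pencil_slope_def pencil_height_def)
qed

lemma pencil_connection:
  assumes x: "x \<in> N"
  shows "connection k \<omega> x = scale2 (of_nat (card (increasing_triples k))) (scale2 (1 / J x) (dJ x))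
    + (scale2 (\<Sum>T\<in>increasing_triples k. pencil_slope a a' T (P x)) (\<pi> x)
      + scale2 (\<Sum>T\<in>increasing_triples k. pencil_height a a' T (P x)) (\<psi> x))"
proof -
  have "connection k \<omega> x = (\<Sum>T\<in>increasing_triples k. scale2 1 (scale2 (1 / J x) (dJ x))
    + (scale2 (pencil_slope a a' T (P x)) (\<pi> x) + scale2 (pencil_height a a' T (P x)) (\<psi> x)))"
    unfolding connection_def increasing_triples_def[symmetric]
  proof (rule sum.cong[OF refl])
    fix T assume T: "T \<in> increasing_triples k"
    obtain r s t where rst: "T = (r, s, t)" by (cases T)
    then have "(r, s, t) \<in> distinct_triples {..<k}"
      using T by (auto simp: increasing_triples_def distinct_triples_def)
    from pencil_eta[OF x this] rst
    show "(case T of (r, s, t) \<Rightarrow> eta \<omega> r s t x) = scale2 1 (scale2 (1 / J x) (dJ x))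
      + (scale2 (pencil_slope a a' T (P x)) (\<pi> x) + scale2 (pencil_height a a' T (P x)) (\<psi> x))" by simp
  qed
  also have "\<dots> = scale2 (\<Sum>T\<in>increasing_triples k. 1) (scale2 (1 / J x) (dJ x))
    + (scale2 (\<Sum>T\<in>increasing_triples k. pencil_slope a a' T (P x)) (\<pi> x)
      + scale2 (\<Sum>T\<in>increasing_triples k. pencil_height a a' T (P x)) (\<psi> x))"
    by (simp only: sum.distrib scale2_sum_left[OF finite_increasing_triples])
  finally show ?thesis by simp
qed

lemma pencil_slope_differentiable:
  assumes x: "x \<in> N" and a'': "\<And>i. i < k \<Longrightarrow> \<exists>D. (a' i has_field_derivative D) (at (P x))"
    and T: "T \<in> increasing_triples k"
  shows "\<exists>D. (pencil_slope a a' T has_field_derivative D) (at (P x))"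
proof -
  obtain r s t where rst: "T = (r, s, t)" by (cases T)
  then have i: "r < k" "s < k" "t < k" "r \<noteq> s" "s \<noteq> t" "t \<noteq> r"
    using T by (auto simp: increasing_triples_def)
  have a1: "a j field_differentiable at (P x)" "a' j field_differentiable at (P x)" if "j < k" for j
    using a[OF x that] a''[OF that] by (auto simp: field_differentiable_def)
  have ne: "a s (P x) - a r (P x) \<noteq> 0" "a t (P x) - a r (P x) \<noteq> 0" "a t (P x) - a s (P x) \<noteq> 0"
    using inj[OF x] i by auto
  have "pencil_slope a a' T field_differentiable at (P x)"
    unfolding rst pencil_slope_def eta_slope_def Let_def prod.case
    by (intro field_differentiable_diff field_differentiable_mult field_differentiable_divide
        field_differentiable_const a1 i ne)
  then show ?thesis by (simp add: field_differentiable_def)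
qed

text \<open>The curvature of such a web is \<open>B' (P) dP \<and> \<psi>\<close>, where \<open>B\<close> is the sum of the heights.\<close>

lemma pencil_curvature:
  assumes k: "2 \<le> k" and m: "m \<in> N"
    and a'': "\<And>i. i < k \<Longrightarrow> \<exists>D. (a' i has_field_derivative D) (at (P m))"
    and u: "\<And>x. x \<in> N \<Longrightarrow> u x \<noteq> 0" "\<And>x. x \<in> N \<Longrightarrow> has_grad u (du x) x"
    and W: "\<And>x \<xi>. x \<in> N \<Longrightarrow> W x \<xi> = u x * (\<Prod>i<k. fst (\<omega> i x) * fst \<xi> + snd (\<omega> i x) * snd \<xi>)"
    and cl: "closed_form (\<lambda>x. scale2 (1 / J x) (dJ x)) m" "closed_form (\<lambda>x. scale2 (1 / u x) (du x)) m"
    and B: "((\<lambda>p. \<Sum>T\<in>increasing_triples k. pencil_height a a' T p) has_field_derivative B') (at (P m))"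
  shows "m \<notin> discriminant k W" and "curvature k W m = B' * J m"
proof -
  have tr: "wedge (\<omega> i x) (\<omega> j x) \<noteq> 0" if "x \<in> N" "i < k" "j < k" "i \<noteq> j" for x i j
    using inj[OF that] J(2)[OF that(1)] by (simp add: pencil_wedge)
  note c = curvature_unit_multiple[OF k N m pencil_differentiable tr u W]
  show "m \<notin> discriminant k W" by (rule c(1))
  have "\<forall>T\<in>increasing_triples k. \<exists>D. (pencil_slope a a' T has_field_derivative D) (at (P m))"
    using pencil_slope_differentiable[OF m a''] by blast
  then obtain D where "\<forall>T\<in>increasing_triples k. (pencil_slope a a' T has_field_derivative D T) (at (P m))"
    by (rule bchoice[THEN exE])
  then have A: "((\<lambda>p. \<Sum>T\<in>increasing_triples k. pencil_slope a a' T p) has_field_derivative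
      (\<Sum>T\<in>increasing_triples k. D T)) (at (P m))"
    by (intro DERIV_sum) simp
  have d: "differentiable_form \<pi> m" "differentiable_form \<psi> m" "ext_deriv \<pi> m = 0" "ext_deriv \<psi> m = 0"
    using \<pi>[OF m] \<psi>[OF m] by (auto simp: closed_form_def)
  note eA = ext_deriv_scale2[OF has_grad_chain[OF P[OF m] A] d(1)]
  note eB = ext_deriv_scale2[OF has_grad_chain[OF P[OF m] B] d(2)]
  note eAB = ext_deriv_add[OF eA(2) eB(2)]
  note eJ = closed_form_const_scale[OF cl(1), of "of_nat (card (increasing_triples k))"]
  note eu = closed_form_const_scale[OF cl(2), of "of_real (real ((k - 1) * (k - 2)) / 2)"]
  define \<Lambda> where "\<Lambda> x = scale2 (of_nat (card (increasing_triples k))) (scale2 (1 / J x) (dJ x))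
    + (scale2 (\<Sum>T\<in>increasing_triples k. pencil_slope a a' T (P x)) (\<pi> x)
      + scale2 (\<Sum>T\<in>increasing_triples k. pencil_height a a' T (P x)) (\<psi> x))" for x
  note e1 = ext_deriv_add[OF eJ[unfolded closed_form_def, THEN conjunct1] eAB(2), folded \<Lambda>_def]
  note e2 = ext_deriv_add[OF e1(2) eu[unfolded closed_form_def, THEN conjunct1]]
  have "\<forall>\<^sub>F x in nhds m. connection k \<omega> x + (real ((k - 1) * (k - 2)) / 2) *\<^sub>R scale2 (1 / u x) (du x)
      = \<Lambda> x + scale2 (of_real (real ((k - 1) * (k - 2)) / 2)) (scale2 (1 / u x) (du x))"
    using eventually_nhds_in_open[OF N m]
    by (rule eventually_mono) (simp only: pencil_connection \<Lambda>_def scale2_of_real)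
  then have "curvature k W m = ext_deriv (\<lambda>x. \<Lambda> x
      + scale2 (of_real (real ((k - 1) * (k - 2)) / 2)) (scale2 (1 / u x) (du x))) m"
    using c(2) ext_deriv_cong by simp
  also have "\<dots> = B' * wedge (\<pi> m) (\<psi> m)"
    unfolding e2(1) e1(1) eAB(1) eA(1) eB(1)
    using eJ eu d by (simp add: closed_form_def wedge_simps)
  finally show "curvature k W m = B' * J m" by (simp add: J(1))
qed

end

section \<open>Binary forms\<close>

definition bform :: "nat \<Rightarrow> complex poly \<Rightarrow> complex \<Rightarrow> complex \<Rightarrow> complex" where
  "bform d p x y = (\<Sum>j\<le>d. coeff p j * x ^ (d - j) * y ^ j)"

lemma poly_sum_upto:
  fixes p :: "complex poly"
  shows "degree p \<le> d \<Longrightarrow> poly p x = (\<Sum>j\<le>d. coeff p j * x ^ j)"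
  unfolding poly_altdef by (rule sum.mono_neutral_left) (auto simp: coeff_eq_0)

lemma bform_eq_poly:
  assumes "degree p \<le> d" "x \<noteq> 0"
  shows "bform d p x y = x ^ d * poly p (y / x)"
  unfolding bform_def poly_sum_upto[OF assms(1)] sum_distrib_left
proof (rule sum.cong[OF refl])
  fix j assume "j \<in> {..d}"
  then have "x ^ d = x ^ (d - j) * x ^ j" by (simp flip: power_add)
  then show "coeff p j * x ^ (d - j) * y ^ j = x ^ d * (coeff p j * (y / x) ^ j)"
    using assms(2) by (simp add: power_divide)
qed

lemma bform_1: "degree p \<le> d \<Longrightarrow> bform d p 1 s = poly p s"
  by (simp add: bform_eq_poly)

lemma bform_0_left: "bform d p 0 y = coeff p d * y ^ d"
proof -
  have "bform d p 0 y = (\<Sum>j\<in>{d}. coeff p j * 0 ^ (d - j) * y ^ j)"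
    unfolding bform_def by (rule sum.mono_neutral_right) auto
  then show ?thesis by simp
qed

lemma bform_scale: "bform d p (t * x) (t * y) = t ^ d * bform d p x y"
  unfolding bform_def sum_distrib_left
proof (rule sum.cong[OF refl])
  fix j assume "j \<in> {..d}"
  then have "t ^ d = t ^ (d - j) * t ^ j" by (simp flip: power_add)
  then show "coeff p j * (t * x) ^ (d - j) * (t * y) ^ j = t ^ d * (coeff p j * x ^ (d - j) * y ^ j)"
    by (simp add: power_mult_distrib)
qed

lemma poly_eqI_nonzero:
  fixes p q :: "complex poly"
  assumes "\<And>s. s \<noteq> 0 \<Longrightarrow> poly p s = poly q s"
  shows "p = q"
proof -
  have "poly ((p - q) * [:0, 1:]) s = 0" for s using assms[of s] by (cases "s = 0") auto
  then have "(p - q) * [:0, 1:] = 0" by (intro poly_all_0_iff_0[THEN iffD1] allI)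
  then show ?thesis by simp
qed

lemma degree_le_reverse:
  fixes p q :: "complex poly"
  assumes "\<And>s. s \<noteq> 0 \<Longrightarrow> poly p s = s ^ d * poly q (1 / s)"
  shows "degree p \<le> d"
proof (cases "p = 0")
  case False
  have "p * monom 1 (degree q) = monom 1 d * reflect_poly q"
  proof (rule poly_eqI_nonzero)
    fix s :: complex assume "s \<noteq> 0"
    then show "poly (p * monom 1 (degree q)) s = poly (monom 1 d * reflect_poly q) s"
      using assms by (simp add: poly_monom poly_reflect_poly_nz divide_inverse)
  qed
  then have "degree (p * monom 1 (degree q)) \<le> degree (monom 1 d :: complex poly) + degree (reflect_poly q)"
    by (metis degree_mult_le)
  also have "\<dots> \<le> d + degree q"
    by (intro add_mono degree_reflect_poly_le) (simp add: degree_monom_le)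
  finally show ?thesis using False by (simp add: degree_mult_eq degree_monom_eq)
qed simp

lemma binary_form_exists:
  assumes d: "1 \<le> d" and hom: "\<And>t x y. t \<noteq> 0 \<Longrightarrow> f (t * x) (t * y) = t ^ d * f x y"
    and p: "\<And>s. poly p s = f 1 s" and q: "\<And>s. poly q s = f s 1"
  shows "degree p \<le> d" "f = bform d p"
proof -
  show deg: "degree p \<le> d"
  proof (rule degree_le_reverse)
    fix s :: complex assume "s \<noteq> 0"
    then show "poly p s = s ^ d * poly q (1 / s)" using hom[of s "1 / s" 1] by (simp add: p q)
  qed
  have nz: "f x y = bform d p x y" if "x \<noteq> 0" for x y
    using hom[OF that, of 1 "y / x"] that by (simp add: bform_eq_poly[OF deg that] p)
  have "((\<lambda>s. poly q s) \<longlongrightarrow> poly q 0) (at 0)"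
    using poly_isCont[of 0 q] unfolding isCont_def .
  moreover have "((\<lambda>s. poly q s) \<longlongrightarrow> bform d p 0 1) (at 0)"
  proof (rule Lim_transform_eventually)
    show "((\<lambda>s. bform d p s 1) \<longlongrightarrow> bform d p 0 1) (at 0)"
      unfolding bform_def by (intro tendsto_intros)
    show "\<forall>\<^sub>F s in at 0. bform d p s 1 = poly q s"
      by (auto simp: eventually_at_filter q nz)
  qed
  ultimately have "f 0 1 = bform d p 0 1" using q[of 0] by (metis LIM_unique)
  then have "f 0 y = bform d p 0 y" if "y \<noteq> 0" for y
    using hom[OF that, of 0 1] bform_scale[of d p y 0 1] by simp
  moreover have "f 0 0 = bform d p 0 0"
  proof -
    have "of_nat (2 ^ d) \<noteq> (of_nat 1 :: complex)"
      using d unfolding of_nat_eq_iff by (simp add: power_eq_if)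
    then have "(2::complex) ^ d \<noteq> 1" by simp
    then show ?thesis using hom[of 2 0 0] d by (simp add: bform_0_left)
  qed
  ultimately have "f x y = bform d p x y" for x y using nz by (cases "x = 0"; cases "y = 0") auto
  then show "f = bform d p" by (intro ext)
qed

section \<open>Changes of projective coordinates\<close>

lemma vec3_eqI: "u$1 = v$1 \<Longrightarrow> u$2 = v$2 \<Longrightarrow> u$3 = v$3 \<Longrightarrow> u = (v :: 'a^3)"
  by (simp add: vec_eq_iff forall_3)

lemma vec3_eta: "vector [v$1, v$2, v$3] = (v :: 'a::zero^3)"
  by (rule vec3_eqI) (simp_all add: vector_3)

lemma vector_matrix_3:
  fixes M :: "'a::comm_ring_1^3^3"
  shows "(l v* M) $ j = l$1 * M$1$j + l$2 * M$2$j + l$3 * M$3$j"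
  by (simp add: vector_matrix_mult_def sum_3 mult.commute)

lemma matrix_vector_3:
  fixes M :: "'a::comm_ring_1^3^3"
  shows "(M *v v) $ i = M$i$1 * v$1 + M$i$2 * v$2 + M$i$3 * v$3"
  by (simp add: matrix_vector_mult_def sum_3)

lemma dot3_adjoint: "dot3 (l v* M) v = dot3 l (M *v v)"
  by (simp add: dot3_def vector_matrix_3 matrix_vector_3 algebra_simps)

lemma cross_components: "cross u v $ 1 = u$2 * v$3 - u$3 * v$2"
  "cross u v $ 2 = u$3 * v$1 - u$1 * v$3" "cross u v $ 3 = u$1 * v$2 - u$2 * v$1"
  by (simp_all add: cross_def vector_3)

lemma cross_vector_matrix:
  fixes M :: "complex^3^3"
  shows "M *v cross (l v* M) (l' v* M) = det M *s cross l l'"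
  by (rule vec3_eqI) (simp_all add: cross_components vector_matrix_3 matrix_vector_3 det_3 algebra_simps)

lemma invertible_inverse:
  fixes g :: "complex^3^3"
  assumes "invertible g"
  shows "g ** matrix_inv g = mat 1" "matrix_inv g ** g = mat 1" "invertible (matrix_inv g)"
    "g *v (matrix_inv g *v v) = v" "matrix_inv g *v (g *v v) = v"
    "(l v* g) v* matrix_inv g = l" "(l v* matrix_inv g) v* g = l" "det g \<noteq> 0"
proof -
  show 1: "g ** matrix_inv g = mat 1" "matrix_inv g ** g = mat 1"
    using someI_ex[of "\<lambda>A'. g ** A' = mat 1 \<and> A' ** g = mat 1"] assms
    unfolding invertible_def matrix_inv_def by blast+
  then show "invertible (matrix_inv g)" using invertible_def by blast
  show "g *v (matrix_inv g *v v) = v" "matrix_inv g *v (g *v v) = v"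
    by (simp_all add: 1 matrix_vector_mul_assoc)
  show "(l v* g) v* matrix_inv g = l" "(l v* matrix_inv g) v* g = l"
    by (simp_all add: 1 vector_matrix_mul_assoc)
  show "det g \<noteq> 0" using assms by (simp add: invertible_det_nz)
qed

lemma vector_matrix_eq_0_iff:
  fixes g :: "complex^3^3"
  shows "invertible g \<Longrightarrow> l v* g = 0 \<longleftrightarrow> l = 0"
  using invertible_inverse(6)[of g l] by auto

lemma matrix_vector_eq_0_iff:
  fixes g :: "complex^3^3"
  shows "invertible g \<Longrightarrow> g *v v = 0 \<longleftrightarrow> v = 0"
  using invertible_inverse(5)[of g v] by auto

lemma eval_form_scale:
  assumes "foliation d \<Omega>"
  shows "eval_form \<Omega> (t *s v) = t ^ (d + 1) *s eval_form \<Omega> v"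
proof -
  have "homogeneous3 (d + 1) (\<Omega>$i)" for i using assms unfolding foliation_def by blast
  from eval3_scale[OF this] show ?thesis by (simp only: vec_eq_iff eval_form_def vec_lambda_beta vector_smult_component) simp
qed

lemma eval_form_euler:
  assumes "foliation d \<Omega>"
  shows "dot3 (eval_form \<Omega> v) v = 0"
proof -
  have "eval3 (\<Sum>i\<in>UNIV. xyz$i * \<Omega>$i) v = 0" using assms by (simp add: foliation_def)
  then show ?thesis by (simp add: eval3_sum sum_3 dot3_def eval_form_def mult.commute)
qed

lemma eval_form_pullback:
  "eval_form (pullback g \<Omega>) v = eval_form \<Omega> (g *v v) v* g"
proof -
  have "(\<chi> i. eval3 (((\<chi> i j. const3 (g$i$j)) *v xyz)$i) v) = g *v v"
    by (rule vec3_eqI) (simp_all add: matrix_vector_3)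
  then show ?thesis
    by (simp add: vec_eq_iff pullback_def Let_def eval_form_def vector_matrix_3 eval3_subst3)
qed

text \<open>The coefficients of a foliation do not vanish simultaneously on a line of the projective plane,
  since the equation of that line would be a common factor.\<close>

lemma no_line_of_singularities:
  assumes "foliation d \<Omega>" "invertible g" "l \<noteq> 0"
  shows "\<exists>v. dot3 l v = 0 \<and> eval_form \<Omega> (g *v v) \<noteq> 0"
proof (rule ccontr)
  assume *: "\<not> ?thesis"
  define l' where "l' = l v* matrix_inv g"
  have l': "l' \<noteq> 0" using assms by (simp add: l'_def vector_matrix_eq_0_iff invertible_inverse)
  have "linear_form l' dvd \<Omega>$i" for i
    unfolding linear_form_dvd_iff[OF l']
  proof (intro allI impI)
    fix v assume "dot3 l' v = 0"
    then have "dot3 l (matrix_inv g *v v) = 0" by (simp add: l'_def dot3_adjoint)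
    then have "eval_form \<Omega> (g *v (matrix_inv g *v v)) = 0" using * by blast
    then show "eval3 (\<Omega>$i) v = 0" using assms by (simp add: invertible_inverse eval_form_def vec_eq_iff)
  qed
  then have "linear_form l' dvd 1" using assms(1) by (auto simp: foliation_def no_common_factor_def)
  then show False using linear_form_prime[OF l'] by (simp add: prime_elem_def)
qed

section \<open>Normal form of a homogeneous foliation\<close>

definition normal_chart :: "nat \<Rightarrow> poly3^3 \<Rightarrow> complex^3^3 \<Rightarrow> complex poly \<Rightarrow> complex poly \<Rightarrow> bool" where
  "normal_chart d \<Omega> g a b \<longleftrightarrow> invertible g \<and> degree a \<le> d \<and> degree b \<le> d \<and>
     (\<forall>v. eval_form \<Omega> (g *v v) v* g = vector [v$3 * bform d a (v$1) (v$2), v$3 * bform d b (v$1) (v$2),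
        - (v$1 * bform d a (v$1) (v$2) + v$2 * bform d b (v$1) (v$2))]) \<and>
     (\<forall>x y. (x, y) \<noteq> (0, 0) \<longrightarrow> bform d a x y \<noteq> 0 \<or> bform d b x y \<noteq> 0)"

text \<open>A common zero of the two binary forms would give a line of singularities.\<close>

lemma normal_chartI:
  assumes fol: "foliation d \<Omega>" and g: "invertible g" and deg: "degree a \<le> d" "degree b \<le> d"
    and F: "\<And>v. eval_form \<Omega> (g *v v) v* g = vector [v$3 * bform d a (v$1) (v$2), v$3 * bform d b (v$1) (v$2),
        - (v$1 * bform d a (v$1) (v$2) + v$2 * bform d b (v$1) (v$2))]"
  shows "normal_chart d \<Omega> g a b"
proof -
  have "bform d a x y \<noteq> 0 \<or> bform d b x y \<noteq> 0" if xy: "(x, y) \<noteq> (0, 0)" for x y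
  proof (rule ccontr)
    assume *: "\<not> ?thesis"
    have l: "(vector [y, - x, 0] :: complex^3) \<noteq> 0"
      using xy by (auto simp: vec_eq_iff forall_3 vector_3)
    obtain v where v: "dot3 (vector [y, - x, 0]) v = 0" "eval_form \<Omega> (g *v v) \<noteq> 0"
      using no_line_of_singularities[OF fol g l] by blast
    then have "y * v$1 = x * v$2" by (simp add: dot3_def vector_3)
    then have "\<exists>t. v$1 = t * x \<and> v$2 = t * y"
    proof (cases "x = 0")
      case True
      with \<open>y * v$1 = x * v$2\<close> xy have "v$1 = 0" "y \<noteq> 0" by auto
      then show ?thesis using True by (intro exI[of _ "v$2 / y"]) simp
    next
      case False
      with \<open>y * v$1 = x * v$2\<close> show ?thesis by (intro exI[of _ "v$1 / x"]) (simp add: field_simps)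
    qed
    then obtain t where "v$1 = t * x" "v$2 = t * y" by blast
    then have "eval_form \<Omega> (g *v v) v* g = 0"
      unfolding F using * by (simp add: bform_scale vec_eq_iff forall_3 vector_3)
    then show False using v(2) g by (simp add: vector_matrix_eq_0_iff)
  qed
  then show ?thesis using assms by (simp add: normal_chart_def)
qed

lemma polynomial_dilation_eigenvector:
  fixes u :: "complex poly"
  assumes "\<And>z. poly u (2 * z) = c * poly u z" "u \<noteq> 0"
  shows "c = 2 ^ degree u" "poly u z = poly u 1 * z ^ degree u"
proof -
  have "pcompose u [:0, 2:] = smult c u"
  proof (rule poly_eqI_nonzero)
    fix s :: complex
    show "poly (pcompose u [:0, 2:]) s = poly (smult c u) s"
      using assms(1)[of s] by (simp add: poly_pcompose mult.commute)
  qed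
  then have co: "2 ^ i * coeff u i = c * coeff u i" for i
    by (metis coeff_pcompose_linear coeff_smult)
  from co[of "degree u"] show c: "c = 2 ^ degree u" using assms(2) by simp
  have "coeff u i = 0" if "i \<noteq> degree u" for i
  proof -
    have "(of_nat (2 ^ i) :: complex) \<noteq> of_nat (2 ^ degree u)" using that unfolding of_nat_eq_iff by simp
    then show ?thesis using co[of i] unfolding c by auto
  qed
  then have "u = monom (lead_coeff u) (degree u)" by (intro poly_eqI) auto
  then have "poly u z = lead_coeff u * z ^ degree u" for z by (metis poly_monom)
  from this[of z] this[of 1] show "poly u z = poly u 1 * z ^ degree u" by simp
qed

lemma eval_form_on_line: "\<exists>p. \<forall>t. poly p t = eval_form \<Omega> (u + t *s w) $ i"
  unfolding eval_form_def using eval3_on_line[of "\<Omega>$i" u w] by simp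

lemma eval_form_pullback_on_line:
  fixes g :: "complex^3^3"
  shows "\<exists>p. \<forall>t. poly p t = (eval_form \<Omega> (g *v (u + t *s w)) v* g) $ i"
  using eval_form_on_line[of "pullback g \<Omega>" u w i] by (simp add: eval_form_pullback)

text \<open>Invariance under homotheties forces all monomials of the two horizontal coefficients to contain
  \<open>z\<close> to the same power \<open>e\<close>. That no line consists of singularities excludes \<open>e \<ge> 2\<close> (the line at
  infinity) and \<open>e = 0\<close> (a line through the centre).\<close>

lemma normal_chart_exists:
  assumes d: "1 \<le> d" and fol: "foliation d \<Omega>" and hom: "homogeneous_foliation \<Omega>"
  shows "\<exists>g a b. normal_chart d \<Omega> g a b"
proof -
  obtain g where g: "invertible g" and inv: "\<And>t. t \<noteq> 0 \<Longrightarrow>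
      \<exists>\<mu>. \<mu> \<noteq> 0 \<and> pullback (homothety t) (pullback g \<Omega>) = const3 \<mu> *s pullback g \<Omega>"
    using hom unfolding homogeneous_foliation_def by blast
  define F where "F x y z = eval_form \<Omega> (g *v vector [x, y, z]) v* g" for x y z
  have F0: "F x y z = 0 \<longleftrightarrow> eval_form \<Omega> (g *v vector [x, y, z]) = 0" for x y z
    using g by (simp add: F_def vector_matrix_eq_0_iff)
  have scale: "F (t * x) (t * y) (t * z) $ i = t ^ (d + 1) * F x y z $ i" for t x y z i
  proof -
    have "g *v vector [t * x, t * y, t * z] = t *s (g *v vector [x, y, z])"
      by (rule vec3_eqI) (simp_all add: matrix_vector_3 vector_3 algebra_simps)
    then show ?thesis
      by (simp add: F_def eval_form_scale[OF fol] vector_matrix_3 algebra_simps)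
  qed
  have euler: "x * F x y z $ 1 + y * F x y z $ 2 + z * F x y z $ 3 = 0" for x y z
    using eval_form_euler[OF fol, of "g *v vector [x, y, z]"]
    by (simp add: F_def dot3_adjoint[symmetric]) (simp add: dot3_def vector_3 mult.commute)
  have polyx: "\<exists>p. \<forall>s. poly p s = F s y z $ i" and polyy: "\<exists>p. \<forall>s. poly p s = F x s z $ i"
    and polyz: "\<exists>p. \<forall>s. poly p s = F x y s $ i" for x y z i
  proof -
    have "vector [0, y, z] + s *s vector [1, 0, 0] = (vector [s, y, z] :: complex^3)"
      "vector [x, 0, z] + s *s vector [0, 1, 0] = (vector [x, s, z] :: complex^3)"
      "vector [x, y, 0] + s *s vector [0, 0, 1] = (vector [x, y, s] :: complex^3)" for s
      by (rule vec3_eqI; simp add: vector_3)+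
    note e = this
    show "\<exists>p. \<forall>s. poly p s = F s y z $ i" "\<exists>p. \<forall>s. poly p s = F x s z $ i" "\<exists>p. \<forall>s. poly p s = F x y s $ i"
      using eval_form_pullback_on_line[of \<Omega> g "vector [0, y, z]" "vector [1, 0, 0]" i]
        eval_form_pullback_on_line[of \<Omega> g "vector [x, 0, z]" "vector [0, 1, 0]" i]
        eval_form_pullback_on_line[of \<Omega> g "vector [x, y, 0]" "vector [0, 0, 1]" i]
      unfolding e F_def by blast+
  qed
  obtain \<mu> where \<mu>: "\<mu> \<noteq> 0" "pullback (homothety 2) (pullback g \<Omega>) = const3 \<mu> *s pullback g \<Omega>"
    using inv[of 2] by auto
  have hv: "homothety 2 *v vector [x, y, z] = vector [2 * x, 2 * y, z]" for x y z
    by (rule vec3_eqI) (simp_all add: matrix_vector_3 vector_3 homothety_def)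
  have torus: "(F (2 * x) (2 * y) z v* homothety 2) $ i = \<mu> * F x y z $ i" for x y z i
  proof -
    have "eval_form (pullback (homothety 2) (pullback g \<Omega>)) (vector [x, y, z]) $ i
        = \<mu> * eval_form (pullback g \<Omega>) (vector [x, y, z]) $ i"
      unfolding \<mu>(2) by (simp add: eval_form_def)
    then show ?thesis unfolding eval_form_pullback hv by (simp add: F_def)
  qed
  define c where "c = 2 ^ (d + 2) / \<mu>"
  have dil: "F x y (2 * z) $ 1 = c * F x y z $ 1" "F x y (2 * z) $ 2 = c * F x y z $ 2"
    "F x y (2 * z) $ 3 = c / 2 * F x y z $ 3" for x y z
    using torus[of x y "2 * z" 1] torus[of x y "2 * z" 2] torus[of x y "2 * z" 3] \<mu>(1)
      scale[of 2 x y z 1] scale[of 2 x y z 2] scale[of 2 x y z 3]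
    by (simp_all add: c_def vector_matrix_3 homothety_def vector_3 field_simps)
  have line: "\<exists>v. dot3 l v = 0 \<and> F (v$1) (v$2) (v$3) \<noteq> 0" if l: "l \<noteq> 0" for l
    using no_line_of_singularities[OF fol g l] by (simp add: F0 vec3_eta)
  have linev: "False" if xy: "(x0, y0) \<noteq> (0, 0)" and z: "\<And>t z. F (t * x0) (t * y0) z = 0" for x0 y0
  proof -
    have l: "(vector [y0, - x0, 0] :: complex^3) \<noteq> 0"
      using xy by (auto simp: vec_eq_iff forall_3 vector_3)
    obtain v where v: "dot3 (vector [y0, - x0, 0]) v = 0" "F (v$1) (v$2) (v$3) \<noteq> 0"
      using line[OF l] by blast
    then have e: "y0 * v$1 = x0 * v$2" by (simp add: dot3_def vector_3)
    have "\<exists>t. v$1 = t * x0 \<and> v$2 = t * y0"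
    proof (cases "x0 = 0")
      case True
      with e xy show ?thesis by (intro exI[of _ "v$2 / y0"]) auto
    next
      case False
      with e show ?thesis by (intro exI[of _ "v$1 / x0"]) (simp add: field_simps)
    qed
    then show False using v(2) z by metis
  qed
  have ex: "\<exists>x y z i. i \<noteq> 3 \<and> F x y z $ i \<noteq> 0"
  proof (rule ccontr)
    assume "\<not> ?thesis"
    then have "F x y z $ i = 0" if "i \<noteq> 3" for x y z i using that by blast
    from this[of 1] this[of 2] have 0: "F x y z $ 1 = 0" "F x y z $ 2 = 0" for x y z by simp_all
    have nz3: "F x y z $ 3 = 0" if "z \<noteq> 0" for x y z using euler[of x y z] 0 that by simp
    have "F x y z $ 3 = 0" for x y z
    proof -
      obtain p where p: "\<And>s. poly p s = F x y s $ 3" using polyz by metis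
      have "p = 0" by (rule poly_eqI_nonzero) (simp add: p nz3)
      then show ?thesis using p[of z] by simp
    qed
    with 0 have "F x y z = 0" for x y z by (intro vec3_eqI) simp_all
    then show False using line[of "vector [1, 0, 0]"] by (auto simp: vec_eq_iff forall_3 vector_3)
  qed
  then obtain x1 y1 z1 i1 where 1: "i1 \<noteq> 3" "F x1 y1 z1 $ i1 \<noteq> 0" by blast
  obtain u1 where u1: "\<And>s. poly u1 s = F x1 y1 s $ i1" using polyz by metis
  define e where "e = degree u1"
  have i1: "i1 = 1 \<or> i1 = 2" using 1(1) exhaust_3[of i1] by blast
  have "u1 \<noteq> 0" using u1[of z1] 1(2) by auto
  moreover have "poly u1 (2 * z) = c * poly u1 z" for z
    using dil(1)[of x1 y1 z] dil(2)[of x1 y1 z] i1 by (auto simp: u1)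
  ultimately have c: "c = 2 ^ e" unfolding e_def by (rule polynomial_dilation_eigenvector(1)[rotated])
  have pw: "F x y z $ i = F x y 1 $ i * z ^ e" if "i \<noteq> 3" for x y z i
  proof -
    obtain u where u: "\<And>s. poly u s = F x y s $ i" using polyz by metis
    show ?thesis
    proof (cases "u = 0")
      case True then show ?thesis using u[of z] u[of 1] by simp
    next
      case False
      have *: "poly u (2 * z) = c * poly u z" for z
        using dil(1)[of x y z] dil(2)[of x y z] that exhaust_3[of i] by (auto simp: u)
      have "(of_nat (2 ^ e) :: complex) = of_nat (2 ^ degree u)"
        using polynomial_dilation_eigenvector(1)[OF * False] c by simp
      then have "e = degree u" unfolding of_nat_eq_iff by simp
      then show ?thesis using polynomial_dilation_eigenvector(2)[OF * False, of z] u by simp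
    qed
  qed
  have F3: "F x y z $ 3 = 0" if e0: "e = 0 \<or> (2 \<le> e \<and> z = 0)" for x y z
  proof -
    obtain u where u: "\<And>s. poly u s = F x y s $ 3" using polyz by metis
    show ?thesis
    proof (cases "u = 0")
      case True then show ?thesis using u[of z] by simp
    next
      case False
      have *: "poly u (2 * z) = c / 2 * poly u z" for z using dil(3) by (simp add: u)
      have "c = 2 ^ Suc (degree u)" using polynomial_dilation_eigenvector(1)[OF * False] by simp
      then have "(of_nat (2 ^ e) :: complex) = of_nat (2 ^ Suc (degree u))" using c by simp
      then have "e = Suc (degree u)" unfolding of_nat_eq_iff by (simp del: power_Suc)
      then show ?thesis using e0 polynomial_dilation_eigenvector(2)[OF * False, of z] u by auto
    qed
  qed
  have "e \<noteq> 0"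
  proof
    assume e: "e = 0"
    have z: "F x y z = F x y 1" for x y z
      by (rule vec3_eqI) (use pw[of _ x y z] F3 e in auto)
    have dir: False if "(x0, y0) \<noteq> (0, 0)" "F x0 y0 1 $ 1 = 0" "F x0 y0 1 $ 2 = 0" for x0 y0
    proof (rule linev[OF that(1)])
      fix t z
      have "F (t * x0) (t * y0) z = F (t * x0) (t * y0) (t * 1)" using z by metis
      also have "\<dots> = 0" by (rule vec3_eqI) (use that(2,3) F3 e in \<open>simp_all only: scale, simp_all\<close>)
      finally show "F (t * x0) (t * y0) z = 0" .
    qed
    have B: "F x 1 1 $ 2 = - x * F x 1 1 $ 1" for x
      using euler[of x 1 1] F3 e by (simp add: add_eq_0_iff)
    obtain \<alpha> where \<alpha>: "\<And>s. poly \<alpha> s = F s 1 1 $ 1" using polyx by metis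
    show False
    proof (cases "\<exists>s. poly \<alpha> s = 0")
      case True
      then obtain s where "F s 1 1 $ 1 = 0" using \<alpha> by auto
      then show False using dir[of s 1] B[of s] by simp
    next
      case False
      then obtain k where "\<alpha> = [:k:]" using fundamental_theorem_of_algebra_alt[of \<alpha>] by blast
      then have al: "poly \<alpha> s = poly \<alpha> 0" for s by simp
      obtain p where p: "\<And>s. poly p s = F 1 s 1 $ 1" using polyy by metis
      obtain q where q: "\<And>s. poly q s = F 1 s 1 $ 2" using polyy by metis
      have ps: "F 1 s 1 $ 1 = s ^ (d + 1) * poly \<alpha> 0" if "s \<noteq> 0" for s
      proof -
        have "F 1 s 1 $ 1 = F (s * (1 / s)) (s * 1) (s * 1) $ 1" using z[of 1 s s] that by simp
        also have "\<dots> = s ^ (d + 1) * poly \<alpha> (1 / s)" unfolding scale \<alpha> ..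
        finally show ?thesis using al by simp
      qed
      have "p = monom (poly \<alpha> 0) (d + 1)"
        by (rule poly_eqI_nonzero) (use ps in \<open>simp add: p poly_monom\<close>)
      then have "F 1 0 1 $ 1 = 0" using p[of 0] by (simp add: poly_monom)
      moreover have "q = monom (- poly \<alpha> 0) d"
      proof (rule poly_eqI_nonzero)
        fix s :: complex assume s: "s \<noteq> 0"
        have "s * F 1 s 1 $ 2 = - F 1 s 1 $ 1"
          using euler[of 1 s 1] F3 e by (simp add: add_eq_0_iff)
        then have "s * F 1 s 1 $ 2 = s * (- poly \<alpha> 0 * s ^ d)" using ps[OF s] by simp
        then have "F 1 s 1 $ 2 = - poly \<alpha> 0 * s ^ d" using s by (simp only: mult_cancel_left) simp
        then show "poly q s = poly (monom (- poly \<alpha> 0) d) s" by (simp add: q poly_monom)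
      qed
      then have "F 1 0 1 $ 2 = 0" using q[of 0] d by (simp add: poly_monom power_0_left)
      ultimately show False using dir[of 1 0] by simp
    qed
  qed
  moreover have "\<not> 2 \<le> e"
  proof
    assume e: "2 \<le> e"
    obtain v where v: "dot3 (vector [0, 0, 1]) v = 0" "F (v$1) (v$2) (v$3) \<noteq> 0"
      using line[of "vector [0, 0, 1]"] by (auto simp: vec_eq_iff forall_3 vector_3)
    then have v3: "v$3 = 0" by (simp add: dot3_def vector_3)
    have "F (v$1) (v$2) (v$3) = 0"
      by (rule vec3_eqI) (use pw[of 1 "v$1" "v$2" 0] pw[of 2 "v$1" "v$2" 0] F3 e v3 in auto)
    then show False using v(2) by simp
  qed
  ultimately have e: "e = 1" by simp
  have hom: "F (t * x) (t * y) 1 $ i = t ^ d * F x y 1 $ i" if t: "t \<noteq> 0" and i: "i \<noteq> 3" for t x y i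
  proof -
    have "F (t * x) (t * y) (t * 1) $ i = t * F (t * x) (t * y) 1 $ i"
      using pw[OF i, of "t * x" "t * y" "t * 1"] e by simp
    then show ?thesis using scale[of t x y 1 i] t by simp
  qed
  obtain a where a: "\<And>s. poly a s = F 1 s 1 $ 1" using polyy by metis
  obtain b where b: "\<And>s. poly b s = F 1 s 1 $ 2" using polyy by metis
  obtain a' where a': "\<And>s. poly a' s = F s 1 1 $ 1" using polyx by metis
  obtain b' where b': "\<And>s. poly b' s = F s 1 1 $ 2" using polyx by metis
  have A: "degree a \<le> d" "(\<lambda>x y. F x y 1 $ 1) = bform d a"
    using binary_form_exists[OF d, of "\<lambda>x y. F x y 1 $ 1" a a'] hom a a' by simp_all
  have B: "degree b \<le> d" "(\<lambda>x y. F x y 1 $ 2) = bform d b"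
    using binary_form_exists[OF d, of "\<lambda>x y. F x y 1 $ 2" b b'] hom b b' by simp_all
  have AB: "F x y z $ 1 = z * bform d a x y" "F x y z $ 2 = z * bform d b x y" for x y z
    using pw[of 1 x y z] pw[of 2 x y z] fun_cong[OF fun_cong[OF A(2)], of x y]
      fun_cong[OF fun_cong[OF B(2)], of x y] e by simp_all
  have nz3: "F x y z $ 3 = - (x * bform d a x y + y * bform d b x y)" if z: "z \<noteq> 0" for x y z
  proof -
    have "z * F x y z $ 3 = z * (- (x * bform d a x y + y * bform d b x y))"
      using euler[of x y z] unfolding AB by (simp add: algebra_simps add_eq_0_iff)
    then show ?thesis using z by simp
  qed
  have C: "F x y z $ 3 = - (x * bform d a x y + y * bform d b x y)" for x y z
  proof -
    obtain u where u: "\<And>s. poly u s = F x y s $ 3" using polyz by metis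
    have "u = [:- (x * bform d a x y + y * bform d b x y):]"
      by (rule poly_eqI_nonzero) (use nz3 in \<open>simp add: u\<close>)
    then show ?thesis using u[of z] by simp
  qed
  have "eval_form \<Omega> (g *v v) v* g = vector [v$3 * bform d a (v$1) (v$2), v$3 * bform d b (v$1) (v$2),
        - (v$1 * bform d a (v$1) (v$2) + v$2 * bform d b (v$1) (v$2))]" for v
  proof -
    have "eval_form \<Omega> (g *v v) v* g = F (v$1) (v$2) (v$3)" by (simp add: F_def vec3_eta)
    also have "\<dots> = vector [v$3 * bform d a (v$1) (v$2), v$3 * bform d b (v$1) (v$2),
        - (v$1 * bform d a (v$1) (v$2) + v$2 * bform d b (v$1) (v$2))]"
      by (rule vec3_eqI) (simp_all add: AB C vector_3)
    finally show ?thesis .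
  qed
  then show ?thesis using normal_chartI[OF fol g A(1) B(1)] by blast
qed

text \<open>Linear changes of the affine coordinates preserve the normal form; they allow an arbitrary
  direction \<open>(e, e')\<close> to be moved to the vertical one.\<close>

lemma normal_chart_rotate:
  assumes d: "1 \<le> d" and fol: "foliation d \<Omega>" and nc: "normal_chart d \<Omega> g a b"
    and R: "\<alpha> * e' - \<beta> * e \<noteq> 0"
  defines "R \<equiv> vector [vector [\<alpha>, e, 0], vector [\<beta>, e', 0], vector [0, 0, 1]]"
  shows "\<exists>a' b'. normal_chart d \<Omega> (g ** R) a' b'
    \<and> (\<forall>x y. bform d b' x y = e * bform d a (\<alpha> * x + e * y) (\<beta> * x + e' * y)
                           + e' * bform d b (\<alpha> * x + e * y) (\<beta> * x + e' * y))
    \<and> (\<forall>x y. bform d a' x y = \<alpha> * bform d a (\<alpha> * x + e * y) (\<beta> * x + e' * y)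
                           + \<beta> * bform d b (\<alpha> * x + e * y) (\<beta> * x + e' * y))"
proof -
  have g: "invertible g" and F: "\<And>v. eval_form \<Omega> (g *v v) v* g = vector [v$3 * bform d a (v$1) (v$2), v$3 * bform d b (v$1) (v$2),
        - (v$1 * bform d a (v$1) (v$2) + v$2 * bform d b (v$1) (v$2))]"
    using nc by (simp_all add: normal_chart_def)
  have Rr: "R$1$1 = \<alpha>" "R$1$2 = e" "R$1$3 = 0" "R$2$1 = \<beta>" "R$2$2 = e'" "R$2$3 = 0"
    "R$3$1 = 0" "R$3$2 = 0" "R$3$3 = 1" by (simp_all add: R_def vector_3)
  have "det R \<noteq> 0" using R by (simp add: det_3 Rr mult.commute)
  then have "invertible (g ** R)" using g by (simp add: invertible_det_nz det_mul)
  define u w where "u x y = \<alpha> * x + e * y" and "w x y = \<beta> * x + e' * y" for x y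
  have comb: "\<exists>p. degree p \<le> d \<and> bform d p = (\<lambda>x y. k * bform d a (u x y) (w x y) + l * bform d b (u x y) (w x y))"
    for k l
  proof -
    define f where "f x y = k * bform d a (u x y) (w x y) + l * bform d b (u x y) (w x y)" for x y
    define P where "P U V = smult k (\<Sum>j\<le>d. smult (coeff a j) (U ^ (d - j) * V ^ j))
        + smult l (\<Sum>j\<le>d. smult (coeff b j) (U ^ (d - j) * V ^ j))" for U V :: "complex poly"
    have P: "poly (P U V) s = k * bform d a (poly U s) (poly V s) + l * bform d b (poly U s) (poly V s)" for U V s
      by (simp add: P_def poly_sum bform_def mult.assoc)
    have hom: "f (t * x) (t * y) = t ^ d * f x y" for t x y
    proof -
      have "u (t * x) (t * y) = t * u x y" "w (t * x) (t * y) = t * w x y"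
        by (simp_all add: u_def w_def algebra_simps)
      then show ?thesis by (simp add: f_def bform_scale algebra_simps)
    qed
    have p: "poly (P [:\<alpha>, e:] [:\<beta>, e':]) s = f 1 s" for s
      by (simp add: P f_def u_def w_def mult.commute)
    have q: "poly (P [:e, \<alpha>:] [:e', \<beta>:]) s = f s 1" for s
      by (simp add: P f_def u_def w_def add.commute mult.commute)
    show ?thesis
      using binary_form_exists[OF d, of f, OF hom p q] unfolding f_def[abs_def] by metis
  qed
  obtain a' where a': "degree a' \<le> d" "bform d a' = (\<lambda>x y. \<alpha> * bform d a (u x y) (w x y) + \<beta> * bform d b (u x y) (w x y))"
    using comb by blast
  obtain b' where b': "degree b' \<le> d" "bform d b' = (\<lambda>x y. e * bform d a (u x y) (w x y) + e' * bform d b (u x y) (w x y))"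
    using comb by blast
  have "normal_chart d \<Omega> (g ** R) a' b'"
  proof (rule normal_chartI[OF fol \<open>invertible (g ** R)\<close> a'(1) b'(1)])
    fix v :: "complex^3"
    have "eval_form \<Omega> ((g ** R) *v v) v* (g ** R) = (eval_form \<Omega> (g *v (R *v v)) v* g) v* R"
      by (simp add: matrix_vector_mul_assoc vector_matrix_mul_assoc)
    also have "\<dots> = vector [v$3 * bform d a' (v$1) (v$2), v$3 * bform d b' (v$1) (v$2),
        - (v$1 * bform d a' (v$1) (v$2) + v$2 * bform d b' (v$1) (v$2))]"
      unfolding F a' b'
      by (rule vec3_eqI) (simp_all add: vector_matrix_3 matrix_vector_3 Rr vector_3 u_def w_def algebra_simps)
    finally show "eval_form \<Omega> ((g ** R) *v v) v* (g ** R) = vector [v$3 * bform d a' (v$1) (v$2), v$3 * bform d b' (v$1) (v$2),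
        - (v$1 * bform d a' (v$1) (v$2) + v$2 * bform d b' (v$1) (v$2))]" .
  qed
  then show ?thesis using a'(2) b'(2) by (intro exI[of _ a'] exI[of _ b']) (simp add: u_def w_def)
qed

section \<open>The Legendre transform in a normal chart\<close>

lemma legendre_poly_eval:
  "poly (legendre_poly \<Omega> m) t = eval_form \<Omega> (vector [t, fst m * t - snd m, 1]) $ 1
     + fst m * eval_form \<Omega> (vector [t, fst m * t - snd m, 1]) $ 2"
proof -
  have "(\<chi> i. poly ((vector [[:0, 1:], [:- snd m, fst m:], 1] :: complex poly^3) $ i) t)
      = vector [t, fst m * t - snd m, 1]"
    by (rule vec3_eqI) (simp_all add: vector_3 mult.commute)
  then show ?thesis by (simp add: legendre_poly_def Let_def poly_subst3 eval_form_def)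
qed

text \<open>At infinity the line \<open>y = p x - q\<close> meets the direction \<open>(1, p)\<close>, and the form vanishes on its
  own point, which lowers the degree by one.\<close>

lemma degree_legendre_poly:
  assumes fol: "foliation d \<Omega>" and g: "invertible g"
  shows "degree (legendre_poly (pullback g \<Omega>) m) \<le> d"
proof -
  define F where "F v = eval_form (pullback g \<Omega>) v" for v
  have F: "F v = eval_form \<Omega> (g *v v) v* g" for v by (simp add: F_def eval_form_pullback)
  have scale: "F (t *s v) $ i = t ^ (d + 1) * F v $ i" for t v i
    by (simp add: F eval_form_scale[OF fol] vector_scalar_commute vector_matrix_3 algebra_simps)
  have euler: "dot3 (F v) v = 0" for v
    using eval_form_euler[OF fol] by (simp add: F dot3_adjoint)
  let ?w = "\<lambda>s. vector [1, fst m, 0] + s *s vector [0, - snd m, 1] :: complex^3"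
  obtain p1 where p1: "\<And>s. poly p1 s = F (?w s) $ 1" unfolding F_def using eval_form_on_line by metis
  obtain p2 where p2: "\<And>s. poly p2 s = F (?w s) $ 2" unfolding F_def using eval_form_on_line by metis
  define \<rho> where "\<rho> = p1 + smult (fst m) p2"
  have "poly \<rho> 0 = 0" using euler[of "?w 0"] by (simp add: \<rho>_def p1 p2 dot3_def vector_3 algebra_simps)
  then obtain q where q: "\<rho> = [:0, 1:] * q" by (metis dvd_def minus_zero poly_eq_0_iff_dvd)
  show ?thesis
  proof (rule degree_le_reverse)
    fix s :: complex assume s: "s \<noteq> 0"
    have w: "vector [s, fst m * s - snd m, 1] = s *s ?w (1 / s)"
      by (rule vec3_eqI) (use s in \<open>simp_all add: vector_3 field_simps\<close>)
    have "poly (legendre_poly (pullback g \<Omega>) m) s = s ^ (d + 1) * poly \<rho> (1 / s)"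
      unfolding legendre_poly_eval F_def[symmetric] w scale by (simp add: \<rho>_def p1 p2 algebra_simps)
    then show "poly (legendre_poly (pullback g \<Omega>) m) s = s ^ d * poly q (1 / s)"
      using s by (simp add: q)
  qed
qed

text \<open>Let \<open>M\<close> be the transition matrix between two systems of projective coordinates. The line with
  coordinates \<open>(p, q)\<close> in the first system has the homogeneous dual coordinates
  \<open>dual_coords M (p, q)\<close> in the second one.\<close>

definition dual_coords :: "complex^3^3 \<Rightarrow> c2 \<Rightarrow> complex^3" where
  "dual_coords M m = vector [fst m, -1, - snd m] v* M"

definition dual_coords_deriv :: "complex^3^3 \<Rightarrow> c2 \<Rightarrow> complex^3" where
  "dual_coords_deriv M \<xi> = vector [fst \<xi>, 0, - snd \<xi>] v* M"

lemma dual_coords_components: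
  "dual_coords M m $ j = M$1$j * fst m - M$2$j - M$3$j * snd m"
  "dual_coords_deriv M \<xi> $ j = M$1$j * fst \<xi> - M$3$j * snd \<xi>"
  by (simp_all add: dual_coords_def dual_coords_deriv_def vector_matrix_3 vector_3 mult.commute)

text \<open>The point of contact of the line \<open>l\<close> moving with velocity \<open>l'\<close> is \<open>l \<times> l'\<close>. There the form of
  the foliation is a combination \<open>\<lambda> l + W l'\<close>, and \<open>W\<close> is the Legendre transform evaluated at
  \<open>l'\<close>; this description does not depend on the coordinates.\<close>

lemma legendre_contact:
  fixes m \<xi> :: c2
  assumes fol: "foliation d \<Omega>" and nc: "normal_chart d \<Omega> g0 a b" and g: "invertible g"
    and \<xi>: "fst \<xi> \<noteq> 0"
  defines "M \<equiv> matrix_inv g ** g0"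
  defines "L \<equiv> dual_coords M m" and "L' \<equiv> dual_coords_deriv M \<xi>"
  shows "\<exists>c. cross L L' $ 3 * bform d a (cross L L' $ 1) (cross L L' $ 2)
        = c * L$1 + det M ^ (d + 1) * legendre_transform d \<Omega> g m \<xi> * L'$1
      \<and> cross L L' $ 3 * bform d b (cross L L' $ 1) (cross L L' $ 2)
        = c * L$2 + det M ^ (d + 1) * legendre_transform d \<Omega> g m \<xi> * L'$2"
proof -
  define W where "W = legendre_transform d \<Omega> g m \<xi>"
  define l l' :: "complex^3" where "l = vector [fst m, -1, - snd m]" and "l' = vector [fst \<xi>, 0, - snd \<xi>]"
  define V where "V = cross l l'"
  define F where "F v = eval_form \<Omega> (g *v v) v* g" for v
  have scale: "F (t *s v) = t ^ (d + 1) *s F v" for t v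
    by (rule vec3_eqI) (simp_all add: F_def eval_form_scale[OF fol] vector_scalar_commute vector_matrix_3 algebra_simps)
  have euler: "F v $ 1 * v $ 1 + F v $ 2 * v $ 2 + F v $ 3 * v $ 3 = 0" for v
    using eval_form_euler[OF fol, of "g *v v"] by (simp add: F_def dot3_adjoint[symmetric]) (simp add: dot3_def)
  define t where "t = snd \<xi> / fst \<xi>"
  have V: "V = fst \<xi> *s vector [t, fst m * t - snd m, 1]"
    by (rule vec3_eqI) (use \<xi> in \<open>simp_all add: V_def l_def l'_def t_def cross_components vector_3 field_simps\<close>)
  have "W = fst \<xi> ^ d * poly (legendre_poly (pullback g \<Omega>) m) t"
    unfolding W_def legendre_transform_def poly_sum_upto[OF degree_legendre_poly[OF fol g]] sum_distrib_left
  proof (rule sum.cong[OF refl])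
    fix j assume "j \<in> {..d}"
    then have "fst \<xi> ^ d = fst \<xi> ^ (d - j) * fst \<xi> ^ j" by (simp flip: power_add)
    then show "coeff (legendre_poly (pullback g \<Omega>) m) j * snd \<xi> ^ j * fst \<xi> ^ (d - j)
        = fst \<xi> ^ d * (coeff (legendre_poly (pullback g \<Omega>) m) j * t ^ j)"
      using \<xi> by (simp add: t_def power_divide)
  qed
  then have W: "F V $ 1 + fst m * F V $ 2 = fst \<xi> * W"
    unfolding V scale legendre_poly_eval eval_form_pullback F_def[symmetric] by (simp add: algebra_simps)
  have "fst \<xi> * F V $ 3 = fst \<xi> * (F V $ 2 * snd m - W * snd \<xi>)"
    using euler[of V] W \<xi> unfolding V_def cross_components l_def l'_def
    by (simp add: vector_3) algebra
  then have F3: "F V $ 3 = F V $ 2 * snd m - W * snd \<xi>" using \<xi> by simp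
  have FV: "F V = (- F V $ 2) *s l + W *s l'"
    by (rule vec3_eqI) (use W F3 in \<open>simp_all add: l_def l'_def vector_3 algebra_simps\<close>)
  have LL: "L = l v* M" "L' = l' v* M" by (simp_all add: L_def L'_def l_def l'_def dual_coords_def dual_coords_deriv_def)
  have g0: "invertible g0" using nc by (simp add: normal_chart_def)
  have "det M \<noteq> 0" unfolding M_def using g g0 by (simp add: det_mul invertible_inverse)
  have gM: "g ** M = g0" by (simp add: M_def matrix_mul_assoc invertible_inverse[OF g])
  have "det M *s (g *v V) = g0 *v cross L L'"
    unfolding LL V_def gM[symmetric] matrix_vector_mul_assoc[symmetric] cross_vector_matrix
    by (rule vec3_eqI) (simp_all add: matrix_vector_3 algebra_simps)
  then have "eval_form \<Omega> (g0 *v cross L L') v* g0 = eval_form \<Omega> (det M *s (g *v V)) v* (g ** M)"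
    by (simp add: gM)
  also have "\<dots> = det M ^ (d + 1) *s (F V v* M)"
    unfolding eval_form_scale[OF fol] F_def vector_matrix_mul_assoc[symmetric]
    by (rule vec3_eqI) (simp_all add: vector_matrix_3 algebra_simps)
  also have "F V v* M = (- F V $ 2) *s L + W *s L'"
    unfolding FV[THEN arg_cong[where f="\<lambda>v. v v* M"]] LL
    by (rule vec3_eqI) (simp_all add: vector_matrix_3 algebra_simps)
  finally have fin: "eval_form \<Omega> (g0 *v cross L L') v* g0 = det M ^ (d + 1) *s ((- F V $ 2) *s L + W *s L')" .
  have nf: "(eval_form \<Omega> (g0 *v cross L L') v* g0) $ 1 = cross L L' $ 3 * bform d a (cross L L' $ 1) (cross L L' $ 2)"
    "(eval_form \<Omega> (g0 *v cross L L') v* g0) $ 2 = cross L L' $ 3 * bform d b (cross L L' $ 1) (cross L L' $ 2)"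
    using nc by (simp_all add: normal_chart_def vector_3)
  show ?thesis
    unfolding nf[symmetric] fin W_def[symmetric]
    by (intro exI[of _ "det M ^ (d + 1) * (- F V $ 2)"]) (simp add: algebra_simps)
qed

lemma dual_coords_independent:
  assumes "det M \<noteq> 0" "dual_coords M m $ 1 \<noteq> 0 \<or> dual_coords M m $ 2 \<noteq> 0"
  shows "cross (dual_coords M m) (dual_coords_deriv M (1, 0)) $ 3 \<noteq> 0
    \<or> cross (dual_coords M m) (dual_coords_deriv M (0, 1)) $ 3 \<noteq> 0"
proof (rule ccontr)
  assume "\<not> ?thesis"
  then have "dual_coords M m $ 1 * det M = 0" "dual_coords M m $ 2 * det M = 0"
    unfolding cross_components dual_coords_components det_3 by (simp_all, algebra+)
  then show False using assms by auto
qed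

lemma legendre_transform_normal:
  fixes m \<xi> :: c2
  assumes fol: "foliation d \<Omega>" and nc: "normal_chart d \<Omega> g0 a b" and g: "invertible g"
  defines "M \<equiv> matrix_inv g ** g0"
  defines "L \<equiv> dual_coords M m" and "L' \<equiv> dual_coords_deriv M \<xi>"
  assumes L2: "L$2 \<noteq> 0"
  shows "det M ^ (d + 1) * legendre_transform d \<Omega> g m \<xi>
    = L$1 * bform d b (cross L L' $ 1) (cross L L' $ 2) - L$2 * bform d a (cross L L' $ 1) (cross L L' $ 2)"
proof -
  have g0: "invertible g0" using nc by (simp add: normal_chart_def)
  have M: "det M \<noteq> 0" unfolding M_def using g g0 by (simp add: det_mul invertible_inverse)
  define K where "K \<eta> = cross L (dual_coords_deriv M \<eta>)" for \<eta>
  define lhs where "lhs \<eta> = det M ^ (d + 1) * legendre_transform d \<Omega> g m \<eta>" for \<eta>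
  define rhs where "rhs \<eta> = L$1 * bform d b (K \<eta> $ 1) (K \<eta> $ 2) - L$2 * bform d a (K \<eta> $ 1) (K \<eta> $ 2)" for \<eta>
  have generic: "lhs \<eta> = rhs \<eta>" if \<eta>: "fst \<eta> \<noteq> 0" "K \<eta> $ 3 \<noteq> 0" for \<eta>
  proof -
    obtain c where c: "K \<eta> $ 3 * bform d a (K \<eta> $ 1) (K \<eta> $ 2) = c * L$1 + lhs \<eta> * dual_coords_deriv M \<eta> $ 1"
      "K \<eta> $ 3 * bform d b (K \<eta> $ 1) (K \<eta> $ 2) = c * L$2 + lhs \<eta> * dual_coords_deriv M \<eta> $ 2"
      using legendre_contact[OF fol nc g \<eta>(1), of m] unfolding K_def lhs_def L_def M_def by blast
    have "K \<eta> $ 3 * rhs \<eta> = L$1 * (K \<eta> $ 3 * bform d b (K \<eta> $ 1) (K \<eta> $ 2))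
        - L$2 * (K \<eta> $ 3 * bform d a (K \<eta> $ 1) (K \<eta> $ 2))"
      by (simp add: rhs_def algebra_simps)
    also have "\<dots> = K \<eta> $ 3 * lhs \<eta>"
      unfolding c by (simp add: K_def cross_components algebra_simps)
    finally show ?thesis using \<eta>(2) by simp
  qed
  have lin: "K (u + \<tau> * u', v + \<tau> * v') $ j = K (u, v) $ j + \<tau> * K (u', v') $ j" for u v u' v' \<tau> j
    using exhaust_3[of j] by (auto simp: K_def cross_components dual_coords_components algebra_simps)
  obtain \<zeta> :: c2 where \<zeta>: "fst \<zeta> \<noteq> 0" "K \<zeta> $ 3 \<noteq> 0"
  proof (cases "K (1, 0) $ 3 = 0")
    case True
    then have "K (0, 1) $ 3 \<noteq> 0"
      using dual_coords_independent[OF M, of m] L2 by (auto simp: K_def L_def)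
    then have "K (1, 1) $ 3 \<noteq> 0" using lin[of 1 1 0 0 1 3] True by simp
    then show ?thesis using that[of "(1, 1)"] by simp
  next
    case False then show ?thesis using that[of "(1, 0)"] by simp
  qed
  define \<gamma> where "\<gamma> \<tau> = (fst \<xi> + \<tau> * fst \<zeta>, snd \<xi> + \<tau> * snd \<zeta>)" for \<tau>
  have K\<gamma>: "K (\<gamma> \<tau>) $ j = K \<xi> $ j + \<tau> * K \<zeta> $ j" for \<tau> j
    using lin[of "fst \<xi>" \<tau> "fst \<zeta>" "snd \<xi>" "snd \<zeta>" j] by (simp add: \<gamma>_def)
  have "((\<lambda>\<tau>. lhs (\<gamma> \<tau>)) \<longlongrightarrow> lhs (\<gamma> 0)) (at 0)"
    unfolding lhs_def legendre_transform_def \<gamma>_def fst_conv snd_conv by (intro tendsto_intros)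
  moreover have "((\<lambda>\<tau>. lhs (\<gamma> \<tau>)) \<longlongrightarrow> rhs (\<gamma> 0)) (at 0)"
  proof (rule Lim_transform_eventually)
    show "((\<lambda>\<tau>. rhs (\<gamma> \<tau>)) \<longlongrightarrow> rhs (\<gamma> 0)) (at 0)"
      unfolding rhs_def K\<gamma> bform_def by (intro tendsto_intros)
    have "((\<lambda>\<tau>. fst \<xi> + \<tau> * fst \<zeta>) \<longlongrightarrow> fst \<xi> + 0 * fst \<zeta>) (at 0)" by (intro tendsto_intros)
    have ne: "\<forall>\<^sub>F \<tau> in at 0. x + \<tau> * y \<noteq> 0" if "y \<noteq> 0" for x y :: complex
    proof -
      have "\<forall>\<^sub>F \<tau> in at 0. \<tau> \<noteq> - x / y"
        by (rule eventually_neq_at_within)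
      then show ?thesis by (rule eventually_mono) (use that in \<open>auto simp: field_simps add_eq_0_iff\<close>)
    qed
    show "\<forall>\<^sub>F \<tau> in at 0. rhs (\<gamma> \<tau>) = lhs (\<gamma> \<tau>)"
      using ne[OF \<zeta>(1), of "fst \<xi>"] ne[OF \<zeta>(2), of "K \<xi> $ 3"]
    proof eventually_elim
      case (elim \<tau>)
      then have "fst (\<gamma> \<tau>) \<noteq> 0" "K (\<gamma> \<tau>) $ 3 \<noteq> 0" unfolding K\<gamma> by (simp_all add: \<gamma>_def)
      from generic[OF this] show ?case by simp
    qed
  qed
  ultimately have "lhs (\<gamma> 0) = rhs (\<gamma> 0)" by (metis LIM_unique)
  then show ?thesis by (simp add: \<gamma>_def lhs_def rhs_def K_def L'_def)
qed

text \<open>The line at infinity of a normal chart lies in the discriminant.\<close>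

lemma legendre_transform_infinity:
  assumes fol: "foliation d \<Omega>" and nc: "normal_chart d \<Omega> g0 a b" and g: "invertible g"
  defines "M \<equiv> matrix_inv g ** g0"
  assumes L: "dual_coords M m $ 1 = 0" "dual_coords M m $ 2 = 0"
  shows "legendre_transform d \<Omega> g m (1, t) = 0"
proof (rule ccontr)
  assume W: "legendre_transform d \<Omega> g m (1, t) \<noteq> 0"
  have g0: "invertible g0" using nc by (simp add: normal_chart_def)
  have M: "det M \<noteq> 0" unfolding M_def using g g0 by (simp add: det_mul invertible_inverse)
  have "dual_coords_deriv M (1, t) $ 1 = 0" "dual_coords_deriv M (1, t) $ 2 = 0"
    using legendre_contact[OF fol nc g, of "(1, t)" m] L M W
    unfolding M_def[symmetric] by (auto simp: cross_components)
  with L have "det M = 0"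
    unfolding dual_coords_components det_3 by simp algebra
  then show False using M by simp
qed

section \<open>The fibres of the Gauss map\<close>

text \<open>In a normal chart the Gauss map sends the direction \<open>s = y/x\<close> to the slope
  \<open>p = - a(s) / b(s)\<close>; its fibre over \<open>p\<close> is the set of roots of \<open>a + p b\<close>.\<close>

abbreviation fibre_poly :: "complex poly \<Rightarrow> complex poly \<Rightarrow> complex \<Rightarrow> complex poly" where
  "fibre_poly a b p \<equiv> a + smult p b"

definition fibre :: "complex poly \<Rightarrow> complex poly \<Rightarrow> complex \<Rightarrow> complex set" where
  "fibre a b p = {s. poly (fibre_poly a b p) s = 0}"

definition regular_value :: "nat \<Rightarrow> complex poly \<Rightarrow> complex poly \<Rightarrow> complex \<Rightarrow> bool" where
  "regular_value d a b p \<longleftrightarrow> degree (fibre_poly a b p) = d \<and> rsquarefree (fibre_poly a b p)"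

text \<open>The velocity of a point of the fibre when \<open>p\<close> moves with unit speed.\<close>

definition fibre_velocity :: "complex poly \<Rightarrow> complex poly \<Rightarrow> complex \<Rightarrow> complex \<Rightarrow> complex" where
  "fibre_velocity a b p s = - poly b s / poly (pderiv (fibre_poly a b p)) s"

definition fibre_height :: "complex poly \<Rightarrow> complex poly \<Rightarrow> complex \<Rightarrow> complex \<times> complex \<times> complex \<Rightarrow> complex" where
  "fibre_height a b p = (\<lambda>(x, y, w). 1 - interpolate0 (p - x) (p - y) (p - w)
     (fibre_velocity a b p x) (fibre_velocity a b p y) (fibre_velocity a b p w))"

text \<open>Up to the closed form \<open>dq/q\<close>, the coefficient of the connection whose derivative is the
  curvature; unlike the individual branches of the fibre it is a single-valued function of \<open>p\<close>.\<close>

definition total_height :: "complex poly \<Rightarrow> complex poly \<Rightarrow> complex \<Rightarrow> complex" where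
  "total_height a b p = (1 / 6) * (\<Sum>T\<in>distinct_triples (fibre a b p). fibre_height a b p T)"

lemma regular_value_iff:
  assumes "1 \<le> d" "degree a \<le> d" "degree b \<le> d"
  shows "regular_value d a b p \<longleftrightarrow> coeff a d + p * coeff b d \<noteq> 0 \<and> rsquarefree (fibre_poly a b p)"
proof -
  have le: "degree (fibre_poly a b p) \<le> d"
    using assms by (intro degree_add_le order.trans[OF degree_smult_le]) auto
  have "degree (fibre_poly a b p) = d \<longleftrightarrow> coeff (fibre_poly a b p) d \<noteq> 0"
  proof
    assume "degree (fibre_poly a b p) = d"
    then show "coeff (fibre_poly a b p) d \<noteq> 0"
      using assms(1) leading_coeff_0_iff[of "fibre_poly a b p"] by force
  next
    assume "coeff (fibre_poly a b p) d \<noteq> 0"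
    from le_degree[OF this] le show "degree (fibre_poly a b p) = d" by (rule antisym[rotated])
  qed
  then show ?thesis by (simp add: regular_value_def)
qed

lemma card_roots_rsquarefree:
  fixes N :: "complex poly"
  assumes N: "rsquarefree N" "N \<noteq> 0"
  shows "card {s. poly N s = 0} = degree N"
proof -
  have "lead_coeff N \<noteq> 0" using N(2) by simp
  then have "degree N = degree (\<Prod>z|poly N z = 0. [:-z, 1:])"
    using degree_smult_eq[of "lead_coeff N" "\<Prod>z|poly N z = 0. [:-z, 1:]"]
    unfolding complex_poly_decompose_rsquarefree[OF N(1)] by simp
  also have "\<dots> = (\<Sum>z|poly N z = 0. degree [:-z, 1:])"
    by (rule degree_prod_sum_eq) simp
  also have "\<dots> = card {s. poly N s = 0}" by simp
  finally show ?thesis by (rule sym)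
qed

lemma regular_valueD:
  assumes d: "1 \<le> d" and r: "regular_value d a b p"
  obtains root where "\<And>i. i < d \<Longrightarrow> poly (fibre_poly a b p) (root i) = 0"
    "\<And>i. i < d \<Longrightarrow> poly (pderiv (fibre_poly a b p)) (root i) \<noteq> 0" "inj_on root {..<d}"
    "card (fibre a b p) = d"
proof -
  let ?N = "fibre_poly a b p"
  have N: "degree ?N = d" "rsquarefree ?N" "?N \<noteq> 0" using r d by (auto simp: regular_value_def)
  have card: "card {s. poly ?N s = 0} = d"
    using card_roots_rsquarefree[OF N(2,3)] N(1) by (rule trans)
  have fin: "finite {s. poly ?N s = 0}" using N(3) by (rule poly_roots_finite)
  then obtain root where root: "bij_betw root {..<d} {s. poly ?N s = 0}"
    using card ex_bij_betw_nat_finite[OF fin] by (auto simp: atLeast0LessThan)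
  show thesis
  proof (rule that)
    show r0: "poly ?N (root i) = 0" if "i < d" for i using root that by (auto simp: bij_betw_def)
    show "poly (pderiv ?N) (root i) \<noteq> 0" if "i < d" for i
      using N(2) r0[OF that] by (auto simp: rsquarefree_roots)
    show "inj_on root {..<d}" using root by (simp add: bij_betw_def)
    show "card (fibre a b p) = d" using card by (simp add: fibre_def)
  qed
qed

context
  fixes d :: nat and a b :: "complex poly"
  assumes d: "1 \<le> d" and deg: "degree a \<le> d" "degree b \<le> d"
    and coprime: "\<And>s. poly b s = 0 \<Longrightarrow> poly a s \<noteq> 0"
begin

lemma local_root:
  assumes s: "poly (fibre_poly a b p0) s = 0" "poly (pderiv (fibre_poly a b p0)) s \<noteq> 0"
  shows "\<exists>r \<sigma>. 0 < r \<and> \<sigma> holomorphic_on ball p0 r \<and> \<sigma> p0 = s \<and> (\<forall>p\<in>ball p0 r. poly (fibre_poly a b p) (\<sigma> p) = 0)"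
proof -
  have bs: "poly b s \<noteq> 0" using s(1) coprime[of s] by auto
  have p0: "poly a s = - p0 * poly b s" using s(1) by (simp add: add_eq_0_iff)
  define G where "G z = - poly a z / poly b z" for z
  define S where "S = {z. poly b z \<noteq> 0}"
  have "open S" unfolding S_def by (intro open_Collect_neq continuous_intros)
  have "s \<in> S" using bs by (simp add: S_def)
  have holG: "G holomorphic_on S"
    unfolding G_def[abs_def] by (intro holomorphic_intros) (simp add: S_def)
  have "(G has_field_derivative (- poly (pderiv a) s * poly b s + poly a s * poly (pderiv b) s) / (poly b s * poly b s)) (at s)"
    unfolding G_def[abs_def] by (rule DERIV_cong[OF DERIV_divide[OF DERIV_minus[OF poly_DERIV] poly_DERIV bs]]) simp
  then have "deriv G s = (- poly (pderiv a) s * poly b s + poly a s * poly (pderiv b) s) / (poly b s * poly b s)"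
    by (rule DERIV_imp_deriv)
  also have "\<dots> = - poly (pderiv (fibre_poly a b p0)) s / poly b s"
    using bs by (simp add: p0 pderiv_add pderiv_smult field_simps)
  finally have "deriv G s \<noteq> 0" using s(2) bs by simp
  from has_complex_derivative_locally_invertible[OF holG \<open>s \<in> S\<close> \<open>open S\<close> this]
  obtain \<rho> where \<rho>: "\<rho> > 0" "ball s \<rho> \<subseteq> S" "open (G ` ball s \<rho>)" "inj_on G (ball s \<rho>)" .
  obtain g where g: "g holomorphic_on (G ` ball s \<rho>)" "\<And>z. z \<in> ball s \<rho> \<Longrightarrow> g (G z) = z"
    using holomorphic_has_inverse[OF holomorphic_on_subset[OF holG \<rho>(2)] open_ball \<rho>(4)] by metis
  have "G s = p0" using bs by (simp add: G_def p0)
  then have "p0 \<in> G ` ball s \<rho>" using \<rho>(1) by force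
  then obtain r where r: "0 < r" "ball p0 r \<subseteq> G ` ball s \<rho>" using \<rho>(3) openE by blast
  have "poly (fibre_poly a b p) (g p) = 0" if p: "p \<in> ball p0 r" for p
  proof -
    obtain z where z: "z \<in> ball s \<rho>" "p = G z" using r(2) p by blast
    have "poly b z \<noteq> 0" using z \<rho>(2) by (auto simp: S_def)
    then have "poly (fibre_poly a b p) z = 0" by (simp add: z(2) G_def)
    then show ?thesis using g(2)[OF z(1)] z(2) by simp
  qed
  moreover have "g p0 = s" using g(2)[of s] \<rho>(1) \<open>G s = p0\<close> by simp
  moreover have "g holomorphic_on ball p0 r" by (rule holomorphic_on_subset[OF g(1) r(2)])
  ultimately show ?thesis using r(1) by blast
qed

lemma local_roots:
  assumes reg: "regular_value d a b p0"
  obtains r \<sigma> where "0 < r" "\<And>i. i < d \<Longrightarrow> \<sigma> i holomorphic_on ball p0 r"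
    "\<And>i p. i < d \<Longrightarrow> p \<in> ball p0 r \<Longrightarrow> poly (fibre_poly a b p) (\<sigma> i p) = 0"
    "\<And>i j p. i < d \<Longrightarrow> j < d \<Longrightarrow> i \<noteq> j \<Longrightarrow> p \<in> ball p0 r \<Longrightarrow> \<sigma> i p \<noteq> \<sigma> j p"
    "\<And>p. p \<in> ball p0 r \<Longrightarrow> coeff a d + p * coeff b d \<noteq> 0"
proof -
  obtain root where root: "\<And>i. i < d \<Longrightarrow> poly (fibre_poly a b p0) (root i) = 0"
    "\<And>i. i < d \<Longrightarrow> poly (pderiv (fibre_poly a b p0)) (root i) \<noteq> 0" "inj_on root {..<d}"
    using regular_valueD[OF d reg] by metis
  define Q where "Q i \<sigma> r \<longleftrightarrow> 0 < r \<and> \<sigma> holomorphic_on ball p0 r \<and> \<sigma> p0 = root i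
      \<and> (\<forall>p\<in>ball p0 r. poly (fibre_poly a b p) (\<sigma> p) = 0)" for i \<sigma> r
  have "\<forall>i\<in>{..<d}. \<exists>\<sigma>. \<exists>r. Q i \<sigma> r"
    using local_root[OF root(1,2)] unfolding Q_def by blast
  then obtain \<sigma> where "\<forall>i\<in>{..<d}. \<exists>r. Q i (\<sigma> i) r" by (rule bchoice[THEN exE])
  then obtain R where R: "\<forall>i\<in>{..<d}. Q i (\<sigma> i) (R i)" by (rule bchoice[THEN exE])
  have cont: "isCont (\<sigma> i) p0" if "i < d" for i
  proof -
    have "\<sigma> i holomorphic_on ball p0 (R i)" "0 < R i" using R that by (auto simp: Q_def)
    then have "continuous_on (ball p0 (R i)) (\<sigma> i)" "p0 \<in> ball p0 (R i)"
      by (auto intro: holomorphic_on_imp_continuous_on)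
    then show ?thesis using continuous_on_eq_continuous_at[OF open_ball] by blast
  qed
  have near: "\<forall>\<^sub>F p in nhds p0. p \<in> ball p0 (R i)" if "i < d" for i
    by (rule eventually_nhds_in_open) (use R that in \<open>auto simp: Q_def\<close>)
  have sep: "\<forall>\<^sub>F p in nhds p0. i \<noteq> j \<longrightarrow> \<sigma> i p - \<sigma> j p \<noteq> 0" if ij: "i < d" "j < d" for i j
  proof (cases "i = j")
    case False
    have "\<sigma> i p0 - \<sigma> j p0 \<noteq> 0"
      using R ij inj_onD[OF root(3), of i j] False by (auto simp: Q_def)
    moreover have "((\<lambda>p. \<sigma> i p - \<sigma> j p) \<longlongrightarrow> \<sigma> i p0 - \<sigma> j p0) (at p0)"
      using cont[OF ij(1)] cont[OF ij(2)] unfolding isCont_def by (intro tendsto_diff)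
    ultimately have "\<forall>\<^sub>F p in at p0. \<sigma> i p - \<sigma> j p \<noteq> 0" by (intro tendsto_imp_eventually_ne)
    then show ?thesis using \<open>\<sigma> i p0 - \<sigma> j p0 \<noteq> 0\<close>
      by (auto simp: eventually_at_filter elim: eventually_mono)
  qed simp
  have lead: "\<forall>\<^sub>F p in nhds p0. coeff a d + p * coeff b d \<noteq> 0"
  proof -
    have l0: "coeff a d + p0 * coeff b d \<noteq> 0" using reg regular_value_iff[OF d deg] by blast
    have "((\<lambda>p. coeff a d + p * coeff b d) \<longlongrightarrow> coeff a d + p0 * coeff b d) (at p0)"
      by (intro tendsto_intros)
    from tendsto_imp_eventually_ne[OF this l0] show ?thesis using l0
      by (auto simp: eventually_at_filter elim: eventually_mono)
  qed
  have "\<forall>\<^sub>F p in nhds p0. (\<forall>i\<in>{..<d}. p \<in> ball p0 (R i))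
      \<and> (\<forall>i\<in>{..<d}. \<forall>j\<in>{..<d}. i \<noteq> j \<longrightarrow> \<sigma> i p - \<sigma> j p \<noteq> 0) \<and> coeff a d + p * coeff b d \<noteq> 0"
    by (intro eventually_conj eventually_ball_finite ballI finite_lessThan near sep lead) simp_all
  then obtain r where r: "r > 0" "\<And>p. dist p p0 < r \<Longrightarrow> (\<forall>i\<in>{..<d}. p \<in> ball p0 (R i))
      \<and> (\<forall>i\<in>{..<d}. \<forall>j\<in>{..<d}. i \<noteq> j \<longrightarrow> \<sigma> i p - \<sigma> j p \<noteq> 0) \<and> coeff a d + p * coeff b d \<noteq> 0"
    unfolding eventually_nhds_metric by blast
  show thesis
  proof (rule that[of r \<sigma>])
    show "0 < r" by fact
    fix i assume i: "i < d"
    have "ball p0 r \<subseteq> ball p0 (R i)" using r(2) i by (auto simp: dist_commute)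
    then show "\<sigma> i holomorphic_on ball p0 r" using R i by (auto simp: Q_def intro: holomorphic_on_subset)
    show "poly (fibre_poly a b p) (\<sigma> i p) = 0" if "p \<in> ball p0 r" for p
      using R i r(2)[of p] that by (auto simp: Q_def dist_commute)
  next
    fix i j p assume "i < d" "j < d" "i \<noteq> j" "p \<in> ball p0 r"
    then show "\<sigma> i p \<noteq> \<sigma> j p" using r(2)[of p] by (auto simp: dist_commute)
  next
    fix p assume "p \<in> ball p0 r"
    then show "coeff a d + p * coeff b d \<noteq> 0" using r(2)[of p] by (auto simp: dist_commute)
  qed
qed

lemma interpolate0_rotate: "interpolate0 y z x v w u = interpolate0 x y z u v w"
  by (simp add: interpolate0_def add_ac mult_ac)

lemma interpolate0_swap: "interpolate0 x z y u w v = interpolate0 x y z u v w"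
  by (simp add: interpolate0_def add_ac mult_ac)

text \<open>Near a regular value the fibre consists of \<open>d\<close> disjoint holomorphic branches, by the inverse
  function theorem, and the sum over all triples of distinct points of the fibre counts each
  increasing triple of branches six times.\<close>

lemma fibre_branches:
  assumes reg: "regular_value d a b p0"
  obtains r \<sigma> where "0 < r"
    "\<And>i p. i < d \<Longrightarrow> p \<in> ball p0 r \<Longrightarrow> (\<sigma> i has_field_derivative fibre_velocity a b p (\<sigma> i p)) (at p)"
    "\<And>i p. i < d \<Longrightarrow> p \<in> ball p0 r \<Longrightarrow> (\<lambda>p. fibre_velocity a b p (\<sigma> i p)) field_differentiable (at p)"
    "\<And>i j p. i < d \<Longrightarrow> j < d \<Longrightarrow> i \<noteq> j \<Longrightarrow> p \<in> ball p0 r \<Longrightarrow> \<sigma> i p \<noteq> \<sigma> j p"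
    "\<And>p. p \<in> ball p0 r \<Longrightarrow> coeff a d + p * coeff b d \<noteq> 0"
    "\<And>p s. p \<in> ball p0 r \<Longrightarrow> poly (fibre_poly a b p) s = (coeff a d + p * coeff b d) * (\<Prod>i<d. s - \<sigma> i p)"
    "\<And>p. p \<in> ball p0 r \<Longrightarrow> total_height a b p = (\<Sum>(i, j, l)\<in>increasing_triples d. fibre_height a b p (\<sigma> i p, \<sigma> j p, \<sigma> l p))"
proof (rule local_roots[OF reg])
  fix r :: real and \<sigma> :: "nat \<Rightarrow> complex \<Rightarrow> complex"
  assume r: "0 < r" and hol: "\<And>i. i < d \<Longrightarrow> \<sigma> i holomorphic_on ball p0 r"
    and z: "\<And>i p. i < d \<Longrightarrow> p \<in> ball p0 r \<Longrightarrow> poly (fibre_poly a b p) (\<sigma> i p) = 0"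
    and ne: "\<And>i j p. i < d \<Longrightarrow> j < d \<Longrightarrow> i \<noteq> j \<Longrightarrow> p \<in> ball p0 r \<Longrightarrow> \<sigma> i p \<noteq> \<sigma> j p"
    and lead: "\<And>p. p \<in> ball p0 r \<Longrightarrow> coeff a d + p * coeff b d \<noteq> 0"
  have fact: "fibre_poly a b p = smult (coeff a d + p * coeff b d) (\<Prod>i<d. [:- \<sigma> i p, 1:])" if p: "p \<in> ball p0 r" for p
  proof -
    have dp: "degree (\<Prod>i<d. [:- \<sigma> i p, 1:]) = d" by (simp add: degree_prod_sum_eq)
    have "lead_coeff (\<Prod>i<d. [:- \<sigma> i p, 1:]) = 1" by (simp add: lead_coeff_prod)
    then have lc: "coeff (\<Prod>i<d. [:- \<sigma> i p, 1:]) d = 1" unfolding dp .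
    have inj: "inj_on (\<lambda>i. \<sigma> i p) {..<d}" using ne[OF _ _ _ p] by (auto simp: inj_on_def)
    show ?thesis
    proof (rule poly_eqI_degree_lead_coeff[where n=d and A="(\<lambda>i. \<sigma> i p) ` {..<d}"])
      show "coeff (fibre_poly a b p) d = coeff (smult (coeff a d + p * coeff b d) (\<Prod>i<d. [:- \<sigma> i p, 1:])) d"
        by (simp add: lc)
      show "d \<le> card ((\<lambda>i. \<sigma> i p) ` {..<d})" by (simp add: card_image[OF inj])
      show "degree (fibre_poly a b p) \<le> d" using deg by (intro degree_add_le order.trans[OF degree_smult_le]) auto
      show "degree (smult (coeff a d + p * coeff b d) (\<Prod>i<d. [:- \<sigma> i p, 1:])) \<le> d"
        using degree_smult_le[of "coeff a d + p * coeff b d" "\<Prod>i<d. [:- \<sigma> i p, 1:]"] by (simp add: dp)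
      show "poly (fibre_poly a b p) z = poly (smult (coeff a d + p * coeff b d) (\<Prod>i<d. [:- \<sigma> i p, 1:])) z"
        if zA: "z \<in> (\<lambda>i. \<sigma> i p) ` {..<d}" for z
      proof -
        obtain i where i: "i < d" "z = \<sigma> i p" using zA by blast
        then have "poly (fibre_poly a b p) z = 0" using z[OF i(1) p] by simp
        moreover have "(\<Prod>j<d. z - \<sigma> j p) = 0" by (rule prod_zero) (use i in auto)
        ultimately show ?thesis by (simp add: poly_prod)
      qed
    qed
  qed
  have eval: "poly (fibre_poly a b p) s = (coeff a d + p * coeff b d) * (\<Prod>i<d. s - \<sigma> i p)" if p: "p \<in> ball p0 r" for p s
    by (subst fact[OF p]) (simp add: poly_prod add.commute)
  have D: "(\<sigma> i has_field_derivative deriv (\<sigma> i) p) (at p)" if "i < d" "p \<in> ball p0 r" for i p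
    by (rule holomorphic_derivI[OF hol[OF that(1)] open_ball that(2)])
  have der: "deriv (\<sigma> i) p * poly (pderiv (fibre_poly a b p)) (\<sigma> i p) = - poly b (\<sigma> i p)"
    if ip: "i < d" "p \<in> ball p0 r" for i p
  proof -
    have "((\<lambda>q. poly a (\<sigma> i q) + q * poly b (\<sigma> i q)) has_field_derivative
        poly (pderiv a) (\<sigma> i p) * deriv (\<sigma> i) p + (poly b (\<sigma> i p) + p * (poly (pderiv b) (\<sigma> i p) * deriv (\<sigma> i) p))) (at p)"
      by (rule derivative_eq_intros DERIV_chain2[OF poly_DERIV D[OF ip]] refl)+ simp
    moreover have "((\<lambda>q. poly a (\<sigma> i q) + q * poly b (\<sigma> i q)) has_field_derivative 0) (at p)"
    proof (rule has_field_derivative_transform_within_open[where f="\<lambda>_. 0"])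
      show "open (ball p0 r)" "p \<in> ball p0 r" using ip by simp_all
      show "0 = poly a (\<sigma> i q) + q * poly b (\<sigma> i q)" if "q \<in> ball p0 r" for q
        using z[OF ip(1) that] by simp
    qed simp
    ultimately have "poly (pderiv a) (\<sigma> i p) * deriv (\<sigma> i) p + (poly b (\<sigma> i p) + p * (poly (pderiv b) (\<sigma> i p) * deriv (\<sigma> i) p)) = 0"
      by (rule DERIV_unique)
    then show ?thesis by (simp add: pderiv_add pderiv_smult algebra_simps add_eq_0_iff)
  qed
  have nz: "poly (pderiv (fibre_poly a b p)) (\<sigma> i p) \<noteq> 0" if ip: "i < d" "p \<in> ball p0 r" for i p
  proof
    assume "poly (pderiv (fibre_poly a b p)) (\<sigma> i p) = 0"
    then have "poly b (\<sigma> i p) = 0" using der[OF ip] by simp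
    then show False using coprime[of "\<sigma> i p"] z[OF ip] by simp
  qed
  have vel: "deriv (\<sigma> i) p = fibre_velocity a b p (\<sigma> i p)" if ip: "i < d" "p \<in> ball p0 r" for i p
    using der[OF ip] nz[OF ip] by (simp add: fibre_velocity_def field_simps)
  have D2: "(\<lambda>p. fibre_velocity a b p (\<sigma> i p)) field_differentiable (at p)" if ip: "i < d" "p \<in> ball p0 r" for i p
  proof -
    have s: "\<sigma> i field_differentiable at p" using D[OF ip] by (auto simp: field_differentiable_def)
    have pl: "(\<lambda>p. poly f (\<sigma> i p)) field_differentiable at p" for f
      using DERIV_chain2[OF poly_DERIV D[OF ip]] unfolding field_differentiable_def by blast
    show ?thesis
      unfolding fibre_velocity_def pderiv_add pderiv_smult poly_add poly_smult
      using nz[OF ip]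
      by (intro field_differentiable_divide field_differentiable_minus pl field_differentiable_add
          field_differentiable_mult field_differentiable_ident) (simp add: pderiv_add pderiv_smult)
  qed
  have total: "total_height a b p = (\<Sum>(i, j, l)\<in>increasing_triples d. fibre_height a b p (\<sigma> i p, \<sigma> j p, \<sigma> l p))"
    if p: "p \<in> ball p0 r" for p
  proof -
    have bij: "bij_betw (\<lambda>i. \<sigma> i p) {..<d} (fibre a b p)"
      unfolding bij_betw_def
    proof
      show "inj_on (\<lambda>i. \<sigma> i p) {..<d}" using ne[OF _ _ _ p] by (auto simp: inj_on_def)
      show "(\<lambda>i. \<sigma> i p) ` {..<d} = fibre a b p"
        using eval[OF p] lead[OF p] z[OF _ p] by (auto simp: fibre_def)
    qed
    define f where "f i j l = fibre_height a b p (\<sigma> i p, \<sigma> j p, \<sigma> l p)" for i j l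
    have "(\<Sum>T\<in>distinct_triples (fibre a b p). fibre_height a b p T) = (\<Sum>(i, j, l)\<in>distinct_triples {..<d}. f i j l)"
      using sum.reindex_bij_betw[OF bij_betw_distinct_triples[OF bij], of "fibre_height a b p"]
      by (simp add: f_def split_def)
    also have "\<dots> = 6 *\<^sub>R (\<Sum>(i, j, l)\<in>increasing_triples d. f i j l)"
      unfolding increasing_triples_def
    proof (rule sum_distinct_triples)
      show "f j l i = f i j l" for i j l
        unfolding f_def fibre_height_def prod.case by (subst interpolate0_rotate) (rule refl)
      show "f i l j = f i j l" for i j l
        unfolding f_def fibre_height_def prod.case by (subst interpolate0_swap) (rule refl)
    qed
    finally show ?thesis by (simp add: total_height_def f_def scaleR_conv_of_real)
  qed
  show thesis
    by (rule that[of r \<sigma>]) (use r D vel D2 ne lead eval total in \<open>simp_all\<close>)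
qed


lemma total_height_differentiable:
  assumes "regular_value d a b p"
  shows "(total_height a b has_field_derivative deriv (total_height a b) p) (at p)"
proof (rule fibre_branches[OF assms])
  fix r :: real and \<sigma> :: "nat \<Rightarrow> complex \<Rightarrow> complex"
  assume r: "0 < r"
    "\<And>i p'. i < d \<Longrightarrow> p' \<in> ball p r \<Longrightarrow> (\<sigma> i has_field_derivative fibre_velocity a b p' (\<sigma> i p')) (at p')"
    "\<And>i p'. i < d \<Longrightarrow> p' \<in> ball p r \<Longrightarrow> (\<lambda>p. fibre_velocity a b p (\<sigma> i p)) field_differentiable (at p')"
    "\<And>i j p'. i < d \<Longrightarrow> j < d \<Longrightarrow> i \<noteq> j \<Longrightarrow> p' \<in> ball p r \<Longrightarrow> \<sigma> i p' \<noteq> \<sigma> j p'"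
    "\<And>p'. p' \<in> ball p r \<Longrightarrow> coeff a d + p' * coeff b d \<noteq> 0"
    "\<And>p' s. p' \<in> ball p r \<Longrightarrow> poly (fibre_poly a b p') s = (coeff a d + p' * coeff b d) * (\<Prod>i<d. s - \<sigma> i p')"
    "\<And>p'. p' \<in> ball p r \<Longrightarrow> total_height a b p' = (\<Sum>(i, j, l)\<in>increasing_triples d. fibre_height a b p' (\<sigma> i p', \<sigma> j p', \<sigma> l p'))"
  have p: "p \<in> ball p r" using r(1) by simp
  have s: "(\<lambda>q. q - \<sigma> i q) field_differentiable at p" if "i < d" for i
    using r(2)[OF that p] by (intro field_differentiable_diff field_differentiable_ident) (auto simp: field_differentiable_def)
  have s2: "(\<lambda>q. q - \<sigma> i q - (q - \<sigma> j q)) field_differentiable at p" if "i < d" "j < d" for i j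
    by (intro field_differentiable_diff s that)
  have "(\<lambda>q. \<Sum>(i, j, l)\<in>increasing_triples d. fibre_height a b q (\<sigma> i q, \<sigma> j q, \<sigma> l q)) field_differentiable at p"
  proof (rule field_differentiable_sum, clarify)
    fix i j l assume "(i, j, l) \<in> increasing_triples d"
    then have i: "i < d" "j < d" "l < d" "i \<noteq> j" "j \<noteq> l" "l \<noteq> i" by (auto simp: increasing_triples_def)
    have n: "p - \<sigma> u p - (p - \<sigma> v p) \<noteq> 0" if "u < d" "v < d" "u \<noteq> v" for u v
      using r(4)[OF that p] by simp
    show "(\<lambda>q. fibre_height a b q (\<sigma> i q, \<sigma> j q, \<sigma> l q)) field_differentiable at p"
      unfolding fibre_height_def interpolate0_def prod.case
      by (intro field_differentiable_diff[OF field_differentiable_const] field_differentiable_add field_differentiable_mult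
          field_differentiable_divide s2 s r(3) no_zero_divisors n i i(4-6)[symmetric] p)
  qed
  then obtain D where "((\<lambda>q. \<Sum>(i, j, l)\<in>increasing_triples d. fibre_height a b q (\<sigma> i q, \<sigma> j q, \<sigma> l q))
      has_field_derivative D) (at p)" by (auto simp: field_differentiable_def)
  then have "(total_height a b has_field_derivative D) (at p)"
    by (rule has_field_derivative_transform_within_open[OF _ open_ball p]) (simp add: r(7))
  then show ?thesis using DERIV_imp_deriv by blast
qed

end

section \<open>The curvature of the Legendre transform of a homogeneous foliation\<close>

lemma bform_fibre_poly: "bform d (fibre_poly a b p) x y = bform d a x y + p * bform d b x y"
  by (simp add: bform_def sum.distrib sum_distrib_left algebra_simps)

lemma bform_factor:
  assumes le: "degree N \<le> d" and N: "\<And>s. poly N s = c * (\<Prod>i<d. s - \<sigma> i)" "coeff N d = c"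
  shows "bform d N x y = c * (\<Prod>i<d. y - \<sigma> i * x)"
proof (cases "x = 0")
  case True
  then show ?thesis by (simp add: bform_0_left N(2))
next
  case False
  have "bform d N x y = x ^ d * (c * (\<Prod>i<d. y / x - \<sigma> i))"
    by (simp add: bform_eq_poly[OF le False] N(1))
  also have "\<dots> = c * ((\<Prod>i<d. x) * (\<Prod>i<d. y / x - \<sigma> i))" by simp
  also have "\<dots> = c * (\<Prod>i<d. x * (y / x - \<sigma> i))" by (simp only: prod.distrib)
  also have "\<dots> = c * (\<Prod>i<d. y - \<sigma> i * x)"
    using False by (simp add: algebra_simps)
  finally show ?thesis .
qed

lemma normal_chart_coprime:
  assumes "normal_chart d \<Omega> g a b" "poly b s = 0"
  shows "poly a s \<noteq> 0"
proof -
  have "bform d a 1 s \<noteq> 0 \<or> bform d b 1 s \<noteq> 0" using assms(1) by (simp add: normal_chart_def)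
  then show ?thesis using assms by (simp add: normal_chart_def bform_1)
qed

lemma has_log_grad_mult:
  assumes "has_grad f (scale2 (f x) \<alpha>) x" "has_grad g (scale2 (g x) \<beta>) x"
  shows "has_grad (\<lambda>x. f x * g x) (scale2 (f x * g x) (\<alpha> + \<beta>)) x"
proof -
  have "scale2 (g x) (scale2 (f x) \<alpha>) + scale2 (f x) (scale2 (g x) \<beta>) = scale2 (f x * g x) (\<alpha> + \<beta>)"
    by (simp add: prod_eq_iff algebra_simps)
  then show ?thesis using has_grad_mult[OF assms] by simp
qed

lemma has_log_grad_power:
  assumes "has_grad f (scale2 (f x) \<alpha>) x"
  shows "has_grad (\<lambda>x. f x ^ n) (scale2 (f x ^ n) (scale2 (of_nat n) \<alpha>)) x"
proof (induct n)
  case 0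
  have "scale2 1 (scale2 0 \<alpha>) = 0" by (simp add: scale2_def zero_prod_def)
  then show ?case using has_grad_const[of 1 x] by simp
next
  case (Suc n)
  have "\<alpha> + scale2 (of_nat n) \<alpha> = scale2 (of_nat (Suc n)) \<alpha>"
    by (simp add: prod_eq_iff algebra_simps)
  then show ?case using has_log_grad_mult[OF assms Suc] by simp
qed

lemma has_log_grad_inverse:
  assumes "has_grad f (scale2 (f x) \<alpha>) x" "f x \<noteq> 0"
  shows "has_grad (\<lambda>x. inverse (f x)) (scale2 (inverse (f x)) (scale2 (-1) \<alpha>)) x"
proof -
  have "scale2 (- (inverse (f x) ^ 2)) (scale2 (f x) \<alpha>) = scale2 (inverse (f x)) (scale2 (-1) \<alpha>)"
    using assms(2) by (simp add: prod_eq_iff power2_eq_square field_simps)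
  then show ?thesis using has_grad_inverse[OF assms] by simp
qed

lemma has_log_grad_const_mult:
  assumes "has_grad f (scale2 (f x) \<alpha>) x"
  shows "has_grad (\<lambda>x. c * f x) (scale2 (c * f x) \<alpha>) x"
proof -
  have "has_grad (\<lambda>_. c) (scale2 c 0) x" using has_grad_const[of c x] by (simp add: scale2_def zero_prod_def[symmetric])
  from has_log_grad_mult[OF this assms] show ?thesis by simp
qed

definition dual_grad :: "complex^3^3 \<Rightarrow> 3 \<Rightarrow> c2" where
  "dual_grad M j = (M$1$j, - M$3$j)"

lemma has_grad_dual_coords: "has_grad (\<lambda>x. dual_coords M x $ j) (dual_grad M j) x"
  unfolding has_grad_def dual_coords_components dual_grad_def
  by (auto intro!: derivative_eq_intros simp: algebra_simps)

lemma dual_coords_deriv_grad: "dual_coords_deriv M \<xi> $ j = fst (dual_grad M j) * fst \<xi> + snd (dual_grad M j) * snd \<xi>"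
  by (simp add: dual_coords_components dual_grad_def)

lemma has_log_grad_dual_coords:
  assumes "dual_coords M x $ j \<noteq> 0"
  shows "has_grad (\<lambda>x. dual_coords M x $ j)
    (scale2 (dual_coords M x $ j) (scale2 (inverse (dual_coords M x $ j)) (dual_grad M j))) x"
  using has_grad_dual_coords[of M j x] assms by (simp add: scale2_scale2)

lemma closed_form_dlog:
  assumes "dual_coords M x $ j \<noteq> 0"
  shows "closed_form (\<lambda>x. scale2 (c * inverse (dual_coords M x $ j)) (dual_grad M j)) x"
proof -
  have "has_grad (\<lambda>x. c * inverse (dual_coords M x $ j))
      (scale2 (c * inverse (dual_coords M x $ j)) (scale2 (-1) (scale2 (inverse (dual_coords M x $ j)) (dual_grad M j)))) x"
    using assms by (intro has_log_grad_const_mult has_log_grad_inverse has_log_grad_dual_coords) auto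
  from ext_deriv_scale2[OF this differentiable_form_const[of "dual_grad M j"]]
  show ?thesis by (simp add: closed_form_def ext_deriv_const wedge_simps)
qed

text \<open>The slope \<open>p\<close> of the line in the normal chart, as a function on the dual plane.\<close>

definition slope_at :: "complex^3^3 \<Rightarrow> c2 \<Rightarrow> complex" where
  "slope_at M x = - dual_coords M x $ 1 / dual_coords M x $ 2"

definition dslope :: "complex^3^3 \<Rightarrow> c2 \<Rightarrow> c2" where
  "dslope M x = scale2 (- inverse (dual_coords M x $ 2)) (dual_grad M 1)
     + scale2 (dual_coords M x $ 1 * inverse (dual_coords M x $ 2) ^ 2) (dual_grad M 2)"

text \<open>The form \<open>dq/q\<close>.\<close>

definition dlog_intercept :: "complex^3^3 \<Rightarrow> c2 \<Rightarrow> c2" where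
  "dlog_intercept M x = scale2 (1 * inverse (dual_coords M x $ 3)) (dual_grad M 3)
     + scale2 (- 1 * inverse (dual_coords M x $ 2)) (dual_grad M 2)"

lemma has_grad_slope_at:
  assumes "dual_coords M x $ 2 \<noteq> 0"
  shows "has_grad (slope_at M) (dslope M x) x"
proof -
  have "has_grad (\<lambda>x. - (dual_coords M x $ 1 * inverse (dual_coords M x $ 2))) (- (scale2 (inverse (dual_coords M x $ 2)) (dual_grad M 1)
      + scale2 (dual_coords M x $ 1) (scale2 (- (inverse (dual_coords M x $ 2) ^ 2)) (dual_grad M 2)))) x"
    by (intro has_grad_minus has_grad_mult has_grad_inverse has_grad_dual_coords assms)
  moreover have "(\<lambda>x. - (dual_coords M x $ 1 * inverse (dual_coords M x $ 2))) = slope_at M"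
    by (rule ext) (simp add: slope_at_def divide_inverse)
  moreover have "- (scale2 (inverse (dual_coords M x $ 2)) (dual_grad M 1)
      + scale2 (dual_coords M x $ 1) (scale2 (- (inverse (dual_coords M x $ 2) ^ 2)) (dual_grad M 2))) = dslope M x"
    by (simp add: dslope_def prod_eq_iff algebra_simps)
  ultimately show ?thesis by simp
qed

lemma closed_form_dslope:
  assumes "dual_coords M x $ 2 \<noteq> 0"
  shows "closed_form (dslope M) x"
proof -
  let ?i = "inverse (dual_coords M x $ 2)"
  have 1: "has_grad (\<lambda>x. - inverse (dual_coords M x $ 2)) (- scale2 (- (?i ^ 2)) (dual_grad M 2)) x"
    by (intro has_grad_minus has_grad_inverse has_grad_dual_coords assms)
  have 2: "has_grad (\<lambda>x. dual_coords M x $ 1 * inverse (dual_coords M x $ 2) ^ 2)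
     (scale2 (?i ^ 2) (dual_grad M 1) + scale2 (dual_coords M x $ 1)
       (scale2 (?i ^ 2) (scale2 (of_nat 2) (scale2 (-1) (scale2 ?i (dual_grad M 2)))))) x"
    using assms
    by (intro has_grad_mult has_grad_dual_coords has_log_grad_power has_log_grad_inverse has_log_grad_dual_coords)
  note e1 = ext_deriv_scale2[OF 1 differentiable_form_const[of "dual_grad M 1"]]
  note e2 = ext_deriv_scale2[OF 2 differentiable_form_const[of "dual_grad M 2"]]
  have neg: "wedge (- u) v = - wedge u v" for u v by (simp add: wedge_def)
  show ?thesis
    unfolding closed_form_def dslope_def[abs_def] ext_deriv_add(1)[OF e1(2) e2(2)] e1(1) e2(1)
    using ext_deriv_add(2)[OF e1(2) e2(2)] wedge_flip[of "dual_grad M 1" "dual_grad M 2"]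
    by (simp add: ext_deriv_const wedge_simps neg)
qed

lemma closed_form_dlog_intercept:
  assumes "dual_coords M x $ 2 \<noteq> 0" "dual_coords M x $ 3 \<noteq> 0"
  shows "closed_form (dlog_intercept M) x"
  unfolding dlog_intercept_def[abs_def] by (intro closed_form_add closed_form_dlog assms)

lemma wedge_dslope_dlog_intercept:
  assumes "dual_coords M x $ 2 \<noteq> 0" "dual_coords M x $ 3 \<noteq> 0"
  shows "wedge (dslope M x) (dlog_intercept M x)
    = - det M * (inverse (dual_coords M x $ 2) ^ 2 * inverse (dual_coords M x $ 3))"
proof -
  let ?L = "dual_coords M x" and ?w = "\<lambda>i j. wedge (dual_grad M i) (dual_grad M j)"
  have "?L$1 * ?w 2 3 - ?L$2 * ?w 1 3 + ?L$3 * ?w 1 2 = - det M"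
    by (simp add: wedge_def dual_grad_def dual_coords_components det_3 algebra_simps)
  moreover have "wedge (dslope M x) (dlog_intercept M x)
    = (?L$1 * ?w 2 3 - ?L$2 * ?w 1 3 + ?L$3 * ?w 1 2) * (inverse (?L$2) ^ 2 * inverse (?L$3))"
    using assms by (simp add: dslope_def dlog_intercept_def wedge_simps power2_eq_square field_simps)
  ultimately show ?thesis by simp
qed

lemma closed_form_log_deriv_slope:
  assumes L2: "dual_coords M x $ 2 \<noteq> 0" and h: "(h has_field_derivative h') (at (slope_at M x))"
  shows "closed_form (\<lambda>x. scale2 (h (slope_at M x)) (dslope M x)) x"
proof -
  have c: "differentiable_form (dslope M) x" "ext_deriv (dslope M) x = 0"
    using closed_form_dslope[OF L2] by (auto simp: closed_form_def)
  from ext_deriv_scale2[OF has_grad_chain[OF has_grad_slope_at[OF L2] h] c(1)] c(2)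
  show ?thesis by (simp add: closed_form_def wedge_simps)
qed

lemma continuous_on_dual_coords: "continuous_on A (\<lambda>x. dual_coords M x $ j)"
  unfolding dual_coords_components by (intro continuous_intros)

text \<open>The point of contact of a line moving with velocity \<open>(dp, dq)\<close> lies in the direction \<open>s\<close> iff
  \<open>(p - s) dq - q dp = 0\<close>.\<close>

lemma web_factor:
  fixes x \<xi> :: c2 and s :: complex
  assumes L: "dual_coords M x $ 2 \<noteq> 0" "dual_coords M x $ 3 \<noteq> 0"
  defines "K \<equiv> cross (dual_coords M x) (dual_coords_deriv M \<xi>)"
    and "\<omega> \<equiv> scale2 (slope_at M x - s) (dlog_intercept M x) + scale2 (-1) (dslope M x)"
  shows "K $ 2 - s * K $ 1 = dual_coords M x $ 2 * dual_coords M x $ 3 * (fst \<omega> * fst \<xi> + snd \<omega> * snd \<xi>)"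
proof -
  let ?L = "dual_coords M x" and ?L' = "dual_coords_deriv M \<xi>"
  define ev where "ev \<alpha> = fst \<alpha> * fst \<xi> + snd \<alpha> * snd \<xi>" for \<alpha> :: c2
  have ev: "ev (\<alpha> + \<beta>) = ev \<alpha> + ev \<beta>" "ev (scale2 c \<alpha>) = c * ev \<alpha>" "ev (dual_grad M j) = ?L' $ j" for \<alpha> \<beta> c j
    by (simp_all add: ev_def dual_coords_deriv_grad algebra_simps)
  define i2 i3 where "i2 = inverse (?L$2)" and "i3 = inverse (?L$3)"
  have "?L$2 * i2 = 1" "?L$3 * i3 = 1" using L by (simp_all add: i2_def i3_def)
  moreover have "slope_at M x = - ?L$1 * i2" by (simp add: slope_at_def i2_def divide_inverse)
  moreover have "ev \<omega> = (slope_at M x - s) * (i3 * ?L'$3 - i2 * ?L'$2) + i2 * ?L'$1 - ?L$1 * (i2 * i2) * ?L'$2"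
    by (simp add: \<omega>_def ev dlog_intercept_def dslope_def i2_def i3_def power2_eq_square)
  ultimately have "?L$2 * ?L$3 * ev \<omega> = K $ 2 - s * K $ 1"
    unfolding K_def cross_components by algebra
  then show ?thesis by (simp add: ev_def)
qed

text \<open>The web is a web of the type studied above for \<open>P = p\<close> and \<open>\<psi> = dq/q\<close>, where \<open>(p, q)\<close> are the
  slope and the intercept in the normal chart, while the curvature is computed in an arbitrary chart
  of the dual plane. The last factor is the coefficient of \<open>dp \<and> dq/q\<close> in that chart.\<close>

lemma curvature_normal_chart:
  assumes d: "2 \<le> d" and fol: "foliation d \<Omega>" and nc: "normal_chart d \<Omega> g0 a b" and g: "invertible g"
  defines "M \<equiv> matrix_inv g ** g0"
  assumes L: "dual_coords M m $ 2 \<noteq> 0" "dual_coords M m $ 3 \<noteq> 0"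
    and reg: "regular_value d a b (slope_at M m)"
  shows "m \<notin> discriminant d (legendre_transform d \<Omega> g)"
    and "curvature d (legendre_transform d \<Omega> g) m = deriv (total_height a b) (slope_at M m)
      * (- det M * (inverse (dual_coords M m $ 2) ^ 2 * inverse (dual_coords M m $ 3)))"
proof -
  have g0: "invertible g0" and deg: "degree a \<le> d" "degree b \<le> d" using nc by (simp_all add: normal_chart_def)
  have M: "det M \<noteq> 0" unfolding M_def using g g0 by (simp add: det_mul invertible_inverse)
  have d1: "1 \<le> d" using d by simp
  note cop = normal_chart_coprime[OF nc]
  define p0 where "p0 = slope_at M m"
  have "m \<notin> discriminant d (legendre_transform d \<Omega> g) \<and>
    curvature d (legendre_transform d \<Omega> g) m = deriv (total_height a b) p0
      * (- det M * (inverse (dual_coords M m $ 2) ^ 2 * inverse (dual_coords M m $ 3)))"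
  proof (rule fibre_branches[OF d1 deg cop reg[folded p0_def]])
    fix r :: real and \<sigma> :: "nat \<Rightarrow> complex \<Rightarrow> complex"
    assume r: "0 < r"
      and D: "\<And>i p. i < d \<Longrightarrow> p \<in> ball p0 r \<Longrightarrow> (\<sigma> i has_field_derivative fibre_velocity a b p (\<sigma> i p)) (at p)"
      and D2: "\<And>i p. i < d \<Longrightarrow> p \<in> ball p0 r \<Longrightarrow> (\<lambda>p. fibre_velocity a b p (\<sigma> i p)) field_differentiable (at p)"
      and ne: "\<And>i j p. i < d \<Longrightarrow> j < d \<Longrightarrow> i \<noteq> j \<Longrightarrow> p \<in> ball p0 r \<Longrightarrow> \<sigma> i p \<noteq> \<sigma> j p"
      and lead: "\<And>p. p \<in> ball p0 r \<Longrightarrow> coeff a d + p * coeff b d \<noteq> 0"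
      and fact: "\<And>p s. p \<in> ball p0 r \<Longrightarrow> poly (fibre_poly a b p) s = (coeff a d + p * coeff b d) * (\<Prod>i<d. s - \<sigma> i p)"
      and total: "\<And>p. p \<in> ball p0 r \<Longrightarrow> total_height a b p = (\<Sum>(i, j, l)\<in>increasing_triples d. fibre_height a b p (\<sigma> i p, \<sigma> j p, \<sigma> l p))"
    define U where "U = {x. dual_coords M x $ 2 \<noteq> 0} \<inter> {x. dual_coords M x $ 3 \<noteq> 0}"
    have U: "open U" unfolding U_def
      by (intro open_Int open_Collect_neq continuous_on_dual_coords continuous_on_const)
    have "continuous_on U (slope_at M)"
      unfolding slope_at_def[abs_def] U_def
      by (intro continuous_on_divide continuous_on_minus continuous_on_dual_coords) auto
    then have "open (U \<inter> slope_at M -` ball p0 r)"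
      using U open_ball by (rule continuous_open_preimage)
    define V where "V = U \<inter> slope_at M -` ball p0 r"
    have V: "open V" "m \<in> V"
      using \<open>open (U \<inter> slope_at M -` ball p0 r)\<close> L r by (simp_all add: V_def U_def p0_def)
    have VD: "dual_coords M x $ 2 \<noteq> 0" "dual_coords M x $ 3 \<noteq> 0" "slope_at M x \<in> ball p0 r" if "x \<in> V" for x
      using that by (auto simp: V_def U_def)
    define J where "J x = wedge (dslope M x) (dlog_intercept M x)" for x
    have J: "J x = - det M * (inverse (dual_coords M x $ 2) ^ 2 * inverse (dual_coords M x $ 3))" if "x \<in> V" for x
      unfolding J_def by (rule wedge_dslope_dlog_intercept[OF VD(1,2)[OF that]])
    define lJ where "lJ x = scale2 (- 2 * inverse (dual_coords M x $ 2)) (dual_grad M 2)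
        + scale2 (- 1 * inverse (dual_coords M x $ 3)) (dual_grad M 3)" for x
    have gJ: "has_grad J (scale2 (J x) (lJ x)) x" if x: "x \<in> V" for x
    proof -
      have "has_grad (\<lambda>x. - det M * (inverse (dual_coords M x $ 2) ^ 2 * inverse (dual_coords M x $ 3)))
        (scale2 (- det M * (inverse (dual_coords M x $ 2) ^ 2 * inverse (dual_coords M x $ 3)))
         (scale2 (of_nat 2) (scale2 (-1) (scale2 (inverse (dual_coords M x $ 2)) (dual_grad M 2)))
          + scale2 (-1) (scale2 (inverse (dual_coords M x $ 3)) (dual_grad M 3)))) x"
        using VD[OF x]
        by (intro has_log_grad_const_mult has_log_grad_mult has_log_grad_power has_log_grad_inverse has_log_grad_dual_coords)
      note h = this
      have ev: "\<forall>\<^sub>F y in nhds x. - det M * (inverse (dual_coords M y $ 2) ^ 2 * inverse (dual_coords M y $ 3)) = J y"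
        using eventually_nhds_in_open[OF V(1) x] by (rule eventually_mono) (simp add: J)
      show ?thesis
        using has_grad_cong[OF ev h] unfolding J[OF x] lJ_def by (simp add: scale2_scale2)
    qed
    define lead_at where "lead_at p = coeff a d + p * coeff b d" for p
    define u where "u x = - (1 / det M ^ (d + 1)) * (lead_at (slope_at M x) * (dual_coords M x $ 2 ^ (d + 1) * dual_coords M x $ 3 ^ d))" for x
    define lu where "lu x = scale2 (coeff b d * inverse (lead_at (slope_at M x))) (dslope M x)
        + (scale2 (of_nat (d + 1) * inverse (dual_coords M x $ 2)) (dual_grad M 2)
        + scale2 (of_nat d * inverse (dual_coords M x $ 3)) (dual_grad M 3))" for x
    have lead0: "lead_at (slope_at M x) \<noteq> 0" if "x \<in> V" for x
      using lead[OF VD(3)[OF that]] by (simp add: lead_at_def)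
    have u0: "u x \<noteq> 0" if "x \<in> V" for x
      using VD[OF that] lead0[OF that] M by (simp add: u_def)
    have gu: "has_grad u (scale2 (u x) (lu x)) x" if x: "x \<in> V" for x
    proof -
      have "(lead_at has_field_derivative coeff b d) (at (slope_at M x))"
        unfolding lead_at_def[abs_def] by (auto intro!: derivative_eq_intros)
      from has_grad_chain[OF has_grad_slope_at[OF VD(1)[OF x]] this]
      have "has_grad (\<lambda>x. lead_at (slope_at M x)) (scale2 (lead_at (slope_at M x))
          (scale2 (coeff b d * inverse (lead_at (slope_at M x))) (dslope M x))) x"
        using lead0[OF x] by (simp add: scale2_scale2 mult.left_commute)
      then have "has_grad u (scale2 (u x) (scale2 (coeff b d * inverse (lead_at (slope_at M x))) (dslope M x)
        + (scale2 (of_nat (d + 1)) (scale2 (inverse (dual_coords M x $ 2)) (dual_grad M 2))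
        + scale2 (of_nat d) (scale2 (inverse (dual_coords M x $ 3)) (dual_grad M 3))))) x"
        unfolding u_def using VD[OF x]
        by (intro has_log_grad_const_mult has_log_grad_mult has_log_grad_power has_log_grad_dual_coords)
      then show ?thesis unfolding lu_def scale2_scale2 .
    qed
    have cl: "closed_form (\<lambda>x. scale2 (1 / f x) (scale2 (f x) (l x))) m"
      if "closed_form l m" "\<And>x. x \<in> V \<Longrightarrow> f x \<noteq> 0" for f and l :: one_form
    proof (rule closed_form_cong[OF _ that(1)])
      show "\<forall>\<^sub>F x in nhds m. l x = scale2 (1 / f x) (scale2 (f x) (l x))"
        using eventually_nhds_in_open[OF V] by (rule eventually_mono) (simp add: that(2) scale2_scale2)
    qed
    have clJ: "closed_form lJ m"
      unfolding lJ_def[abs_def] by (intro closed_form_add closed_form_dlog L)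
    have dlead: "((\<lambda>p. coeff b d * inverse (lead_at p)) has_field_derivative
        coeff b d * - (inverse (lead_at p0) * coeff b d * inverse (lead_at p0))) (at p0)"
      using lead0[OF V(2)] unfolding p0_def[symmetric] lead_at_def[abs_def]
      by (auto intro!: derivative_eq_intros)
    have clu: "closed_form lu m"
      unfolding lu_def[abs_def]
      by (intro closed_form_add closed_form_dlog closed_form_log_deriv_slope[where h="\<lambda>p. coeff b d * inverse (lead_at p)"] L)
         (use dlead in \<open>simp add: p0_def\<close>)
    define \<omega> where "\<omega> i x = scale2 (slope_at M x - \<sigma> i (slope_at M x)) (dlog_intercept M x) + scale2 (-1) (dslope M x)" for i x
    have W: "legendre_transform d \<Omega> g x \<xi> = u x * (\<Prod>i<d. fst (\<omega> i x) * fst \<xi> + snd (\<omega> i x) * snd \<xi>)"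
      if x: "x \<in> V" for x \<xi>
    proof -
      let ?L = "dual_coords M x" and ?p = "slope_at M x"
      define K where "K = cross ?L (dual_coords_deriv M \<xi>)"
      have "degree (fibre_poly a b ?p) \<le> d"
        using deg by (intro degree_add_le order.trans[OF degree_smult_le]) auto
      from bform_factor[OF this fact[OF VD(3)[OF x]], of "K $ 1" "K $ 2"]
      have bf: "bform d a (K$1) (K$2) + ?p * bform d b (K$1) (K$2) = lead_at ?p * (\<Prod>i<d. K$2 - \<sigma> i ?p * K$1)"
        by (simp add: bform_fibre_poly lead_at_def)
      have wf: "K$2 - \<sigma> i ?p * K$1 = ?L$2 * ?L$3 * (fst (\<omega> i x) * fst \<xi> + snd (\<omega> i x) * snd \<xi>)" for i
        unfolding K_def \<omega>_def by (rule web_factor[OF VD(1,2)[OF x]])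
      have "det M ^ (d + 1) * legendre_transform d \<Omega> g x \<xi> = ?L$1 * bform d b (K$1) (K$2) - ?L$2 * bform d a (K$1) (K$2)"
        using legendre_transform_normal[OF fol nc g, of x \<xi>] VD(1)[OF x] unfolding K_def M_def by simp
      also have "\<dots> = - (?L$2 * (bform d a (K$1) (K$2) + ?p * bform d b (K$1) (K$2)))"
        using VD(1)[OF x] by (simp add: slope_at_def field_simps)
      also have "\<dots> = - (?L$2 * (lead_at ?p * (\<Prod>i<d. ?L$2 * ?L$3 * (fst (\<omega> i x) * fst \<xi> + snd (\<omega> i x) * snd \<xi>))))"
        unfolding bf wf ..
      also have "\<dots> = det M ^ (d + 1) * (u x * (\<Prod>i<d. fst (\<omega> i x) * fst \<xi> + snd (\<omega> i x) * snd \<xi>))"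
        unfolding prod.distrib using M by (simp add: u_def power_mult_distrib field_simps)
      finally show ?thesis using M by simp
    qed
    have aD: "((\<lambda>p. p - \<sigma> i p) has_field_derivative 1 - fibre_velocity a b p (\<sigma> i p)) (at p)"
      if "i < d" "p \<in> ball p0 r" for i p
      by (rule derivative_intros D[OF that])+
    have B: "(\<Sum>T\<in>increasing_triples d. pencil_height (\<lambda>i p. p - \<sigma> i p) (\<lambda>i p. 1 - fibre_velocity a b p (\<sigma> i p)) T p)
        = total_height a b p" if "p \<in> ball p0 r" for p
      unfolding total[OF that] by (rule sum.cong) (auto simp: fibre_height_def pencil_height_def)
    have "(total_height a b has_field_derivative deriv (total_height a b) p0) (at p0)"
      by (rule total_height_differentiable[OF d1 deg cop reg[folded p0_def]])
    then have BD: "((\<lambda>p. \<Sum>T\<in>increasing_triples d. pencil_height (\<lambda>i p. p - \<sigma> i p) (\<lambda>i p. 1 - fibre_velocity a b p (\<sigma> i p)) T p)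
        has_field_derivative deriv (total_height a b) p0) (at p0)"
      by (rule has_field_derivative_transform_within_open[OF _ open_ball[of p0 r]]) (use r B in auto)
    have "(\<lambda>p. 1 - fibre_velocity a b p (\<sigma> i p)) field_differentiable at p0" if "i < d" for i
      using r by (intro field_differentiable_diff field_differentiable_const D2 that) simp
    then have a2: "\<exists>D. ((\<lambda>p. 1 - fibre_velocity a b p (\<sigma> i p)) has_field_derivative D) (at (slope_at M m))" if "i < d" for i
      using that by (simp add: field_differentiable_def p0_def)
    note pc = pencil_curvature[where k=d and N=V and a="\<lambda>i p. p - \<sigma> i p" and a'="\<lambda>i p. 1 - fibre_velocity a b p (\<sigma> i p)"
        and P="slope_at M" and J=J and \<pi>="dslope M" and \<psi>="dlog_intercept M" and dJ="\<lambda>x. scale2 (J x) (lJ x)"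
        and \<omega>=\<omega> and m=m and u=u and du="\<lambda>x. scale2 (u x) (lu x)" and W="legendre_transform d \<Omega> g"
        and B'="deriv (total_height a b) p0"]
    have J0: "J x \<noteq> 0" if "x \<in> V" for x using J[OF that] VD[OF that] M by simp
    have prem: "\<And>x i j. x \<in> V \<Longrightarrow> i < d \<Longrightarrow> j < d \<Longrightarrow> i \<noteq> j \<Longrightarrow> slope_at M x - \<sigma> i (slope_at M x) \<noteq> slope_at M x - \<sigma> j (slope_at M x)"
      using ne VD(3) by simp
    have pP: "\<And>x. x \<in> V \<Longrightarrow> has_grad (slope_at M) (dslope M x) x"
      and p\<pi>: "\<And>x. x \<in> V \<Longrightarrow> closed_form (dslope M) x"
      and p\<psi>: "\<And>x. x \<in> V \<Longrightarrow> closed_form (dlog_intercept M) x"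
      by (simp_all add: VD has_grad_slope_at closed_form_dslope closed_form_dlog_intercept)
    have pa: "\<And>x i. x \<in> V \<Longrightarrow> i < d \<Longrightarrow> ((\<lambda>p. p - \<sigma> i p) has_field_derivative
        1 - fibre_velocity a b (slope_at M x) (\<sigma> i (slope_at M x))) (at (slope_at M x))"
      by (intro aD VD(3))
    have clJ': "closed_form (\<lambda>x. scale2 (1 / J x) (scale2 (J x) (lJ x))) m" by (rule cl[OF clJ J0])
    have clu': "closed_form (\<lambda>x. scale2 (1 / u x) (scale2 (u x) (lu x))) m" by (rule cl[OF clu u0])
    have BD': "((\<lambda>p. \<Sum>T\<in>increasing_triples d. pencil_height (\<lambda>i p. p - \<sigma> i p) (\<lambda>i p. 1 - fibre_velocity a b p (\<sigma> i p)) T p)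
        has_field_derivative deriv (total_height a b) p0) (at (slope_at M m))"
      using BD by (simp only: p0_def[symmetric])
    note pc' = pc[OF V(1) pP p\<pi> p\<psi> J_def J0 gJ pa prem \<omega>_def d V(2) a2 u0 gu W clJ' clu' BD']
    show ?thesis using pc' J[OF V(2)] by simp
  qed
  then show "m \<notin> discriminant d (legendre_transform d \<Omega> g)"
    "curvature d (legendre_transform d \<Omega> g) m = deriv (total_height a b) (slope_at M m)
      * (- det M * (inverse (dual_coords M m $ 2) ^ 2 * inverse (dual_coords M m $ 3)))"
    by (simp_all add: p0_def)
qed

section \<open>Critical values of the Gauss map\<close>

lemma bform_has_zero:
  assumes "1 \<le> d" "degree p \<le> d"
  shows "\<exists>x y. (x, y) \<noteq> (0, 0) \<and> bform d p x y = 0"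
proof (cases "degree p = 0")
  case True
  then have "coeff p d = 0" using assms by (intro coeff_eq_0) simp
  then have "bform d p 0 1 = 0" by (simp add: bform_0_left)
  then show ?thesis by (intro exI[of _ 0] exI[of _ 1]) simp
next
  case False
  have "\<not> (\<exists>k l. k \<noteq> 0 \<and> l = 0 \<and> p = pCons k l)" using False by auto
  then obtain s where "poly p s = 0" using fundamental_theorem_of_algebra_alt[of p] by blast
  then have "bform d p 1 s = 0" using assms by (simp add: bform_1)
  then show ?thesis by (intro exI[of _ 1] exI[of _ s]) simp
qed

text \<open>The Gauss map is not constant.\<close>

lemma pderiv_wronskian_nonzero:
  assumes d: "1 \<le> d" and deg: "degree a \<le> d" "degree b \<le> d"
    and cop: "\<And>x y. (x, y) \<noteq> (0, 0) \<Longrightarrow> bform d a x y \<noteq> 0 \<or> bform d b x y \<noteq> 0"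
  shows "pderiv a * b - a * pderiv b \<noteq> (0 :: complex poly)"
proof
  assume W: "pderiv a * b - a * pderiv b = 0"
  show False
  proof (cases "degree b = 0")
    case True
    then obtain c where b: "b = [:c:]" by (metis degree_0_id)
    show False
    proof (cases "c = 0")
      case True
      then show False using bform_has_zero[OF d deg(1)] cop b by (auto simp: bform_def)
    next
      case False
      then have "pderiv a = 0" using W b by (simp add: pderiv_pCons)
      then have "degree a = 0" by (simp add: pderiv_eq_0_iff)
      then have "coeff a d = 0" "coeff b d = 0" using d True by (auto intro!: coeff_eq_0)
      then show False using cop[of 0 1] by (simp add: bform_0_left)
    qed
  next
    case False
    have "\<not> (\<exists>k l. k \<noteq> 0 \<and> l = 0 \<and> b = pCons k l)" using False by auto
    then obtain s where s: "poly b s = 0" using fundamental_theorem_of_algebra_alt[of b] by blast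
    have as: "poly a s \<noteq> 0" using cop[of 1 s] s deg by (simp add: bform_1)
    have b': "pderiv b \<noteq> 0" using False by (simp add: pderiv_eq_0_iff)
    have b0: "b \<noteq> 0" "a \<noteq> 0" using False as by auto
    have eq: "pderiv a * b = a * pderiv b" using W by simp
    then have a': "pderiv a * b \<noteq> 0" using b0 b' by simp
    have o: "order s b = Suc (order s (pderiv b))" by (rule order_pderiv[OF b0(1) s])
    have "order s (pderiv a * b) = order s (pderiv a) + order s b" by (rule order_mult[OF a'])
    moreover have "order s (a * pderiv b) = order s a + order s (pderiv b)"
      by (rule order_mult) (use b0 b' in simp)
    moreover have "order s a = 0" using as by (simp add: order_0I)
    ultimately show False using eq o by simp
  qed
qed

lemma finite_critical_values:
  assumes d: "1 \<le> d" and nc: "normal_chart d \<Omega> g a b"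
  shows "finite {p. \<not> regular_value d a b p}"
proof -
  have deg: "degree a \<le> d" "degree b \<le> d"
    and cop: "\<And>x y. (x, y) \<noteq> (0, 0) \<Longrightarrow> bform d a x y \<noteq> 0 \<or> bform d b x y \<noteq> 0"
    using nc by (simp_all add: normal_chart_def)
  let ?w = "pderiv a * b - a * pderiv b"
  have "finite {s. poly ?w s = 0}"
    by (rule poly_roots_finite) (rule pderiv_wronskian_nonzero[OF d deg cop])
  moreover have "{p. \<not> regular_value d a b p} \<subseteq> (\<lambda>s. - poly a s / poly b s) ` {s. poly ?w s = 0} \<union> {- coeff a d / coeff b d}"
  proof
    fix p assume "p \<in> {p. \<not> regular_value d a b p}"
    then consider "coeff a d + p * coeff b d = 0" | "\<not> rsquarefree (fibre_poly a b p)"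
      using regular_value_iff[OF d deg] by auto
    then show "p \<in> (\<lambda>s. - poly a s / poly b s) ` {s. poly ?w s = 0} \<union> {- coeff a d / coeff b d}"
    proof cases
      case 1
      have "coeff b d \<noteq> 0" using cop[of 0 1] 1 by (auto simp: bform_0_left)
      then have "p = - coeff a d / coeff b d" using 1 by (simp add: field_simps add_eq_0_iff)
      then show ?thesis by blast
    next
      case 2
      then obtain s where s: "poly (fibre_poly a b p) s = 0" "poly (pderiv (fibre_poly a b p)) s = 0"
        by (auto simp: rsquarefree_roots)
      then have a: "poly a s = - p * poly b s" "poly (pderiv a) s = - p * poly (pderiv b) s"
        by (simp_all add: pderiv_add pderiv_smult add_eq_0_iff)
      have "poly b s \<noteq> 0" using normal_chart_coprime[OF nc, of s] a by auto
      then have "p = - poly a s / poly b s" using a by simp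
      moreover have "poly ?w s = 0" using a by simp
      ultimately show ?thesis by blast
    qed
  qed
  ultimately show ?thesis by (meson finite.emptyI finite_UnI finite_imageI finite_insert finite_subset)
qed

section \<open>Radial critical points\<close>

lemma poly_lipschitz_cball:
  fixes p :: "complex poly"
  shows "\<exists>K>0. \<forall>x\<in>cball c 1. \<forall>y\<in>cball c 1. cmod (poly p x - poly p y) \<le> K * cmod (x - y)"
proof -
  have "compact (poly (pderiv p) ` cball c 1)"
    by (intro compact_continuous_image continuous_intros) simp
  then have "bounded (poly (pderiv p) ` cball c 1)" by (rule compact_imp_bounded)
  then obtain B where B: "\<forall>x\<in>cball c 1. cmod (poly (pderiv p) x) \<le> B"
    unfolding bounded_iff by blast
  have "cmod (poly p x - poly p y) \<le> (\<bar>B\<bar> + 1) * cmod (x - y)" if "x \<in> cball c 1" "y \<in> cball c 1" for x y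
  proof (rule field_differentiable_bound[of "cball c 1" "poly p" "poly (pderiv p)"])
    show "cmod (poly (pderiv p) z) \<le> \<bar>B\<bar> + 1" if "z \<in> cball c 1" for z using bspec[OF B that] by linarith
  qed (use that in \<open>auto intro: poly_DERIV has_field_derivative_at_within\<close>)
  then show ?thesis by (intro exI[of _ "\<bar>B\<bar> + 1"]) auto
qed

text \<open>Two distinct points of one fibre near a point \<open>\<sigma>\<close> are separated at least proportionally to
  their distance from \<open>\<sigma>\<close>: to first order they differ by a root of unity. At a simple point of the
  fibre no two points are close.\<close>

lemma fibre_separation:
  fixes f b :: "complex poly"
  assumes f: "f \<noteq> 0" "poly f \<sigma> = 0" and b: "poly b \<sigma> \<noteq> 0"
  shows "\<exists>\<eta>>0. \<exists>\<epsilon>>0. \<forall>x\<in>ball \<sigma> \<eta>. \<forall>y\<in>ball \<sigma> \<eta>. x \<noteq> y \<longrightarrow> y \<noteq> \<sigma> \<longrightarrow>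
    poly f x * poly b y = poly f y * poly b x \<longrightarrow>
    \<epsilon> * cmod (y - \<sigma>) \<le> cmod (x - y) \<and> poly (pderiv f) \<sigma> = 0"
proof -
  define n where "n = order \<sigma> f"
  obtain h where h: "f = [:- \<sigma>, 1:] ^ n * h" "\<not> [:- \<sigma>, 1:] dvd h"
    using order_decomp[OF f(1), of \<sigma>] unfolding n_def by blast
  have n0: "n \<noteq> 0" using f by (simp add: n_def order_root)
  have h0: "poly h \<sigma> \<noteq> 0" using h(2) by (simp add: poly_eq_0_iff_dvd)
  have fx: "poly f x = (x - \<sigma>) ^ n * poly h x" for x by (subst h(1)) simp
  have simple: "poly (pderiv f) \<sigma> = 0" if "n \<noteq> 1"
  proof -
    have "n = Suc (Suc (n - 2))" using n0 that by simp
    then have "f = [:- \<sigma>, 1:] * ([:- \<sigma>, 1:] * ([:- \<sigma>, 1:] ^ (n - 2) * h))"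
      using h(1) by (metis mult.assoc power_Suc)
    then have "pderiv f = pderiv ([:- \<sigma>, 1:] * ([:- \<sigma>, 1:] * ([:- \<sigma>, 1:] ^ (n - 2) * h)))" by (rule arg_cong)
    then show ?thesis by (simp only: pderiv_mult poly_add poly_mult) simp
  qed
  obtain Kh where Kh: "Kh > 0" "\<And>x y. x \<in> cball \<sigma> 1 \<Longrightarrow> y \<in> cball \<sigma> 1 \<Longrightarrow> cmod (poly h x - poly h y) \<le> Kh * cmod (x - y)"
    using poly_lipschitz_cball[of \<sigma> h] by blast
  obtain Kb where Kb: "Kb > 0" "\<And>x y. x \<in> cball \<sigma> 1 \<Longrightarrow> y \<in> cball \<sigma> 1 \<Longrightarrow> cmod (poly b x - poly b y) \<le> Kb * cmod (x - y)"
    using poly_lipschitz_cball[of \<sigma> b] by blast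
  define mh mb where "mh = cmod (poly h \<sigma>) / 2" and "mb = cmod (poly b \<sigma>) / 2"
  have mpos: "0 < mh" "0 < mb" using h0 b by (simp_all add: mh_def mb_def)
  define C where "C = (3 * mh * Kb + 3 * mb * Kh) / (mh * mb)"
  have C: "0 < C" unfolding C_def using mpos Kh(1) Kb(1) by (intro divide_pos_pos add_pos_pos mult_pos_pos) auto
  have "((\<lambda>r. \<Sum>i<n. r ^ i) \<longlongrightarrow> (\<Sum>i<n. 1 ^ i)) (at (1::complex))"
    by (intro tendsto_intros)
  then have "((\<lambda>r. cmod (\<Sum>i<n. r ^ i)) \<longlongrightarrow> real n) (at (1::complex))"
    using tendsto_norm by fastforce
  moreover have "1 / 2 < real n" using n0 by simp
  ultimately have "\<forall>\<^sub>F r in at (1::complex). 1 / 2 < cmod (\<Sum>i<n. r ^ i)"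
    by (rule order_tendstoD)
  then obtain \<epsilon> where \<epsilon>: "\<epsilon> > 0" "\<And>r. r \<noteq> 1 \<Longrightarrow> dist r 1 < \<epsilon> \<Longrightarrow> 1 / 2 < cmod (\<Sum>i<n. r ^ i)"
    unfolding eventually_at by auto
  define \<eta> where "\<eta> = min (min 1 (1 / (2 * C))) (min (mh / Kh) (mb / Kb))"
  have \<eta>: "0 < \<eta>" "\<eta> \<le> 1" "\<eta> \<le> 1 / (2 * C)" "\<eta> \<le> mh / Kh" "\<eta> \<le> mb / Kb"
    using C mpos Kh(1) Kb(1) by (auto simp: \<eta>_def)
  have near: "cmod (poly h x - poly h \<sigma>) \<le> mh" "cmod (poly b x - poly b \<sigma>) \<le> mb"
    if x: "x \<in> ball \<sigma> \<eta>" for x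
  proof -
    have d: "cmod (x - \<sigma>) \<le> \<eta>" "x \<in> cball \<sigma> 1" using x \<eta>(2) by (auto simp: dist_norm norm_minus_commute)
    have "cmod (poly h x - poly h \<sigma>) \<le> Kh * cmod (x - \<sigma>)" by (rule Kh(2)) (use d in auto)
    also have "\<dots> \<le> Kh * (mh / Kh)" using d \<eta>(4) Kh(1) by (intro mult_left_mono) auto
    finally show "cmod (poly h x - poly h \<sigma>) \<le> mh" using Kh(1) by simp
    have "cmod (poly b x - poly b \<sigma>) \<le> Kb * cmod (x - \<sigma>)" by (rule Kb(2)) (use d in auto)
    also have "\<dots> \<le> Kb * (mb / Kb)" using d \<eta>(5) Kb(1) by (intro mult_left_mono) auto
    finally show "cmod (poly b x - poly b \<sigma>) \<le> mb" using Kb(1) by simp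
  qed
  have hb: "mh \<le> cmod (poly h x)" "cmod (poly h x) \<le> 3 * mh" "mb \<le> cmod (poly b x)" "cmod (poly b x) \<le> 3 * mb"
    if x: "x \<in> ball \<sigma> \<eta>" for x
    using near[OF x] norm_triangle_ineq2[of "poly h \<sigma>" "poly h x"] norm_triangle_ineq2[of "poly h x" "poly h \<sigma>"]
      norm_triangle_ineq2[of "poly b \<sigma>" "poly b x"] norm_triangle_ineq2[of "poly b x" "poly b \<sigma>"]
    by (auto simp: mh_def mb_def norm_minus_commute)
  have main: "\<epsilon> * cmod (y - \<sigma>) \<le> cmod (x - y) \<and> poly (pderiv f) \<sigma> = 0"
    if xy: "x \<in> ball \<sigma> \<eta>" "y \<in> ball \<sigma> \<eta>" "x \<noteq> y" "y \<noteq> \<sigma>" "poly f x * poly b y = poly f y * poly b x" for x y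
  proof -
    define u v where "u = x - \<sigma>" and "v = y - \<sigma>"
    have v0: "v \<noteq> 0" "cmod v < \<eta>" "u \<noteq> v" using xy by (auto simp: u_def v_def dist_norm norm_minus_commute)
    have cb: "x \<in> cball \<sigma> 1" "y \<in> cball \<sigma> 1" using xy(1,2) \<eta>(2) by auto
    define E where "E = poly h y * poly b x - poly h x * poly b y"
    have "E = poly h y * (poly b x - poly b y) + poly b y * (poly h y - poly h x)"
      by (simp add: E_def algebra_simps)
    then have "cmod E \<le> cmod (poly h y) * cmod (poly b x - poly b y) + cmod (poly b y) * cmod (poly h y - poly h x)"
      using norm_triangle_ineq norm_mult by metis
    also have "\<dots> \<le> 3 * mh * (Kb * cmod (x - y)) + 3 * mb * (Kh * cmod (y - x))"
      by (intro add_mono mult_mono hb xy Kb(2) Kh(2) cb) (use mpos in auto)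
    finally have E: "cmod E \<le> (3 * mh * Kb + 3 * mb * Kh) * cmod (u - v)"
      by (simp add: u_def v_def norm_minus_commute algebra_simps)
    have "(u ^ n - v ^ n) * (poly h x * poly b y) = v ^ n * E"
      using xy(5) by (simp add: fx u_def v_def E_def algebra_simps)
    then have "cmod (u ^ n - v ^ n) * (cmod (poly h x) * cmod (poly b y)) = cmod v ^ n * cmod E"
      by (metis norm_mult norm_power)
    moreover have "u ^ n - v ^ n = v ^ (n - 1) * (u - v) * (\<Sum>i<n. (u / v) ^ i)"
    proof -
      have "(u / v) ^ n - 1 ^ n = (u / v - 1) * (\<Sum>i<n. 1 ^ (n - Suc i) * (u / v) ^ i)"
        by (rule power_diff_sumr2)
      then have "(u / v) ^ n - 1 = (u / v - 1) * (\<Sum>i<n. (u / v) ^ i)" by simp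
      moreover have "v ^ n = v * v ^ (n - 1)" using n0 by (cases n) auto
      moreover have "v ^ n * (u / v) ^ n = u ^ n" "v * (u / v - 1) = u - v"
        using v0(1) by (simp_all add: power_divide right_diff_distrib)
      moreover have "un - vn = vm * (u - v) * S" if "R - 1 = t * S" "vn = v * vm" "vn * R = un" "v * t = u - v"
        for un vn vm R t S
        using that by algebra
      ultimately show ?thesis by blast
    qed
    ultimately have "cmod v ^ (n - 1) * cmod (u - v) * cmod (\<Sum>i<n. (u / v) ^ i) * (cmod (poly h x) * cmod (poly b y)) = cmod v ^ n * cmod E"
      by (simp add: norm_mult norm_power)
    also have "\<dots> \<le> cmod v ^ n * ((3 * mh * Kb + 3 * mb * Kh) * cmod (u - v))"
      by (intro mult_left_mono E) simp
    also have "cmod v ^ n = cmod v ^ (n - 1) * cmod v" using n0 by (cases n) auto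
    finally have "(cmod v ^ (n - 1) * cmod (u - v)) * (cmod (\<Sum>i<n. (u / v) ^ i) * (cmod (poly h x) * cmod (poly b y)))
        \<le> (cmod v ^ (n - 1) * cmod (u - v)) * (cmod v * (3 * mh * Kb + 3 * mb * Kh))"
      by (simp add: mult_ac)
    then have "cmod (\<Sum>i<n. (u / v) ^ i) * (cmod (poly h x) * cmod (poly b y)) \<le> cmod v * (3 * mh * Kb + 3 * mb * Kh)"
      by (rule mult_left_le_imp_le) (use v0 in simp)
    moreover have "cmod (\<Sum>i<n. (u / v) ^ i) * (mh * mb) \<le> cmod (\<Sum>i<n. (u / v) ^ i) * (cmod (poly h x) * cmod (poly b y))"
      by (intro mult_left_mono mult_mono hb xy) (use mpos in auto)
    ultimately have "cmod (\<Sum>i<n. (u / v) ^ i) \<le> cmod v * C"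
      unfolding C_def using mpos by (simp add: field_simps)
    also have "\<dots> \<le> 1 / (2 * C) * C" using v0 \<eta>(3) C by (intro mult_right_mono) auto
    finally have half: "cmod (\<Sum>i<n. (u / v) ^ i) \<le> 1 / 2" using C by simp
    have "n \<noteq> 1" using half by auto
    have "u / v \<noteq> 1" using v0 by simp
    have "\<not> dist (u / v) 1 < \<epsilon>"
    proof
      assume "dist (u / v) 1 < \<epsilon>"
      from \<epsilon>(2)[OF \<open>u / v \<noteq> 1\<close> this] half show False by linarith
    qed
    then have "\<epsilon> \<le> cmod ((u - v) / v)" using v0(1) by (simp add: dist_norm diff_divide_distrib)
    then have "\<epsilon> * cmod v \<le> cmod (u - v)" using v0(1) by (simp add: norm_divide field_simps)
    then show ?thesis using simple[OF \<open>n \<noteq> 1\<close>] by (simp add: u_def v_def)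
  qed
  show ?thesis
    using \<eta>(1) \<epsilon>(1) main by blast
qed

text \<open>The points of the fibre of \<open>p\<close> converge to those of \<open>p0\<close>, because the leading coefficient does
  not vanish at \<open>p0\<close>.\<close>

lemma fibre_near:
  fixes a b :: "complex poly"
  assumes d: "1 \<le> d" and deg: "degree a \<le> d" "degree b \<le> d" and lead: "degree (fibre_poly a b p0) = d" and \<eta>: "0 < \<eta>"
  shows "\<forall>\<^sub>F p in nhds p0. \<forall>x\<in>fibre a b p. \<exists>\<sigma>\<in>fibre a b p0. dist x \<sigma> < \<eta>"
proof -
  let ?f = "fibre_poly a b p0"
  obtain root where root: "smult (lead_coeff ?f) (\<Prod>i<degree ?f. [:- root i, 1:]) = ?f"
    using complex_poly_decompose' by blast
  define c where "c = lead_coeff ?f"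
  have c0: "c \<noteq> 0" using lead d by (metis c_def degree_0 leading_coeff_0_iff not_one_le_zero)
  have fx: "poly ?f x = c * (\<Prod>i<d. x - root i)" for x
    by (subst root[symmetric]) (simp add: lead c_def poly_prod add.commute del: poly_add)
  have rt: "root i \<in> fibre a b p0" if "i < d" for i
  proof -
    have "(\<Prod>j<d. root i - root j) = 0" by (rule prod_zero) (use that in auto)
    then show ?thesis unfolding fibre_def mem_Collect_eq fx by simp
  qed
  define K where "K = (\<Sum>j\<le>d. cmod (coeff b j)) + 1"
  have K: "0 < K" unfolding K_def by (simp add: add_nonneg_pos sum_nonneg)
  have bK: "cmod (poly b x) \<le> K * (1 + cmod x) ^ d" for x
  proof -
    have "cmod (poly b x) \<le> (\<Sum>j\<le>d. cmod (coeff b j * x ^ j))"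
      unfolding poly_sum_upto[OF deg(2)] by (rule norm_sum)
    also have "\<dots> \<le> (\<Sum>j\<le>d. cmod (coeff b j) * (1 + cmod x) ^ d)"
    proof (rule sum_mono)
      fix j assume "j \<in> {..d}"
      have "cmod x ^ j \<le> (1 + cmod x) ^ j" by (intro power_mono) auto
      also have "\<dots> \<le> (1 + cmod x) ^ d" using \<open>j \<in> {..d}\<close> by (intro power_increasing) auto
      finally show "cmod (coeff b j * x ^ j) \<le> cmod (coeff b j) * (1 + cmod x) ^ d"
        by (simp add: norm_mult norm_power mult_left_mono)
    qed
    also have "\<dots> \<le> K * (1 + cmod x) ^ d"
      unfolding sum_distrib_right[symmetric] K_def by (intro mult_right_mono) auto
    finally show ?thesis .
  qed
  define k where "k i = \<eta> / (1 + cmod (root i) + \<eta>)" for i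
  have kpos: "0 < k i" for i using \<eta> by (auto simp: k_def intro!: divide_pos_pos add_nonneg_pos)
  define \<delta> where "\<delta> = cmod c * (\<Prod>i<d. k i) / K"
  have \<delta>: "0 < \<delta>" unfolding \<delta>_def using c0 K kpos by (intro divide_pos_pos mult_pos_pos prod_pos) auto
  have "\<exists>\<sigma>\<in>fibre a b p0. dist x \<sigma> < \<eta>" if p: "dist p p0 < \<delta>" and x: "x \<in> fibre a b p" for p x
  proof (rule ccontr)
    assume "\<not> ?thesis"
    then have far: "\<eta> \<le> cmod (x - root i)" if "i < d" for i using rt[OF that] by (force simp: dist_norm)
    have fac: "k i * (1 + cmod x) \<le> cmod (x - root i)" if i: "i < d" for i
    proof -
      have "1 + cmod x \<le> 1 + cmod (root i) + cmod (x - root i)"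
        using norm_triangle_ineq[of "root i" "x - root i"] by simp
      then have "\<eta> * (1 + cmod x) \<le> \<eta> * (1 + cmod (root i)) + \<eta> * cmod (x - root i)"
        using \<eta> by (metis distrib_left less_imp_le mult_left_mono)
      also have "\<eta> * (1 + cmod (root i)) \<le> cmod (x - root i) * (1 + cmod (root i))"
        by (intro mult_right_mono far[OF i]) simp
      finally have "\<eta> * (1 + cmod x) \<le> cmod (x - root i) * (1 + cmod (root i) + \<eta>)"
        by (simp add: algebra_simps)
      then show ?thesis using \<eta> by (simp add: k_def pos_divide_le_eq add_nonneg_pos)
    qed
    have "cmod c * ((\<Prod>i<d. k i) * (1 + cmod x) ^ d) = cmod c * (\<Prod>i<d. k i * (1 + cmod x))"
      by (simp add: prod.distrib)
    also have "\<dots> \<le> cmod c * (\<Prod>i<d. cmod (x - root i))"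
      by (intro mult_left_mono prod_mono conjI fac mult_nonneg_nonneg less_imp_le[OF kpos]) auto
    also have "\<dots> = cmod (poly ?f x)" unfolding fx by (simp add: norm_mult prod_norm)
    also have "poly ?f x = - (p - p0) * poly b x"
      using x by (simp add: fibre_def algebra_simps add_eq_0_iff)
    also have "cmod \<dots> \<le> dist p p0 * (K * (1 + cmod x) ^ d)"
      using bK[of x] by (simp add: norm_mult dist_norm norm_minus_commute mult_left_mono)
    also have "\<dots> < \<delta> * (K * (1 + cmod x) ^ d)"
      using p K by (intro mult_strict_right_mono mult_pos_pos zero_less_power add_pos_nonneg) auto
    also have "\<dots> = cmod c * ((\<Prod>i<d. k i) * (1 + cmod x) ^ d)"
      using K by (simp add: \<delta>_def)
    finally show False by simp
  qed
  then show ?thesis using \<delta> unfolding eventually_nhds_metric by blast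
qed

text \<open>Near a point \<open>\<sigma>\<close> of multiplicity \<open>n\<close> of the fibre over \<open>p0\<close>, the difference \<open>p - p0\<close> is comparable
  to \<open>(x - \<sigma>)\<^sup>n\<close>, so that \<open>(p - p0) dx/dp\<close> is comparable to \<open>x - \<sigma>\<close>.\<close>

lemma fibre_velocity_bound:
  fixes a b :: "complex poly"
  assumes f: "fibre_poly a b p0 \<noteq> 0" "\<sigma> \<in> fibre a b p0" and b: "poly b \<sigma> \<noteq> 0" and \<epsilon>: "0 < \<epsilon>"
  shows "\<exists>\<eta>>0. \<forall>p x. p \<noteq> p0 \<longrightarrow> x \<in> fibre a b p \<longrightarrow> dist x \<sigma> < \<eta> \<longrightarrow>
    cmod ((p - p0) * fibre_velocity a b p x) < \<epsilon>"
proof -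
  let ?f = "fibre_poly a b p0"
  define n where "n = order \<sigma> ?f"
  obtain h where h: "?f = [:- \<sigma>, 1:] ^ n * h" "\<not> [:- \<sigma>, 1:] dvd h"
    using order_decomp[OF f(1), of \<sigma>] unfolding n_def by blast
  have "poly ?f \<sigma> = 0" using f(2) by (simp add: fibre_def)
  then have n0: "n \<noteq> 0" using f(1) by (simp only: n_def order_root) simp
  obtain k where k: "n = Suc k" using n0 not0_implies_Suc by blast
  have h0: "poly h \<sigma> \<noteq> 0" using h(2) by (simp add: poly_eq_0_iff_dvd)
  have fx: "poly ?f x = (x - \<sigma>) ^ n * poly h x" for x by (subst h(1)) simp
  have f'x: "poly (pderiv ?f) x = (x - \<sigma>) ^ k * (of_nat n * poly h x + (x - \<sigma>) * poly (pderiv h) x)" for x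
    by (subst h(1)) (simp add: k pderiv_mult pderiv_power_Suc pderiv_pCons algebra_simps del: power_Suc, simp add: algebra_simps)
  define D where "D x = (of_nat n * poly h x + (x - \<sigma>) * poly (pderiv h) x) * poly b x - (x - \<sigma>) * poly h x * poly (pderiv b) x" for x
  have "((\<lambda>x. (x - \<sigma>) * poly h x * poly b x / D x) \<longlongrightarrow> (\<sigma> - \<sigma>) * poly h \<sigma> * poly b \<sigma> / D \<sigma>) (at \<sigma>)"
    unfolding D_def using h0 b n0 by (intro tendsto_intros) simp
  then have "((\<lambda>x. (x - \<sigma>) * poly h x * poly b x / D x) \<longlongrightarrow> 0) (at \<sigma>)" by simp
  from tendstoD[OF this \<epsilon>] obtain \<eta> where \<eta>: "\<eta> > 0"
    "\<And>x. x \<noteq> \<sigma> \<Longrightarrow> dist x \<sigma> < \<eta> \<Longrightarrow> cmod ((x - \<sigma>) * poly h x * poly b x / D x) < \<epsilon>"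
    unfolding eventually_at by auto
  have "isCont (poly b) \<sigma>" by simp
  then have "\<forall>\<^sub>F x in at \<sigma>. poly b x \<noteq> 0" using b unfolding isCont_def by (rule tendsto_imp_eventually_ne)
  then obtain \<eta>' where \<eta>': "\<eta>' > 0" "\<And>x. x \<noteq> \<sigma> \<Longrightarrow> dist x \<sigma> < \<eta>' \<Longrightarrow> poly b x \<noteq> 0"
    unfolding eventually_at by auto
  have "cmod ((p - p0) * fibre_velocity a b p x) < \<epsilon>"
    if p: "p \<noteq> p0" "x \<in> fibre a b p" "dist x \<sigma> < min \<eta> \<eta>'" for p x
  proof -
    have fp: "poly ?f x = - (p - p0) * poly b x"
      using p(2) by (simp add: fibre_def algebra_simps add_eq_0_iff)
    have x\<sigma>: "x \<noteq> \<sigma>"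
    proof
      assume "x = \<sigma>"
      then show False using fp \<open>poly ?f \<sigma> = 0\<close> p(1) b by simp
    qed
    have bx: "poly b x \<noteq> 0" using \<eta>'(2)[OF x\<sigma>] p(3) by simp
    have pp: "p - p0 = - poly ?f x / poly b x" unfolding fp using bx by simp
    have "poly (pderiv (fibre_poly a b p)) x = poly (pderiv ?f) x + (p - p0) * poly (pderiv b) x"
      by (simp add: pderiv_add pderiv_smult algebra_simps)
    moreover have "(p - p0) * poly b x = - poly ?f x" by (simp only: fp) (simp add: algebra_simps)
    moreover have "A * B = F' * B - F * B'" if "A = F' + q * B'" "q * B = - F" for A B B' F F' q :: complex
      using that by algebra
    ultimately have "poly (pderiv (fibre_poly a b p)) x * poly b x = poly (pderiv ?f) x * poly b x - poly ?f x * poly (pderiv b) x"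
      by blast
    also have "\<dots> = (x - \<sigma>) ^ k * D x"
      unfolding fx f'x D_def k by (simp add: algebra_simps)
    finally have den: "poly (pderiv (fibre_poly a b p)) x = (x - \<sigma>) ^ k * D x / poly b x"
      using bx by (simp add: field_simps)
    have alg: "- F / B * (- B / (E / B)) = F * B / E" if "B \<noteq> 0" for B E F :: complex using that by simp
    have "(p - p0) * fibre_velocity a b p x = poly ?f x * poly b x / ((x - \<sigma>) ^ k * D x)"
      unfolding fibre_velocity_def den pp by (rule alg[OF bx])
    also have "\<dots> = (x - \<sigma>) * poly h x * poly b x / D x"
      unfolding fx k using x\<sigma> by simp
    finally show ?thesis using \<eta>(2)[OF x\<sigma>] p(3) by simp
  qed
  then show ?thesis using \<eta>(1) \<eta>'(1) by (intro exI[of _ "min \<eta> \<eta>'"]) auto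
qed

text \<open>Over a point \<open>p0\<close> whose critical points lie in the direction \<open>p0\<close> itself, the singularity of the
  total height is weaker than a simple pole: if \<open>x\<close>, \<open>y\<close> approach the same critical point, so does
  \<open>p\<close>, and the factors \<open>p - y\<close> in the numerators compensate for the factors \<open>x - y\<close> in the
  denominators.\<close>

lemma radial_limit:
  fixes a b :: "complex poly"
  assumes d: "1 \<le> d" and deg: "degree a \<le> d" "degree b \<le> d"
    and coprime: "\<And>s. poly b s = 0 \<Longrightarrow> poly a s \<noteq> 0"
    and lead: "degree (fibre_poly a b p0) = d"
    and radial: "\<And>s. poly (fibre_poly a b p0) s = 0 \<Longrightarrow> poly (pderiv (fibre_poly a b p0)) s = 0 \<Longrightarrow> s = p0"
    and reg: "\<forall>\<^sub>F p in at p0. regular_value d a b p"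
  shows "((\<lambda>p. (p - p0) * total_height a b p) \<longlongrightarrow> 0) (at p0)"
proof -
  let ?f = "fibre_poly a b p0" and ?F = "fibre a b p0"
  have f0: "?f \<noteq> 0" using lead d by auto
  have fin: "finite ?F" unfolding fibre_def using f0 by (rule poly_roots_finite)
  have b0: "poly b \<sigma> \<noteq> 0" if "\<sigma> \<in> ?F" for \<sigma> using that coprime[of \<sigma>] by (auto simp: fibre_def)
  have fp: "poly ?f x = - (p - p0) * poly b x" if "x \<in> fibre a b p" for p x
    using that by (simp add: fibre_def algebra_simps add_eq_0_iff)
  define P where "P \<sigma> \<sigma>' C \<longleftrightarrow> (\<forall>p x y. p \<noteq> p0 \<longrightarrow> dist p p0 < 1 \<longrightarrow> x \<in> fibre a b p \<longrightarrow> y \<in> fibre a b p \<longrightarrow> x \<noteq> y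
    \<longrightarrow> dist x \<sigma> < 1 / C \<longrightarrow> dist y \<sigma>' < 1 / C \<longrightarrow> cmod (p - y) \<le> C * cmod (x - y))" for \<sigma> \<sigma>' and C :: real
  have PI: "\<forall>\<^sub>F C in at_top. P \<sigma> \<sigma>' C"
    if "0 < \<eta>" "\<And>p x y. p \<noteq> p0 \<Longrightarrow> dist p p0 < 1 \<Longrightarrow> x \<in> fibre a b p \<Longrightarrow> y \<in> fibre a b p \<Longrightarrow> x \<noteq> y
      \<Longrightarrow> dist x \<sigma> < \<eta> \<Longrightarrow> dist y \<sigma>' < \<eta> \<Longrightarrow> cmod (p - y) \<le> K * cmod (x - y)" for \<eta> K :: real and \<sigma> \<sigma>'
    using eventually_ge_at_top[of "max K (1 / \<eta>)"]
  proof (rule eventually_mono)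
    fix C :: real assume C: "max K (1 / \<eta>) \<le> C"
    then have "0 < C" using that(1) by (meson divide_pos_pos less_le_trans max.bounded_iff zero_less_one)
    then have C1: "1 / C \<le> \<eta>" using C that(1) by (simp add: field_simps)
    show "P \<sigma> \<sigma>' C" unfolding P_def
    proof (intro allI impI)
      fix p x y assume h: "p \<noteq> p0" "dist p p0 < 1" "x \<in> fibre a b p" "y \<in> fibre a b p" "x \<noteq> y" "dist x \<sigma> < 1 / C" "dist y \<sigma>' < 1 / C"
      have "cmod (p - y) \<le> K * cmod (x - y)" using that(2)[OF h(1-5)] h(6,7) C1 by simp
      also have "\<dots> \<le> C * cmod (x - y)" using C by (intro mult_right_mono) auto
      finally show "cmod (p - y) \<le> C * cmod (x - y)" .
    qed
  qed
  have P: "\<forall>\<^sub>F C in at_top. P \<sigma> \<sigma>' C" if \<sigma>: "\<sigma> \<in> ?F" "\<sigma>' \<in> ?F" for \<sigma> \<sigma>'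
  proof (cases "\<sigma> = \<sigma>'")
    case False
    define \<delta> where "\<delta> = dist \<sigma> \<sigma>'"
    have \<delta>: "0 < \<delta>" using False by (simp add: \<delta>_def)
    define B where "B = 1 + dist p0 \<sigma>' + \<delta> / 4"
    show ?thesis
    proof (rule PI[where \<eta>="\<delta> / 4" and K="B / (\<delta> / 2)"])
      show "0 < \<delta> / 4" using \<delta> by simp
      fix p x y assume h: "dist p p0 < 1" "dist x \<sigma> < \<delta> / 4" "dist y \<sigma>' < \<delta> / 4"
      have "dist p y \<le> B" using h dist_triangle[of p y p0] dist_triangle[of p0 y \<sigma>'] by (simp add: B_def dist_commute)
      moreover have "\<delta> / 2 \<le> dist x y"
        using h dist_triangle[of \<sigma> \<sigma>' x] dist_triangle[of x \<sigma>' y] by (simp add: \<delta>_def dist_commute)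
      moreover have "0 \<le> B" using \<delta> by (simp add: B_def)
      ultimately have "dist p y * (\<delta> / 2) \<le> B * dist x y" using \<delta> by (intro mult_mono) auto
      then show "cmod (p - y) \<le> B / (\<delta> / 2) * cmod (x - y)"
        using \<delta> by (simp add: dist_norm field_simps)
    qed
  next
    case True
    have z: "poly ?f \<sigma> = 0" using \<sigma>(1) by (simp add: fibre_def)
    obtain \<eta> \<epsilon> where \<eta>: "0 < \<eta>" "0 < \<epsilon>" "\<And>x y. x \<in> ball \<sigma> \<eta> \<Longrightarrow> y \<in> ball \<sigma> \<eta> \<Longrightarrow> x \<noteq> y \<Longrightarrow> y \<noteq> \<sigma> \<Longrightarrow>
      poly ?f x * poly b y = poly ?f y * poly b x \<Longrightarrow> \<epsilon> * cmod (y - \<sigma>) \<le> cmod (x - y) \<and> poly (pderiv ?f) \<sigma> = 0"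
      using fibre_separation[OF f0 z b0[OF \<sigma>(1)]] by blast
    obtain K where K: "K > 0" "\<And>x y. x \<in> cball \<sigma> 1 \<Longrightarrow> y \<in> cball \<sigma> 1 \<Longrightarrow> cmod (poly ?f x - poly ?f y) \<le> K * cmod (x - y)"
      using poly_lipschitz_cball[of \<sigma> ?f] by blast
    define \<beta> where "\<beta> = cmod (poly b \<sigma>) / 2"
    have \<beta>: "0 < \<beta>" using b0[OF \<sigma>(1)] by (simp add: \<beta>_def)
    have "isCont (\<lambda>x. cmod (poly b x)) \<sigma>" by simp
    then have "((\<lambda>x. cmod (poly b x)) \<longlongrightarrow> cmod (poly b \<sigma>)) (nhds \<sigma>)" by (simp only: isCont_def tendsto_at_iff_tendsto_nhds[of "\<lambda>x. cmod (poly b x)" \<sigma>])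
    moreover have "\<beta> < cmod (poly b \<sigma>)" using \<beta> by (simp add: \<beta>_def)
    ultimately have "\<forall>\<^sub>F x in nhds \<sigma>. \<beta> < cmod (poly b x)" by (rule order_tendstoD)
    then obtain \<eta>' where \<eta>': "0 < \<eta>'" "\<And>x. dist x \<sigma> < \<eta>' \<Longrightarrow> \<beta> < cmod (poly b x)"
      unfolding eventually_nhds_metric by blast
    show ?thesis
    proof (rule PI[where \<eta>="min (min \<eta> \<eta>') 1" and K="(K / \<beta> + 1) / \<epsilon>"])
      show "0 < min (min \<eta> \<eta>') 1" using \<eta> \<eta>' by simp
      fix p x y assume h: "p \<noteq> p0" "x \<in> fibre a b p" "y \<in> fibre a b p" "x \<noteq> y"
        "dist x \<sigma> < min (min \<eta> \<eta>') 1" "dist y \<sigma>' < min (min \<eta> \<eta>') 1"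
      have y\<sigma>: "y \<noteq> \<sigma>"
      proof
        assume "y = \<sigma>"
        then show False using fp[OF h(3)] z b0[OF \<sigma>(1)] h(1) by simp
      qed
      have sep: "\<epsilon> * cmod (y - \<sigma>) \<le> cmod (x - y)" "poly (pderiv ?f) \<sigma> = 0"
        using \<eta>(3)[of x y] h True y\<sigma> fp[OF h(2)] fp[OF h(3)] by (simp_all add: dist_commute)
      have \<sigma>p: "\<sigma> = p0" using radial[OF z sep(2)] .
      have "cmod (p - p0) * \<beta> \<le> cmod (p - p0) * cmod (poly b y)"
        using \<eta>'(2)[of y] h True by (intro mult_left_mono) auto
      also have "\<dots> = cmod (poly ?f y - poly ?f \<sigma>)" unfolding fp[OF h(3)] z by (simp add: norm_mult norm_minus_commute)
      also have "\<dots> \<le> K * cmod (y - \<sigma>)" using K(2)[of y \<sigma>] h True by (simp add: dist_commute)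
      finally have "cmod (p - p0) \<le> K / \<beta> * cmod (y - \<sigma>)" using \<beta> by (simp add: field_simps)
      then have "cmod (p - y) \<le> (K / \<beta> + 1) * cmod (y - \<sigma>)"
        using norm_triangle_ineq[of "p - p0" "p0 - y"] by (simp add: \<sigma>p norm_minus_commute algebra_simps)
      also have "\<dots> \<le> (K / \<beta> + 1) * (cmod (x - y) / \<epsilon>)"
        using sep(1) \<eta>(2) \<beta> K(1) by (intro mult_left_mono) (auto simp: field_simps)
      finally show "cmod (p - y) \<le> (K / \<beta> + 1) / \<epsilon> * cmod (x - y)" by simp
    qed
  qed
  have "\<forall>\<^sub>F C in at_top. \<forall>\<sigma>\<in>?F. \<forall>\<sigma>'\<in>?F. P \<sigma> \<sigma>' C"
    by (intro eventually_ball_finite fin ballI P)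
  then have "\<forall>\<^sub>F C in at_top. 0 < C \<and> (\<forall>\<sigma>\<in>?F. \<forall>\<sigma>'\<in>?F. P \<sigma> \<sigma>' C)"
    using eventually_gt_at_top[of 0] by (rule eventually_conj[rotated])
  then obtain C :: real where C: "0 < C" "\<And>\<sigma> \<sigma>'. \<sigma> \<in> ?F \<Longrightarrow> \<sigma>' \<in> ?F \<Longrightarrow> P \<sigma> \<sigma>' C"
    using eventually_happens'[OF trivial_limit_at_top_linorder] by blast
  have nearC: "\<forall>\<^sub>F p in at p0. \<forall>x\<in>fibre a b p. \<exists>\<sigma>\<in>?F. dist x \<sigma> < 1 / C"
    using fibre_near[OF d deg lead, of "1 / C"] C(1) by (simp add: eventually_nhds_conv_at)
  have ratio: "\<forall>\<^sub>F p in at p0. \<forall>x\<in>fibre a b p. \<forall>y\<in>fibre a b p. x \<noteq> y \<longrightarrow> cmod (p - y) \<le> C * cmod (x - y)"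
    using nearC eventually_at_ball'[OF zero_less_one, of p0 UNIV]
  proof eventually_elim
    case (elim p)
    show ?case
    proof (intro ballI impI)
      fix x y assume h: "x \<in> fibre a b p" "y \<in> fibre a b p" "x \<noteq> y"
      obtain \<sigma> where \<sigma>: "\<sigma> \<in> ?F" "dist x \<sigma> < 1 / C" using elim(1) h(1) by blast
      obtain \<sigma>' where \<sigma>': "\<sigma>' \<in> ?F" "dist y \<sigma>' < 1 / C" using elim(1) h(2) by blast
      show "cmod (p - y) \<le> C * cmod (x - y)"
        using C(2)[OF \<sigma>(1) \<sigma>'(1)] elim(2) h \<sigma>(2) \<sigma>'(2) by (simp add: P_def dist_commute)
    qed
  qed
  have velocity: "\<forall>\<^sub>F p in at p0. \<forall>x\<in>fibre a b p. cmod ((p - p0) * fibre_velocity a b p x) < \<epsilon>" if \<epsilon>: "0 < \<epsilon>" for \<epsilon>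
  proof -
    define Q where "Q \<sigma> K \<longleftrightarrow> (\<forall>p x. p \<noteq> p0 \<longrightarrow> x \<in> fibre a b p \<longrightarrow> dist x \<sigma> < 1 / K \<longrightarrow>
      cmod ((p - p0) * fibre_velocity a b p x) < \<epsilon>)" for \<sigma> and K :: real
    have "\<forall>\<^sub>F K in at_top. Q \<sigma> K" if \<sigma>: "\<sigma> \<in> ?F" for \<sigma>
    proof -
      obtain \<eta> where \<eta>: "0 < \<eta>" "\<And>p x. p \<noteq> p0 \<Longrightarrow> x \<in> fibre a b p \<Longrightarrow> dist x \<sigma> < \<eta> \<Longrightarrow>
          cmod ((p - p0) * fibre_velocity a b p x) < \<epsilon>"
        using fibre_velocity_bound[OF f0 \<sigma> b0[OF \<sigma>] \<epsilon>] by blast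
      show ?thesis using eventually_ge_at_top[of "1 / \<eta>"]
      proof (rule eventually_mono)
        fix K :: real assume K: "1 / \<eta> \<le> K"
        then have "0 < K" using \<eta>(1) by (meson divide_pos_pos less_le_trans zero_less_one)
        then have "1 / K \<le> \<eta>" using K \<eta>(1) by (simp add: field_simps)
        then show "Q \<sigma> K" using \<eta>(2) by (simp add: Q_def)
      qed
    qed
    then have "\<forall>\<^sub>F K in at_top. \<forall>\<sigma>\<in>?F. Q \<sigma> K" by (intro eventually_ball_finite fin ballI)
    then have "\<forall>\<^sub>F K in at_top. 0 < K \<and> (\<forall>\<sigma>\<in>?F. Q \<sigma> K)"
      using eventually_gt_at_top[of 0] by (rule eventually_conj[rotated])
    then obtain K :: real where K: "0 < K" "\<And>\<sigma>. \<sigma> \<in> ?F \<Longrightarrow> Q \<sigma> K"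
      using eventually_happens'[OF trivial_limit_at_top_linorder] by blast
    have "\<forall>\<^sub>F p in at p0. \<forall>x\<in>fibre a b p. \<exists>\<sigma>\<in>?F. dist x \<sigma> < 1 / K"
      using fibre_near[OF d deg lead, of "1 / K"] K(1) by (simp add: eventually_nhds_conv_at)
    moreover have "\<forall>\<^sub>F p in at p0. p \<noteq> p0" by (simp add: eventually_at_filter)
    ultimately show ?thesis
    proof eventually_elim
      case (elim p)
      then show ?case using K(2) unfolding Q_def by blast
    qed
  qed
  show ?thesis
  proof (rule tendstoI)
    fix e :: real assume e: "0 < e"
    define D where "D = real d ^ 3"
    have D: "0 < D" using d by (simp add: D_def)
    define \<epsilon> where "\<epsilon> = e / (D * C ^ 2)"
    have \<epsilon>: "0 < \<epsilon>" using e D C(1) by (simp add: \<epsilon>_def)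
    then have \<epsilon>C: "0 < \<epsilon> * C ^ 2" using C(1) by simp
    show "\<forall>\<^sub>F p in at p0. dist ((p - p0) * total_height a b p) 0 < e"
      using ratio velocity[OF \<epsilon>] reg eventually_at_ball'[OF \<epsilon>C, of p0 UNIV]
    proof eventually_elim
      case (elim p)
      let ?v = "fibre_velocity a b p"
      have card: "card (fibre a b p) = d" by (rule regular_valueD[OF d elim(3)])
      then have finp: "finite (fibre a b p)" using d card_ge_0_finite by force
      have bound: "cmod ((p - p0) * ?v x * (((p - y) / (x - y)) * ((p - w) / (x - w)))) \<le> \<epsilon> * (C * C)"
        if "x \<in> fibre a b p" "y \<in> fibre a b p" "w \<in> fibre a b p" "x \<noteq> y" "x \<noteq> w" for x y w
      proof -
        have q: "cmod ((p - y) / (x - y)) \<le> C" if "x \<in> fibre a b p" "y \<in> fibre a b p" "x \<noteq> y" for x y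
          using that elim(1) by (simp add: norm_divide divide_le_eq)
        show ?thesis
          unfolding norm_mult[of _ "_ * _"] norm_mult[of "_ / _"]
          by (intro mult_mono q that mult_nonneg_nonneg norm_ge_zero less_imp_le[OF \<epsilon>] less_imp_le[OF C(1)])
            (use elim(2) that(1) in \<open>simp add: less_imp_le\<close>)
      qed
      have height: "cmod ((p - p0) * fibre_height a b p T) \<le> 4 * (\<epsilon> * C ^ 2)"
        if T: "T \<in> distinct_triples (fibre a b p)" for T
      proof -
        obtain x y w where T': "T = (x, y, w)" by (metis prod_cases3)
        have m: "x \<in> fibre a b p" "y \<in> fibre a b p" "w \<in> fibre a b p" "x \<noteq> y" "y \<noteq> w" "w \<noteq> x"
          using T by (simp_all add: T' distinct_triples_def)
        let ?t1 = "(p - p0) * ?v x * (((p - y) / (x - y)) * ((p - w) / (x - w)))"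
        let ?t2 = "(p - p0) * ?v y * (((p - x) / (y - x)) * ((p - w) / (y - w)))"
        let ?t3 = "(p - p0) * ?v w * (((p - x) / (w - x)) * ((p - y) / (w - y)))"
        have "(p - p0) * fibre_height a b p T = (p - p0) - (?t1 + ?t2 + ?t3)"
        proof -
          have gen: "q * (1 - (A + B + C)) = q - (q * A + q * B + q * C)" for q A B C :: complex
            by (simp add: algebra_simps)
          have e: "q * (v * (Y * Z) / (((p - y) - (p - x)) * ((p - z) - (p - x)))) = q * v * ((Y / (x - y)) * (Z / (x - z)))"
            for q v x y z Y Z :: complex
            by (simp add: mult.assoc)
          show ?thesis by (simp only: T' fibre_height_def interpolate0_def prod.case gen e)
        qed
        note eq = this
        have tri: "cmod (q - (A + B + E)) \<le> 4 * k" if "cmod q \<le> k" "cmod A \<le> k" "cmod B \<le> k" "cmod E \<le> k"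
          for q A B E :: complex and k
          using that norm_triangle_ineq4[of q "A + B + E"] norm_triangle_ineq[of "A + B" E] norm_triangle_ineq[of A B]
          by linarith
        have "cmod (p - p0) \<le> \<epsilon> * (C * C)"
          using elim(4) by (simp add: dist_norm norm_minus_commute power2_eq_square)
        then show ?thesis unfolding eq power2_eq_square
          by (rule tri) (intro bound m not_sym[OF m(4)] not_sym[OF m(5)] not_sym[OF m(6)])+
      qed
      have "distinct_triples (fibre a b p) \<subseteq> fibre a b p \<times> fibre a b p \<times> fibre a b p"
        by (auto simp: distinct_triples_def)
      then have "card (distinct_triples (fibre a b p)) \<le> card (fibre a b p \<times> fibre a b p \<times> fibre a b p)"
        using finp by (intro card_mono finite_cartesian_product)
      also have "\<dots> = d ^ 3" by (simp add: card_cartesian_product card power3_eq_cube)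
      finally have cD: "real (card (distinct_triples (fibre a b p))) \<le> D" unfolding D_def by (metis of_nat_le_iff of_nat_power)
      have "(p - p0) * total_height a b p = (1 / 6) * (\<Sum>T\<in>distinct_triples (fibre a b p). (p - p0) * fibre_height a b p T)"
        by (simp add: total_height_def sum_distrib_left)
      also have "cmod \<dots> \<le> (1 / 6) * (\<Sum>T\<in>distinct_triples (fibre a b p). 4 * (\<epsilon> * C ^ 2))"
        unfolding norm_mult by (intro mult_mono sum_norm_le height) auto
      also have "\<dots> = (2 / 3) * (\<epsilon> * C ^ 2) * real (card (distinct_triples (fibre a b p)))" by simp
      also have "\<dots> \<le> (2 / 3) * (\<epsilon> * C ^ 2) * D" using \<epsilon>C by (intro mult_left_mono cD) simp
      also have "\<dots> = (2 / 3) * e" using D C(1) by (simp add: \<epsilon>_def field_simps)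
      also have "\<dots> < e" using e by simp
      finally show ?case by simp
    qed
  qed
qed

section \<open>The discriminant of the Legendre transform\<close>

text \<open>The factors of a web are pairwise non-collinear, so its zeros in the projective line of tangent
  directions are simple. This is how membership in the discriminant is detected.\<close>

lemma simple_zero:
  assumes k: "2 \<le> k" and d: "decomposes k W N \<theta>" "m \<in> N"
    and \<xi>: "\<xi> \<noteq> 0" "W m \<xi> = 0" and w: "wedge \<xi> \<zeta> \<noteq> 0"
    and D: "((\<lambda>\<tau>. W m (fst \<xi> + \<tau> * fst \<zeta>, snd \<xi> + \<tau> * snd \<zeta>)) has_field_derivative D) (at 0)"
  shows "D \<noteq> 0"
proof -
  define ev where "ev i \<eta> = fst (\<theta> i m) * fst \<eta> + snd (\<theta> i m) * snd \<eta>" for i and \<eta> :: c2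
  have W: "W m \<eta> = (\<Prod>i<k. ev i \<eta>)" for \<eta> unfolding ev_def by (rule decomposesD(3)[OF d])
  obtain i where i: "i < k" "ev i \<xi> = 0" using \<xi>(2) unfolding W by (auto simp: prod_zero_iff)
  have others: "ev j \<xi> \<noteq> 0" if j: "j < k" "j \<noteq> i" for j
  proof
    assume "ev j \<xi> = 0"
    then have "fst \<xi> * wedge (\<theta> i m) (\<theta> j m) = 0" "snd \<xi> * wedge (\<theta> i m) (\<theta> j m) = 0"
      using i(2) unfolding ev_def wedge_def by algebra+
    then have "wedge (\<theta> i m) (\<theta> j m) = 0" using \<xi>(1) by (auto simp: prod_eq_iff)
    then show False using decomposesD(2)[OF d i(1) j(1)] j(2) by auto
  qed
  have "ev i \<zeta> \<noteq> 0"
  proof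
    assume "ev i \<zeta> = 0"
    then have "fst (\<theta> i m) * wedge \<xi> \<zeta> = 0" "snd (\<theta> i m) * wedge \<xi> \<zeta> = 0"
      using i(2) unfolding ev_def wedge_def by algebra+
    then have "\<theta> i m = 0" using w by (simp add: prod_eq_iff)
    then show False using decomposes_nonzero[OF k d i(1)] by simp
  qed
  define R where "R \<tau> = (\<Prod>j\<in>{..<k} - {i}. ev j \<xi> + \<tau> * ev j \<zeta>)" for \<tau>
  have Wl: "W m (fst \<xi> + \<tau> * fst \<zeta>, snd \<xi> + \<tau> * snd \<zeta>) = \<tau> * ev i \<zeta> * R \<tau>" for \<tau>
  proof -
    have e: "ev j (fst \<xi> + \<tau> * fst \<zeta>, snd \<xi> + \<tau> * snd \<zeta>) = ev j \<xi> + \<tau> * ev j \<zeta>" for j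
      by (simp add: ev_def algebra_simps)
    have "(\<Prod>j<k. ev j \<xi> + \<tau> * ev j \<zeta>) = (ev i \<xi> + \<tau> * ev i \<zeta>) * R \<tau>"
      unfolding R_def by (rule prod.remove) (use i in auto)
    then show ?thesis unfolding W e using i(2) by simp
  qed
  have "((\<lambda>h. ev i \<zeta> * R h) \<longlongrightarrow> ev i \<zeta> * R 0) (at 0)"
    unfolding R_def by (intro tendsto_intros)
  moreover have "((\<lambda>h. ev i \<zeta> * R h) \<longlongrightarrow> D) (at 0)"
  proof (rule Lim_transform_eventually)
    show "((\<lambda>h. (W m (fst \<xi> + (0 + h) * fst \<zeta>, snd \<xi> + (0 + h) * snd \<zeta>) - W m (fst \<xi> + 0 * fst \<zeta>, snd \<xi> + 0 * snd \<zeta>)) / h) \<longlongrightarrow> D) (at 0)"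
      using D unfolding DERIV_def .
    show "\<forall>\<^sub>F h in at 0. (W m (fst \<xi> + (0 + h) * fst \<zeta>, snd \<xi> + (0 + h) * snd \<zeta>) - W m (fst \<xi> + 0 * fst \<zeta>, snd \<xi> + 0 * snd \<zeta>)) / h = ev i \<zeta> * R h"
      unfolding Wl by (auto simp: eventually_at_filter)
  qed
  ultimately have "D = ev i \<zeta> * R 0" by (rule LIM_unique[symmetric])
  moreover have "R 0 \<noteq> 0" unfolding R_def using others by simp
  ultimately show ?thesis using \<open>ev i \<zeta> \<noteq> 0\<close> by simp
qed

text \<open>A line through the centre, on which \<open>q = 0\<close>, lies in the discriminant because the web degenerates
  there to the \<open>d\<close>-th power of \<open>dq\<close>.\<close>

lemma off_discriminant:
  assumes d: "2 \<le> d" and fol: "foliation d \<Omega>" and nc: "normal_chart d \<Omega> g0 a b" and g: "invertible g"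
  defines "M \<equiv> matrix_inv g ** g0"
  assumes m: "m \<notin> discriminant d (legendre_transform d \<Omega> g)" and L2: "dual_coords M m $ 2 \<noteq> 0"
    and lead: "coeff a d + slope_at M m * coeff b d \<noteq> 0"
  shows "dual_coords M m $ 3 \<noteq> 0" "regular_value d a b (slope_at M m)"
proof -
  let ?L = "dual_coords M m" and ?p = "slope_at M m"
  let ?W = "legendre_transform d \<Omega> g"
  obtain N \<theta> where dec: "decomposes d ?W N \<theta>" "m \<in> N" using m unfolding discriminant_def by blast
  have g0: "invertible g0" and deg: "degree a \<le> d" "degree b \<le> d" using nc by (simp_all add: normal_chart_def)
  have M: "det M \<noteq> 0" unfolding M_def using g g0 by (simp add: det_mul invertible_inverse)
  let ?f = "fibre_poly a b ?p"
  have df: "degree ?f \<le> d" using deg by (intro degree_add_le order.trans[OF degree_smult_le]) auto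
  define c where "c = - ?L$2 / det M ^ (d + 1)"
  define \<kappa>1 \<kappa>2 where "\<kappa>1 = scale2 (?L$2) (dual_grad M 3) - scale2 (?L$3) (dual_grad M 2)"
    and "\<kappa>2 = scale2 (?L$3) (dual_grad M 1) - scale2 (?L$1) (dual_grad M 3)"
  define ev where "ev \<alpha> \<eta> = fst \<alpha> * fst \<eta> + snd \<alpha> * snd \<eta>" for \<alpha> \<eta> :: c2
  have W: "?W m \<xi> = c * bform d ?f (ev \<kappa>1 \<xi>) (ev \<kappa>2 \<xi>)" for \<xi>
  proof -
    have K: "cross ?L (dual_coords_deriv M \<xi>) $ 1 = ev \<kappa>1 \<xi>" "cross ?L (dual_coords_deriv M \<xi>) $ 2 = ev \<kappa>2 \<xi>"
      by (simp_all add: cross_components dual_coords_deriv_grad ev_def \<kappa>1_def \<kappa>2_def algebra_simps)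
    have "det M ^ (d + 1) * ?W m \<xi> = ?L$1 * bform d b (ev \<kappa>1 \<xi>) (ev \<kappa>2 \<xi>) - ?L$2 * bform d a (ev \<kappa>1 \<xi>) (ev \<kappa>2 \<xi>)"
      using legendre_transform_normal[OF fol nc g, of m \<xi>] L2 K unfolding M_def by simp
    also have "\<dots> = - ?L$2 * bform d ?f (ev \<kappa>1 \<xi>) (ev \<kappa>2 \<xi>)"
      unfolding bform_fibre_poly using L2 by (simp add: slope_at_def field_simps)
    finally show ?thesis using M by (simp add: c_def field_simps)
  qed
  show L3: "?L$3 \<noteq> 0"
  proof
    assume L3: "?L$3 = 0"
    define \<alpha> where "\<alpha> = dual_grad M 3"
    define c' where "c' = c * bform d ?f (?L$2) (- ?L$1)"
    have W': "?W m \<xi> = c' * ev \<alpha> \<xi> ^ d" for \<xi>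
    proof -
      have "ev \<kappa>1 \<xi> = ev \<alpha> \<xi> * ?L$2" "ev \<kappa>2 \<xi> = ev \<alpha> \<xi> * (- ?L$1)"
        using L3 by (simp_all add: \<kappa>1_def \<kappa>2_def \<alpha>_def ev_def algebra_simps)
      then show ?thesis unfolding W c'_def by (simp only: bform_scale) simp
    qed
    obtain \<zeta>' where "?W m \<zeta>' \<noteq> 0" using decomposes_nonvanishing[OF d dec] by blast
    then have e: "ev \<alpha> \<zeta>' \<noteq> 0" using W' d by auto
    let ?\<xi> = "(- snd \<alpha>, fst \<alpha>)"
    have "?\<xi> \<noteq> 0" using e by (auto simp: ev_def zero_prod_def)
    moreover have x0: "ev \<alpha> ?\<xi> = 0" by (simp add: ev_def)
    moreover have "?W m ?\<xi> = 0" using d unfolding W' x0 by simp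
    moreover have "wedge ?\<xi> \<zeta>' = - ev \<alpha> \<zeta>'" by (simp add: wedge_def ev_def)
    then have "wedge ?\<xi> \<zeta>' \<noteq> 0" using e by simp
    moreover have "((\<lambda>\<tau>. ?W m (fst ?\<xi> + \<tau> * fst \<zeta>', snd ?\<xi> + \<tau> * snd \<zeta>')) has_field_derivative 0) (at 0)"
    proof -
      have "?W m (fst ?\<xi> + \<tau> * fst \<zeta>', snd ?\<xi> + \<tau> * snd \<zeta>') = c' * (\<tau> * ev \<alpha> \<zeta>') ^ d" for \<tau>
      proof -
        have "ev \<alpha> (fst ?\<xi> + \<tau> * fst \<zeta>', snd ?\<xi> + \<tau> * snd \<zeta>') = \<tau> * ev \<alpha> \<zeta>'"
          by (simp add: ev_def algebra_simps)
        then show ?thesis unfolding W' by simp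
      qed
      moreover have "((\<lambda>\<tau>. c' * (\<tau> * ev \<alpha> \<zeta>') ^ d) has_field_derivative 0) (at 0)"
        using d by (auto intro!: derivative_eq_intros)
      ultimately show ?thesis by simp
    qed
    ultimately show False using simple_zero[OF d dec, of ?\<xi> \<zeta>' 0] by simp
  qed
  have det: "wedge \<kappa>1 \<kappa>2 = - ?L$3 * det M"
    by (simp add: \<kappa>1_def \<kappa>2_def wedge_def dual_grad_def dual_coords_components det_3 algebra_simps)
  define \<Delta> where "\<Delta> = wedge \<kappa>1 \<kappa>2"
  have \<Delta>: "\<Delta> \<noteq> 0" using det L3 M by (simp add: \<Delta>_def)
  have solve: "\<exists>\<xi>. ev \<kappa>1 \<xi> = x \<and> ev \<kappa>2 \<xi> = y" for x y
  proof (intro exI conjI)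
    let ?\<xi> = "((x * snd \<kappa>2 - y * snd \<kappa>1) / \<Delta>, (y * fst \<kappa>1 - x * fst \<kappa>2) / \<Delta>)"
    have "ev \<kappa>1 ?\<xi> * \<Delta> = x * \<Delta>" "ev \<kappa>2 ?\<xi> * \<Delta> = y * \<Delta>"
      using \<Delta> by (simp_all add: ev_def field_simps, simp_all add: \<Delta>_def wedge_def algebra_simps)
    then show "ev \<kappa>1 ?\<xi> = x" "ev \<kappa>2 ?\<xi> = y" using \<Delta> by simp_all
  qed
  have "rsquarefree ?f"
    unfolding rsquarefree_roots
  proof (rule allI, rule notI, elim conjE)
    fix s assume s: "poly ?f s = 0" "poly (pderiv ?f) s = 0"
    obtain \<xi> where \<xi>: "ev \<kappa>1 \<xi> = 1" "ev \<kappa>2 \<xi> = s" using solve by blast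
    obtain \<zeta> where \<zeta>: "ev \<kappa>1 \<zeta> = 0" "ev \<kappa>2 \<zeta> = 1" using solve by blast
    have "\<xi> \<noteq> 0" using \<xi>(1) by (auto simp: ev_def)
    moreover have "?W m \<xi> = 0" unfolding W \<xi> bform_1[OF df] using s(1) by simp
    moreover have "wedge \<xi> \<zeta> \<noteq> 0"
    proof
      assume "wedge \<xi> \<zeta> = 0"
      then have "ev \<kappa>1 \<xi> * ev \<kappa>2 \<zeta> - ev \<kappa>2 \<xi> * ev \<kappa>1 \<zeta> = 0"
        unfolding ev_def wedge_def by algebra
      then show False unfolding \<xi> \<zeta> by simp
    qed
    moreover have "((\<lambda>\<tau>. ?W m (fst \<xi> + \<tau> * fst \<zeta>, snd \<xi> + \<tau> * snd \<zeta>)) has_field_derivative 0) (at 0)"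
    proof -
      have "?W m (fst \<xi> + \<tau> * fst \<zeta>, snd \<xi> + \<tau> * snd \<zeta>) = c * poly ?f (s + \<tau>)" for \<tau>
      proof -
        have "ev \<kappa>1 (fst \<xi> + \<tau> * fst \<zeta>, snd \<xi> + \<tau> * snd \<zeta>) = ev \<kappa>1 \<xi> + \<tau> * ev \<kappa>1 \<zeta>"
          "ev \<kappa>2 (fst \<xi> + \<tau> * fst \<zeta>, snd \<xi> + \<tau> * snd \<zeta>) = ev \<kappa>2 \<xi> + \<tau> * ev \<kappa>2 \<zeta>"
          by (simp_all add: ev_def algebra_simps)
        then show ?thesis unfolding W by (simp only: \<xi> \<zeta> mult_zero_right add_0_right mult_1_right bform_1[OF df])
      qed
      moreover have "((\<lambda>\<tau>. poly ?f (s + \<tau>)) has_field_derivative poly (pderiv ?f) (s + 0) * (0 + 1)) (at 0)"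
        by (rule DERIV_chain2[OF poly_DERIV]) (intro derivative_intros)
      then have "((\<lambda>\<tau>. c * poly ?f (s + \<tau>)) has_field_derivative c * (poly (pderiv ?f) (s + 0) * (0 + 1))) (at 0)"
        by (rule DERIV_cmult)
      then have "((\<lambda>\<tau>. c * poly ?f (s + \<tau>)) has_field_derivative 0) (at 0)"
        using s(2) by (simp only: add_0_right mult_zero_left mult_zero_right)
      ultimately show ?thesis by presburger
    qed
    ultimately show False using simple_zero[OF d dec, of \<xi> \<zeta> 0] by blast
  qed
  then show "regular_value d a b ?p"
    using regular_value_iff[OF _ deg, of ?p] d lead by simp
qed

definition rotation :: "complex \<Rightarrow> complex^3^3" where
  "rotation s = vector [vector [0, 1, 0], vector [- 1, s, 0], vector [0, 0, 1]]"

lemma rotation_components: "(l v* rotation s) $ 1 = - l$2" "(l v* rotation s) $ 2 = l$1 + s * l$2" "(l v* rotation s) $ 3 = l$3"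
  by (simp_all add: vector_matrix_3 rotation_def vector_3 mult.commute)

lemma det_rotation: "det (rotation s) = 1"
  by (simp add: det_3 rotation_def vector_3)

text \<open>A rotation of the affine coordinates makes the slope of a given line finite and keeps the vertical
  direction out of the fibre over this slope; only finitely many values of the parameter fail.\<close>

lemma good_rotation:
  assumes d: "1 \<le> d" and fol: "foliation d \<Omega>" and nc: "normal_chart d \<Omega> g a b" and l: "(l1, l2) \<noteq> (0, 0)"
  shows "\<exists>s a' b'. normal_chart d \<Omega> (g ** rotation s) a' b' \<and> l1 + s * l2 \<noteq> 0
    \<and> coeff a' d + l2 / (l1 + s * l2) * coeff b' d \<noteq> 0"
proof -
  have deg: "degree a \<le> d" "degree b \<le> d"
    and cop: "\<And>x y. (x, y) \<noteq> (0, 0) \<Longrightarrow> bform d a x y \<noteq> 0 \<or> bform d b x y \<noteq> 0"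
    using nc by (simp_all add: normal_chart_def)
  define q where "q = smult l2 a - smult l1 b"
  have "q \<noteq> 0"
  proof
    assume "q = 0"
    then have "coeff (smult l2 a) j = coeff (smult l1 b) j" for j by (simp add: q_def)
    then have co: "l2 * coeff a j = l1 * coeff b j" for j by simp
    have eq: "l2 * bform d a x y = l1 * bform d b x y" for x y
    proof -
      have "l2 * bform d a x y = (\<Sum>j\<le>d. (l2 * coeff a j) * x ^ (d - j) * y ^ j)"
        by (simp add: bform_def sum_distrib_left mult_ac)
      also have "\<dots> = l1 * bform d b x y" unfolding co by (simp add: bform_def sum_distrib_left mult_ac)
      finally show ?thesis .
    qed
    show False
    proof (cases "l2 = 0")
      case True
      obtain x y where "(x, y) \<noteq> (0, 0)" "bform d a x y = 0" using bform_has_zero[OF d deg(1)] by blast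
      then show False using eq[of x y] cop[of x y] True l by auto
    next
      case False
      obtain x y where "(x, y) \<noteq> (0, 0)" "bform d b x y = 0" using bform_has_zero[OF d deg(2)] by blast
      then show False using eq[of x y] cop[of x y] False by auto
    qed
  qed
  moreover have "[:l1, l2:] \<noteq> 0" using l by auto
  ultimately have "q * [:l1, l2:] \<noteq> 0" by (simp only: mult_eq_0_iff) blast
  then have "finite {s. poly (q * [:l1, l2:]) s = 0}" by (rule poly_roots_finite)
  then obtain s where s: "s \<notin> {s. poly (q * [:l1, l2:]) s = 0}"
    using ex_new_if_finite[OF infinite_UNIV_char_0] by blast
  have "poly q s * poly [:l1, l2:] s \<noteq> 0" using s unfolding mem_Collect_eq poly_mult .
  then have "poly q s \<noteq> 0" and s1: "l1 + s * l2 \<noteq> 0" by simp_all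
  then have s2: "l2 * poly a s - l1 * poly b s \<noteq> 0" by (simp add: q_def)
  have "(0::complex) * s - (- 1) * 1 \<noteq> 0" by simp
  from normal_chart_rotate[OF d fol nc this]
  obtain a' b' where ab: "normal_chart d \<Omega> (g ** rotation s) a' b'"
    "\<And>x y. bform d b' x y = 1 * bform d a (0 * x + 1 * y) (- 1 * x + s * y) + s * bform d b (0 * x + 1 * y) (- 1 * x + s * y)"
    "\<And>x y. bform d a' x y = 0 * bform d a (0 * x + 1 * y) (- 1 * x + s * y) + - 1 * bform d b (0 * x + 1 * y) (- 1 * x + s * y)"
    unfolding rotation_def by blast
  have co: "coeff b' d = poly a s + s * poly b s" "coeff a' d = - poly b s"
    using ab(2)[of 0 1] ab(3)[of 0 1] by (simp_all add: bform_0_left bform_1 deg)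
  have alg: "(A + l2 / D * B) * D = A * D + l2 * B" if "D \<noteq> 0" for A B D :: complex
    using that by (simp add: distrib_right)
  have "(coeff a' d + l2 / (l1 + s * l2) * coeff b' d) * (l1 + s * l2)
      = - poly b s * (l1 + s * l2) + l2 * (poly a s + s * poly b s)"
    unfolding co by (rule alg[OF s1])
  also have "\<dots> = l2 * poly a s - l1 * poly b s" by algebra
  finally have "(coeff a' d + l2 / (l1 + s * l2) * coeff b' d) * (l1 + s * l2) = l2 * poly a s - l1 * poly b s" .
  then have "coeff a' d + l2 / (l1 + s * l2) * coeff b' d \<noteq> 0" using s2 by auto
  then show ?thesis using ab(1) s1 by blast
qed

section \<open>Inflection lines through the centre\<close>

lemma lie_has_field_derivative:
  "((\<lambda>t. eval3 P (v + t *s eval_form Z v)) has_field_derivative eval3 (lie Z P) v) (at 0)"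
  using eval3_has_field_derivative[of P v "eval_form Z v" 0]
  by (simp add: lie_def eval3_sum eval_form_def)

lemma lie_xyz: "lie Z (xyz$i) = Z$i"
proof (rule eval3_eqI)
  fix v
  have "((\<lambda>t. eval3 (xyz$i) (v + t *s eval_form Z v)) has_field_derivative eval_form Z v $ i) (at 0)"
    by (auto intro!: derivative_eq_intros)
  from DERIV_unique[OF lie_has_field_derivative this] show "eval3 (lie Z (xyz$i)) v = eval3 (Z$i) v"
    by (simp add: eval_form_def)
qed

lemma eval_form_cross_xyz: "eval_form (cross Z xyz) v = cross (eval_form Z v) v"
  by (rule vec3_eqI) (simp_all add: eval_form_def cross_components)

text \<open>The inflection polynomial is the second fundamental form of the foliation.\<close>

lemma inflection_has_field_derivative:
  fixes v :: "complex^3"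
  assumes "\<Omega> = cross Z xyz"
  defines "w \<equiv> eval_form Z v"
  shows "((\<lambda>t. dot3 (eval_form \<Omega> (v + t *s w)) w) has_field_derivative
     eval3 (det (\<chi> i. vector [xyz$i, lie Z (xyz$i), lie Z (lie Z (xyz$i))])) v) (at 0)"
proof -
  define z where "z i t = eval3 (Z$i) (v + t *s w)" for i t
  define A where "A i = eval3 (lie Z (Z$i)) v" for i
  have z: "(z i has_field_derivative A i) (at 0)" for i
    unfolding z_def A_def w_def by (rule lie_has_field_derivative)
  have z0: "z i 0 = w $ i" for i by (simp add: z_def w_def eval_form_def)
  have "dot3 (eval_form \<Omega> (v + t *s w)) w =
      (z 2 t * (v$3 + t * w$3) - z 3 t * (v$2 + t * w$2)) * w$1
    + (z 3 t * (v$1 + t * w$1) - z 1 t * (v$3 + t * w$3)) * w$2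
    + (z 1 t * (v$2 + t * w$2) - z 2 t * (v$1 + t * w$1)) * w$3" for t
    unfolding assms(1) eval_form_cross_xyz by (simp add: dot3_def cross_components z_def eval_form_def)
  moreover have "((\<lambda>t. (z 2 t * (v$3 + t * w$3) - z 3 t * (v$2 + t * w$2)) * w$1
    + (z 3 t * (v$1 + t * w$1) - z 1 t * (v$3 + t * w$3)) * w$2
    + (z 1 t * (v$2 + t * w$2) - z 2 t * (v$1 + t * w$1)) * w$3) has_field_derivative
    ((A 2 * v$3 + w$2 * w$3) - (A 3 * v$2 + w$3 * w$2)) * w$1
    + ((A 3 * v$1 + w$3 * w$1) - (A 1 * v$3 + w$1 * w$3)) * w$2
    + ((A 1 * v$2 + w$1 * w$2) - (A 2 * v$1 + w$2 * w$1)) * w$3) (at 0)"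
    by (rule derivative_eq_intros z refl | simp add: z0)+
  moreover have "eval3 (det (\<chi> i. vector [xyz$i, lie Z (xyz$i), lie Z (lie Z (xyz$i))])) v
    = ((A 2 * v$3 + w$2 * w$3) - (A 3 * v$2 + w$3 * w$2)) * w$1
    + ((A 3 * v$1 + w$3 * w$1) - (A 1 * v$3 + w$1 * w$3)) * w$2
    + ((A 1 * v$2 + w$1 * w$2) - (A 2 * v$1 + w$2 * w$1)) * w$3"
    by (simp add: det_3 vector_3 lie_xyz A_def w_def eval_form_def algebra_simps)
  ultimately show ?thesis by simp
qed

lemma homogeneous3_diff: "homogeneous3 n P \<Longrightarrow> homogeneous3 n Q \<Longrightarrow> homogeneous3 n (P - Q)"
  unfolding homogeneous3_def by (metis coeff_diff diff_zero)

lemma homogeneous3_const_mult: "homogeneous3 n P \<Longrightarrow> homogeneous3 n (const3 c * P)"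
  by (auto simp: homogeneous3_def const3_def)

lemma coeff_of_nat_mult_poly: "coeff (of_nat n * p) k = of_nat n * coeff (p :: 'a::comm_semiring_1 poly) k"
  by (simp add: of_nat_poly)

lemma homogeneous3_grad3:
  assumes P: "homogeneous3 (Suc n) P"
  shows "homogeneous3 n (grad3 P $ m)"
proof -
  have 1: "i + j + k = n" if "coeff (coeff (coeff (grad3 P $ 1) k) j) i \<noteq> 0" for i j k
  proof -
    have "of_nat (Suc i) * coeff (coeff (coeff P k) j) (Suc i) \<noteq> 0"
      using that by (simp add: grad3_def vector_3 coeff_map_poly coeff_pderiv)
    then have "Suc i + j + k = Suc n" using P unfolding homogeneous3_def by (metis mult_zero_right)
    then show ?thesis by simp
  qed
  have 2: "i + j + k = n" if "coeff (coeff (coeff (grad3 P $ 2) k) j) i \<noteq> 0" for i j k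
  proof -
    have "of_nat (Suc j) * coeff (coeff (coeff P k) (Suc j)) i \<noteq> 0"
      using that by (simp add: grad3_def vector_3 coeff_map_poly coeff_pderiv coeff_of_nat_mult_poly del: of_nat_Suc)
    then have "i + Suc j + k = Suc n" using P unfolding homogeneous3_def by (metis mult_zero_right)
    then show ?thesis by simp
  qed
  have 3: "i + j + k = n" if "coeff (coeff (coeff (grad3 P $ 3) k) j) i \<noteq> 0" for i j k
  proof -
    have "of_nat (Suc k) * coeff (coeff (coeff P (Suc k)) j) i \<noteq> 0"
      using that by (simp add: grad3_def vector_3 coeff_map_poly coeff_pderiv coeff_of_nat_mult_poly del: of_nat_Suc)
    then have "i + j + Suc k = Suc n" using P unfolding homogeneous3_def by (metis mult_zero_right)
    then show ?thesis by simp
  qed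
  show ?thesis using exhaust_3[of m] 1 2 3 unfolding homogeneous3_def by auto
qed

text \<open>A vector field describing the foliation is \<open>curl \<Omega> / (d + 2)\<close>, by Euler's relation.\<close>

lemma foliation_field_describes:
  assumes fol: "foliation d \<Omega>"
  shows "describes d (foliation_field d \<Omega>) \<Omega>"
proof -
  define D where "D i j = grad3 (\<Omega>$i) $ j" for i j
  define k where "k = const3 (1 / of_nat (d + 2))"
  define Z :: "poly3^3" where "Z = vector [k * (D 3 2 - D 2 3), k * (D 1 3 - D 3 1), k * (D 2 1 - D 1 2)]"
  have hom: "homogeneous3 (Suc d) (\<Omega>$i)" for i using fol by (simp add: foliation_def)
  have hD: "homogeneous3 d (D i j)" for i j unfolding D_def by (rule homogeneous3_grad3[OF hom])
  have "homogeneous3 d (Z$i)" for i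
    using exhaust_3[of i] hD by (auto simp: Z_def vector_3 k_def intro!: homogeneous3_const_mult homogeneous3_diff)
  moreover have eq: "\<Omega> = cross Z xyz"
  proof -
    have ev: "eval3 (\<Omega>$i) v = eval3 (cross Z xyz $ i) v" for i v
    proof -
      define e where "e i j = eval3 (D i j) v" for i j
      define o' where "o' i = eval3 (\<Omega>$i) v" for i
      have euler: "v$1 * e i 1 + v$2 * e i 2 + v$3 * e i 3 = of_nat (d + 1) * o' i" for i
      proof -
        have "((\<lambda>t. eval3 (\<Omega>$i) (v + t *s v)) has_field_derivative (\<Sum>j\<in>UNIV. v$j * eval3 (grad3 (\<Omega>$i) $ j) (v + 0 *s v))) (at 0)"
          by (rule eval3_has_field_derivative)
        moreover have "(\<lambda>t. eval3 (\<Omega>$i) (v + t *s v)) = (\<lambda>t. (1 + t) ^ (d + 1) * o' i)"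
        proof
          fix t
          have "v + t *s v = (1 + t) *s v" by (simp add: vec_eq_iff algebra_simps)
          then show "eval3 (\<Omega>$i) (v + t *s v) = (1 + t) ^ (d + 1) * o' i"
            using eval3_scale[OF hom[of i], of "1 + t" v] by (simp add: o'_def)
        qed
        moreover have "((\<lambda>t. (1 + t) ^ (d + 1) * o' i) has_field_derivative of_nat (d + 1) * o' i) (at 0)"
          by (auto intro!: derivative_eq_intros)
        ultimately show ?thesis using DERIV_unique by (fastforce simp: sum_3 e_def D_def)
      qed
      have rad: "o' j + (v$1 * e 1 j + v$2 * e 2 j + v$3 * e 3 j) = 0" for j
      proof -
        define u where "u = (axis j 1 :: complex^3)"
        have u: "u $ i = (if i = j then 1 else 0)" for i by (simp add: u_def axis_def)
        have d: "((\<lambda>t. eval3 (\<Omega>$i) (v + t *s u)) has_field_derivative e i j) (at 0)" for i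
          using eval3_has_field_derivative[of "\<Omega>$i" v u 0] exhaust_3[of j] by (auto simp: sum_3 u e_def D_def)
        have "(\<lambda>t. eval3 (\<Omega>$1) (v + t *s u) * (v$1 + t * u$1) + eval3 (\<Omega>$2) (v + t *s u) * (v$2 + t * u$2)
            + eval3 (\<Omega>$3) (v + t *s u) * (v$3 + t * u$3)) = (\<lambda>t. 0)"
        proof
          fix t
          show "eval3 (\<Omega>$1) (v + t *s u) * (v$1 + t * u$1) + eval3 (\<Omega>$2) (v + t *s u) * (v$2 + t * u$2)
            + eval3 (\<Omega>$3) (v + t *s u) * (v$3 + t * u$3) = 0"
            using eval_form_euler[OF fol, of "v + t *s u"] by (simp add: dot3_def eval_form_def)
        qed
        moreover have "((\<lambda>t. eval3 (\<Omega>$1) (v + t *s u) * (v$1 + t * u$1) + eval3 (\<Omega>$2) (v + t *s u) * (v$2 + t * u$2)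
            + eval3 (\<Omega>$3) (v + t *s u) * (v$3 + t * u$3)) has_field_derivative
            (e 1 j * v$1 + o' 1 * u$1) + (e 2 j * v$2 + o' 2 * u$2) + (e 3 j * v$3 + o' 3 * u$3)) (at 0)"
          by (rule derivative_eq_intros d refl | simp add: o'_def)+
        ultimately have "((\<lambda>t. 0) has_field_derivative
            (e 1 j * v$1 + o' 1 * u$1) + (e 2 j * v$2 + o' 2 * u$2) + (e 3 j * v$3 + o' 3 * u$3)) (at (0::complex))"
          by (simp only:)
        from DERIV_unique[OF this DERIV_const]
        have "(e 1 j * v$1 + o' 1 * u$1) + (e 2 j * v$2 + o' 2 * u$2) + (e 3 j * v$3 + o' 3 * u$3) = 0" .
        then show ?thesis using exhaust_3[of j] by (auto simp: u algebra_simps)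
      qed
      define c where "c = (of_nat (d + 2) :: complex)"
      have "c \<noteq> 0" unfolding c_def of_nat_eq_0_iff by simp
      have cc: "of_nat (d + 1) = c - 1" by (simp add: c_def)
      have "eval3 (cross Z xyz $ 1) v = 1 / c * ((e 1 3 - e 3 1) * v$3 - (e 2 1 - e 1 2) * v$2)"
        "eval3 (cross Z xyz $ 2) v = 1 / c * ((e 2 1 - e 1 2) * v$1 - (e 3 2 - e 2 3) * v$3)"
        "eval3 (cross Z xyz $ 3) v = 1 / c * ((e 3 2 - e 2 3) * v$2 - (e 1 3 - e 3 1) * v$1)"
        by (simp_all add: cross_components Z_def vector_3 k_def c_def e_def left_diff_distrib diff_divide_distrib del: of_nat_add)
      moreover have "(e 1 3 - e 3 1) * v$3 - (e 2 1 - e 1 2) * v$2 = c * o' 1"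
        "(e 2 1 - e 1 2) * v$1 - (e 3 2 - e 2 3) * v$3 = c * o' 2"
        "(e 3 2 - e 2 3) * v$2 - (e 1 3 - e 3 1) * v$1 = c * o' 3"
        using euler[of 1] rad[of 1] euler[of 2] rad[of 2] euler[of 3] rad[of 3] unfolding cc by algebra+
      ultimately have "eval3 (cross Z xyz $ 1) v * c = c * o' 1" "eval3 (cross Z xyz $ 2) v * c = c * o' 2"
        "eval3 (cross Z xyz $ 3) v * c = c * o' 3"
        using \<open>c \<noteq> 0\<close> by simp_all
      then have "eval3 (cross Z xyz $ i) v * c = c * o' i" using exhaust_3[of i] by auto
      then show ?thesis using \<open>c \<noteq> 0\<close> by (simp add: o'_def)
    qed
    show ?thesis by (rule vec3_eqI) (rule eval3_eqI, rule ev)+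
  qed
  moreover have "no_common_factor Z"
    unfolding no_common_factor_def
  proof (intro allI impI)
    fix f assume f: "\<forall>i. f dvd Z$i"
    have "f dvd \<Omega>$i" for i
      using exhaust_3[of i] f eq by (auto simp: cross_components intro!: dvd_diff dvd_mult2)
    then show "f dvd 1" using fol by (auto simp: foliation_def no_common_factor_def)
  qed
  ultimately have "describes d Z \<Omega>" by (simp add: describes_def)
  then show ?thesis unfolding foliation_field_def by (rule someI)
qed

lemma bform_double_root:
  assumes deg: "degree f \<le> d" and s: "poly f s = 0" "poly (pderiv f) s = 0" and x: "x \<noteq> 0"
  shows "((\<lambda>t. bform d f (x + t * u) (s * x + t * v)) has_field_derivative 0) (at 0)"
proof -
  define h where "h t = (s * x + t * v) / (x + t * u)" for t
  have h0: "h 0 = s" using x by (simp add: h_def)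
  have "h field_differentiable at 0"
    unfolding h_def using x by (intro field_differentiable_divide field_differentiable_add field_differentiable_mult
        field_differentiable_const field_differentiable_ident) simp
  then obtain h' where h': "(h has_field_derivative h') (at 0)" by (auto simp: field_differentiable_def)
  have "(\<lambda>t. (x + t * u) ^ d) field_differentiable at 0"
    by (intro field_differentiable_power field_differentiable_add field_differentiable_mult field_differentiable_const field_differentiable_ident)
  then obtain P where P: "((\<lambda>t. (x + t * u) ^ d) has_field_derivative P) (at 0)" by (auto simp: field_differentiable_def)
  have "((\<lambda>t. (x + t * u) ^ d * poly f (h t)) has_field_derivative
      P * poly f (h 0) + (poly (pderiv f) (h 0) * h') * (x + 0 * u) ^ d) (at 0)"
    by (rule DERIV_mult[OF P DERIV_chain2[OF poly_DERIV h']])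
  then have "((\<lambda>t. (x + t * u) ^ d * poly f (h t)) has_field_derivative 0) (at 0)"
    unfolding h0 s by simp
  then show ?thesis
  proof (rule has_field_derivative_transform_within_open)
    show "open {t. x + t * u \<noteq> 0}" by (intro open_Collect_neq continuous_intros)
    show "(0::complex) \<in> {t. x + t * u \<noteq> 0}" using x by simp
    show "(x + t * u) ^ d * poly f (h t) = bform d f (x + t * u) (s * x + t * v)" if "t \<in> {t. x + t * u \<noteq> 0}" for t
      using that bform_eq_poly[OF deg, of "x + t * u" "s * x + t * v"] by (simp add: h_def)
  qed
qed

lemma cross_matrix_vector:
  fixes g :: "complex^3^3"
  shows "cross (g *v u) (g *v v) v* g = det g *s cross u v"
  by (rule vec3_eqI) (simp_all add: cross_components vector_matrix_3 matrix_vector_3 det_3 algebra_simps)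

text \<open>The line \<open>y = s x\<close> in the chart given by \<open>g\<close>.\<close>

definition critical_line :: "complex^3^3 \<Rightarrow> complex \<Rightarrow> complex^3" where
  "critical_line g s = vector [s, -1, 0] v* matrix_inv g"

context
  fixes d :: nat and \<Omega> :: "poly3^3" and g :: "complex^3^3" and a b :: "complex poly" and p0 s0 :: complex
  assumes d: "1 \<le> d" and fol: "foliation d \<Omega>" and nc: "normal_chart d \<Omega> g a b"
    and s0: "poly (fibre_poly a b p0) s0 = 0" "poly (pderiv (fibre_poly a b p0)) s0 = 0"
begin

lemma invertible_g: "invertible g" and degrees: "degree a \<le> d" "degree b \<le> d"
  and degree_fibre_poly: "degree (fibre_poly a b p0) \<le> d"
  and normal_form: "eval_form \<Omega> (g *v v) v* g = vector [v$3 * bform d a (v$1) (v$2), v$3 * bform d b (v$1) (v$2),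
        - (v$1 * bform d a (v$1) (v$2) + v$2 * bform d b (v$1) (v$2))]"
proof -
  show "invertible g" "degree a \<le> d" "degree b \<le> d"
    "eval_form \<Omega> (g *v v) v* g = vector [v$3 * bform d a (v$1) (v$2), v$3 * bform d b (v$1) (v$2),
        - (v$1 * bform d a (v$1) (v$2) + v$2 * bform d b (v$1) (v$2))]"
    using nc by (simp_all add: normal_chart_def)
  then show "degree (fibre_poly a b p0) \<le> d"
    by (intro degree_add_le order.trans[OF degree_smult_le])
qed

lemma dot3_critical_line: "dot3 (critical_line g s0) (g *v v) = s0 * v$1 - v$2"
  unfolding critical_line_def dot3_adjoint by (simp add: invertible_inverse[OF invertible_g]) (simp add: dot3_def vector_3)

lemma critical_line_nonzero: "critical_line g s0 \<noteq> 0"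
proof -
  have "(vector [s0, -1, 0] :: complex^3) \<noteq> 0" by (simp add: vec_eq_iff forall_3 vector_3)
  then show ?thesis unfolding critical_line_def
    using vector_matrix_eq_0_iff[OF invertible_inverse(3)[OF invertible_g]] by blast
qed

lemma slope_on_critical_line: "bform d a x (s0 * x) = - p0 * bform d b x (s0 * x)"
proof (cases "x = 0")
  case True
  then show ?thesis using d by (simp add: bform_0_left power_0_left)
next
  case False
  have "bform d (fibre_poly a b p0) x (s0 * x) = x ^ d * poly (fibre_poly a b p0) (s0 * x / x)"
    by (rule bform_eq_poly[OF degree_fibre_poly False])
  also have "\<dots> = 0" using False s0(1) by simp
  finally show ?thesis by (simp add: bform_fibre_poly add_eq_0_iff)
qed

text \<open>At a critical point of the Gauss map the tangent lines to the leaves along a line through the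
  centre are stationary, so this line consists of inflection points.\<close>

lemma critical_line_dvd_inflection: "linear_form (critical_line g s0) dvd inflection_poly d \<Omega>"
proof -
  let ?l = "critical_line g s0"
  define Z where "Z = foliation_field d \<Omega>"
  have Z: "\<Omega> = cross Z xyz" using foliation_field_describes[OF fol] by (simp add: Z_def describes_def)
  define lx lz :: "complex^3" where "lx = vector [1, 0, 0] v* matrix_inv g" and "lz = vector [0, 0, 1] v* matrix_inv g"
  have lxz: "dot3 lx (g *v v) = v$1" "dot3 lz (g *v v) = v$3" for v
    unfolding lx_def lz_def dot3_adjoint by (simp_all add: invertible_inverse[OF invertible_g]) (simp_all add: dot3_def vector_3)
  have main: "eval3 (inflection_poly d \<Omega>) (g *v v) = 0"
    if v: "v$2 = s0 * v$1" "v$1 \<noteq> 0" "v$3 \<noteq> 0" for v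
  proof -
    define w where "w = eval_form Z (g *v v)"
    define w' where "w' = matrix_inv g *v w"
    have w: "w = g *v w'" by (simp add: w'_def invertible_inverse[OF invertible_g])
    have \<delta>: "det g \<noteq> 0" by (rule invertible_inverse(8)[OF invertible_g])
    define B where "B = bform d b (v$1) (v$2)"
    have A: "bform d a (v$1) (v$2) = - p0 * B" unfolding B_def v(1) by (rule slope_on_critical_line)
    have "eval_form \<Omega> (g *v v) v* g = cross w (g *v v) v* g"
      by (subst Z) (simp add: eval_form_cross_xyz w_def)
    then have "det g *s cross w' v = vector [v$3 * (- p0 * B), v$3 * B, - (v$1 * (- p0 * B) + v$2 * B)]"
      unfolding normal_form w cross_matrix_vector A B_def[symmetric] by simp
    then have cr: "det g * cross w' v $ 1 = v$3 * (- p0 * B)" "det g * cross w' v $ 2 = v$3 * B"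
      by (simp_all add: vec_eq_iff forall_3 vector_3)
    define c \<rho> where "c = - B / det g" and "\<rho> = w'$3 / v$3"
    have w1: "w'$1 = c + \<rho> * v$1" and w2: "w'$2 = c * p0 + \<rho> * v$2" and w3: "w'$3 = \<rho> * v$3"
      using cr \<delta> v(3) by (simp_all add: cross_components c_def \<rho>_def field_simps)
    have line: "dot3 (eval_form \<Omega> (g *v v + t *s w)) w
        = c * v$3 * bform d (fibre_poly a b p0) (v$1 + t * w'$1) (s0 * v$1 + t * w'$2)" for t
    proof -
      have "g *v v + t *s w = g *v (v + t *s w')"
        unfolding w by (rule vec3_eqI) (simp_all add: matrix_vector_3 algebra_simps)
      then have "dot3 (eval_form \<Omega> (g *v v + t *s w)) w = dot3 (eval_form \<Omega> (g *v (v + t *s w')) v* g) w'"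
        by (simp add: dot3_adjoint w[symmetric])
      also have "\<dots> = (w'$1 * (v$3 + t * w'$3) - w'$3 * (v$1 + t * w'$1)) * bform d a (v$1 + t * w'$1) (v$2 + t * w'$2)
          + (w'$2 * (v$3 + t * w'$3) - w'$3 * (v$2 + t * w'$2)) * bform d b (v$1 + t * w'$1) (v$2 + t * w'$2)"
        unfolding normal_form by (simp add: dot3_def vector_3 algebra_simps)
      also have "w'$1 * (v$3 + t * w'$3) - w'$3 * (v$1 + t * w'$1) = c * v$3"
        unfolding w1 w3 by (simp add: algebra_simps)
      also have "w'$2 * (v$3 + t * w'$3) - w'$3 * (v$2 + t * w'$2) = c * v$3 * p0"
        unfolding w2 w3 by (simp add: algebra_simps)
      finally show ?thesis unfolding bform_fibre_poly v(1) by (simp add: algebra_simps)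
    qed
    have "((\<lambda>t. dot3 (eval_form \<Omega> (g *v v + t *s w)) w) has_field_derivative c * v$3 * 0) (at 0)"
      unfolding line by (intro DERIV_cmult bform_double_root degree_fibre_poly s0 v)
    moreover have "((\<lambda>t. dot3 (eval_form \<Omega> (g *v v + t *s w)) w) has_field_derivative eval3 (inflection_poly d \<Omega>) (g *v v)) (at 0)"
      unfolding w_def inflection_poly_def Let_def Z_def[symmetric] by (rule inflection_has_field_derivative[OF Z])
    ultimately have "eval3 (inflection_poly d \<Omega>) (g *v v) = c * v$3 * 0" by (rule DERIV_unique[rotated])
    then show ?thesis by simp
  qed
  have "linear_form ?l dvd inflection_poly d \<Omega> * (linear_form lx * linear_form lz)"
    unfolding linear_form_dvd_iff[OF critical_line_nonzero]
  proof (intro allI impI)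
    fix v assume v: "dot3 ?l v = 0"
    define v' where "v' = matrix_inv g *v v"
    have v': "v = g *v v'" by (simp add: v'_def invertible_inverse[OF invertible_g])
    then have "v'$2 = s0 * v'$1" using v dot3_critical_line[of v'] by simp
    then show "eval3 (inflection_poly d \<Omega> * (linear_form lx * linear_form lz)) v = 0"
      using main[of v'] unfolding v' by (auto simp: lxz)
  qed
  moreover have "\<not> linear_form ?l dvd linear_form lx" "\<not> linear_form ?l dvd linear_form lz"
    unfolding linear_form_dvd_iff[OF critical_line_nonzero]
    using dot3_critical_line[of "vector [1, s0, 1]"] lxz[of "vector [1, s0, 1]"] by (auto simp: vector_3)
  ultimately show ?thesis by (simp only: prime_elem_dvd_mult_iff[OF linear_form_prime[OF critical_line_nonzero]] simp_thms)
qed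

text \<open>The tangent direction to the foliation along the line \<open>y = s0 x\<close> is \<open>p0\<close>.\<close>

lemma critical_line_not_invariant:
  assumes ne: "s0 \<noteq> p0"
  shows "\<not> invariant_curve \<Omega> (linear_form (critical_line g s0))"
proof
  let ?l = "critical_line g s0"
  assume inv: "invariant_curve \<Omega> (linear_form ?l)"
  let ?v = "vector [1, s0, 1] :: complex^3"
  have "dot3 ?l (g *v ?v) = 0" using dot3_critical_line[of ?v] by (simp add: vector_3)
  then have "eval3 (cross \<Omega> (grad3 (linear_form ?l)) $ i) (g *v ?v) = 0" for i
    using inv linear_form_dvd_iff[OF critical_line_nonzero] by (auto simp: invariant_curve_def)
  moreover have "eval3 (cross \<Omega> (grad3 (linear_form ?l)) $ i) (g *v ?v) = cross (eval_form \<Omega> (g *v ?v)) ?l $ i" for i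
    using exhaust_3[of i] by (auto simp: cross_components grad3_linear_form eval_form_def)
  ultimately have "cross (eval_form \<Omega> (g *v ?v)) ?l = 0" by (simp add: vec_eq_iff)
  then have "g *v cross (eval_form \<Omega> (g *v ?v) v* g) (?l v* g) = 0"
    by (simp add: cross_vector_matrix)
  then have "cross (eval_form \<Omega> (g *v ?v) v* g) (?l v* g) = 0"
    using matrix_vector_eq_0_iff[OF invertible_g] by blast
  moreover have "?l v* g = vector [s0, -1, 0]" by (simp add: critical_line_def invertible_inverse[OF invertible_g])
  ultimately have "cross (eval_form \<Omega> (g *v ?v) v* g) (vector [s0, -1, 0]) $ 1 = 0" by simp
  then have "bform d a 1 s0 + s0 * bform d b 1 s0 = 0"
    unfolding normal_form by (simp add: cross_components vector_3 add_eq_0_iff) (metis minus_minus)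
  then have "(s0 - p0) * poly b s0 = 0"
    using slope_on_critical_line[of 1] by (simp add: bform_1 degrees algebra_simps)
  then have "poly b s0 = 0" using ne by simp
  moreover have "poly a s0 = 0" using s0(1) calculation by simp
  ultimately show False using normal_chart_coprime[OF nc] by blast
qed

text \<open>The Gauss map sends the points of such a line to all lines of slope \<open>p0\<close>.\<close>

lemma critical_slope_in_gauss_image:
  assumes ne: "s0 \<noteq> p0"
  shows "zeros (linear_form (g *v vector [1, p0, 0])) \<subseteq> gauss_image \<Omega> (transverse_inflection d \<Omega>)"
proof
  fix l assume "l \<in> zeros (linear_form (g *v vector [1, p0, 0]))"
  then have l0: "l \<noteq> 0" and l: "dot3 (g *v vector [1, p0, 0]) l = 0" by (simp_all add: zeros_def)
  let ?S = "{\<mu> *s eval_form \<Omega> v | \<mu> v. v \<in> transverse_inflection d \<Omega> \<and> eval_form \<Omega> v \<noteq> 0 \<and> \<mu> \<noteq> 0}"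
  let ?l = "critical_line g s0"
  have bs: "poly b s0 \<noteq> 0"
    using s0(1) normal_chart_coprime[OF nc, of s0] by auto
  have generic: "l \<in> ?S" if l: "dot3 (g *v vector [1, p0, 0]) l = 0" and l3: "(l v* g) $ 3 \<noteq> 0" for l
  proof -
    let ?k = "l v* g"
    have k1: "?k $ 1 = - p0 * ?k $ 2"
    proof -
      have "dot3 ?k (vector [1, p0, 0]) = 0" using l by (simp add: dot3_adjoint) (simp add: dot3_def mult.commute)
      then show ?thesis by (simp add: dot3_def vector_3 add_eq_0_iff mult.commute)
    qed
    define B where "B = poly b s0"
    define \<mu> where "\<mu> = - ?k $ 3 / (B * (s0 - p0))"
    have \<mu>: "\<mu> \<noteq> 0" using l3 bs ne by (simp add: \<mu>_def B_def)
    define z where "z = ?k $ 2 / (\<mu> * B)"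
    define v :: "complex^3" where "v = vector [1, s0, z]"
    have A: "bform d a 1 s0 = - p0 * B" "bform d b 1 s0 = B"
      using slope_on_critical_line[of 1] by (simp_all add: B_def bform_1 degrees)
    have "\<mu> *s (eval_form \<Omega> (g *v v) v* g) = ?k"
      unfolding normal_form
    proof (rule vec3_eqI)
      have B0: "B \<noteq> 0" "s0 - p0 \<noteq> 0" using bs ne by (simp_all add: B_def)
      have e: "\<mu> * (z * B) = ?k $ 2" using \<mu> B0 by (simp add: z_def)
      then show "(\<mu> *s (vector [v$3 * bform d a (v$1) (v$2), v$3 * bform d b (v$1) (v$2), - (v$1 * bform d a (v$1) (v$2) + v$2 * bform d b (v$1) (v$2))] :: complex^3)) $ 2 = ?k $ 2"
        by (simp add: v_def vector_3 A)
      have "\<mu> * (z * (- p0 * B)) = - p0 * ?k $ 2" unfolding e[symmetric] by simp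
      then show "(\<mu> *s (vector [v$3 * bform d a (v$1) (v$2), v$3 * bform d b (v$1) (v$2), - (v$1 * bform d a (v$1) (v$2) + v$2 * bform d b (v$1) (v$2))] :: complex^3)) $ 1 = ?k $ 1"
        unfolding k1 by (simp add: v_def vector_3 A)
      have "\<mu> * (B * (s0 - p0)) = - ?k $ 3" using B0 by (simp add: \<mu>_def)
      then show "(\<mu> *s (vector [v$3 * bform d a (v$1) (v$2), v$3 * bform d b (v$1) (v$2), - (v$1 * bform d a (v$1) (v$2) + v$2 * bform d b (v$1) (v$2))] :: complex^3)) $ 3 = ?k $ 3"
        by (simp add: v_def vector_3 A algebra_simps)
    qed
    then have "(\<mu> *s eval_form \<Omega> (g *v v)) v* g = l v* g"
      by (simp add: vec_eq_iff forall_3 vector_matrix_3 algebra_simps)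
    then have eq: "l = \<mu> *s eval_form \<Omega> (g *v v)"
      using invertible_inverse(6)[OF invertible_g] by metis
    have "?k \<noteq> 0" using l3 by (auto simp: vec_eq_iff)
    then have "l \<noteq> 0" by auto
    then have \<Omega>0: "eval_form \<Omega> (g *v v) \<noteq> 0" using eq by (auto simp: vec_eq_iff)
    have "v \<noteq> 0" by (auto simp: v_def vec_eq_iff forall_3 vector_3)
    then have "g *v v \<noteq> 0" using matrix_vector_eq_0_iff[OF invertible_g] by blast
    moreover have "dot3 ?l (g *v v) = 0" using dot3_critical_line[of v] by (simp add: v_def vector_3)
    ultimately have "g *v v \<in> zeros (linear_form ?l)" by (simp add: zeros_def)
    then have "g *v v \<in> transverse_inflection d \<Omega>"
      unfolding transverse_inflection_def
      using critical_line_dvd_inflection critical_line_not_invariant[OF ne] linear_form_irreducible[OF critical_line_nonzero]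
      by blast
    then show ?thesis using eq \<Omega>0 \<mu> by (intro CollectI exI[of _ \<mu>] exI[of _ "g *v v"] conjI)
  qed
  have "l \<in> closure ?S"
  proof (cases "(l v* g) $ 3 = 0")
    case False
    show ?thesis by (rule subsetD[OF closure_subset generic[OF l False]])
  next
    case True
    define e where "e = vector [0, 0, 1] v* matrix_inv g"
    have eg: "e v* g = vector [0, 0, 1]" by (simp add: e_def invertible_inverse[OF invertible_g])
    have de: "dot3 (g *v vector [1, p0, 0]) e = 0"
    proof -
      have "dot3 (e v* g) (vector [1, p0, 0]) = 0" unfolding eg by (simp add: dot3_def vector_3)
      then show ?thesis by (simp add: dot3_adjoint) (simp add: dot3_def mult.commute)
    qed
    define x where "x n = l + complex_of_real (inverse (real (Suc n))) *s e" for n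
    have "x n \<in> ?S" for n
    proof (rule generic)
      have "dot3 (g *v vector [1, p0, 0]) (x n) = dot3 (g *v vector [1, p0, 0]) l
          + complex_of_real (inverse (real (Suc n))) * dot3 (g *v vector [1, p0, 0]) e"
        by (simp add: x_def dot3_def algebra_simps)
      then show "dot3 (g *v vector [1, p0, 0]) (x n) = 0" using l de by simp
      have "(x n v* g) $ 3 = (l v* g) $ 3 + complex_of_real (inverse (real (Suc n))) * (e v* g) $ 3"
        by (simp add: x_def vector_matrix_3 algebra_simps)
      also have "\<dots> = complex_of_real (inverse (real (Suc n)))" unfolding True eg by (simp add: vector_3)
      finally show "(x n v* g) $ 3 \<noteq> 0" by (simp del: of_nat_Suc)
    qed
    moreover have "x \<longlonglongrightarrow> l"
    proof (rule vec_tendstoI)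
      fix i
      have "(\<lambda>n. l $ i + complex_of_real (inverse (real (Suc n))) * e $ i) \<longlonglongrightarrow> l $ i + complex_of_real 0 * e $ i"
        by (intro tendsto_intros LIMSEQ_inverse_real_of_nat)
      then show "(\<lambda>n. x n $ i) \<longlonglongrightarrow> l $ i" by (simp add: x_def)
    qed
    ultimately show ?thesis unfolding closure_sequential by (intro exI[of _ x] conjI allI)
  qed
  then show "l \<in> gauss_image \<Omega> (transverse_inflection d \<Omega>)" using l0 by (simp add: gauss_image_def)
qed

end

section \<open>Removing the singularities of the curvature\<close>

lemma eventually_regular_value:
  assumes d: "1 \<le> d" and nc: "normal_chart d \<Omega> g a b"
  shows "\<forall>\<^sub>F p in at p0. regular_value d a b p"
proof -
  have "finite ({p. \<not> regular_value d a b p} - {p0})"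
    using finite_critical_values[OF d nc] by simp
  then have "open (- ({p. \<not> regular_value d a b p} - {p0}))"
    by (intro open_Compl finite_imp_closed)
  moreover have "p0 \<in> - ({p. \<not> regular_value d a b p} - {p0})" by simp
  ultimately have "\<forall>\<^sub>F p in nhds p0. p \<in> - ({p. \<not> regular_value d a b p} - {p0})"
    by (rule eventually_nhds_in_open)
  then show ?thesis unfolding eventually_at_filter by (rule eventually_mono) auto
qed

text \<open>The curve \<open>p \<mapsto> (p, q)\<close> with \<open>q\<close> fixed, parametrized in an arbitrary chart of the dual plane.\<close>

lemma dual_section:
  assumes M: "invertible M" and k: "k = vector [p, -1, - q] v* matrix_inv M" and k2: "k$2 \<noteq> 0"
  shows "dual_coords M (- k$1 / k$2, k$3 / k$2) $ 1 = - p / k$2"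
    "dual_coords M (- k$1 / k$2, k$3 / k$2) $ 2 = 1 / k$2"
    "dual_coords M (- k$1 / k$2, k$3 / k$2) $ 3 = q / k$2"
proof -
  have kM: "k v* M = vector [p, -1, - q]" unfolding k by (rule invertible_inverse(7)[OF M])
  have "k$1 * M$1$j + k$2 * M$2$j + k$3 * M$3$j = vector [p, -1, - q] $ j" for j
    using arg_cong[OF kM, of "\<lambda>v. v $ j"] by (simp only: vector_matrix_3)
  moreover have "dual_coords M (- k$1 / k$2, k$3 / k$2) $ j = - (k$1 * M$1$j + k$2 * M$2$j + k$3 * M$3$j) / k$2" for j
    unfolding dual_coords_components using k2 by (simp add: field_simps)
  ultimately have e: "dual_coords M (- k$1 / k$2, k$3 / k$2) $ j = - (vector [p, -1, - q] $ j) / k$2" for j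
    by (simp only:)
  show "dual_coords M (- k$1 / k$2, k$3 / k$2) $ 1 = - p / k$2"
    "dual_coords M (- k$1 / k$2, k$3 / k$2) $ 2 = 1 / k$2"
    "dual_coords M (- k$1 / k$2, k$3 / k$2) $ 3 = q / k$2"
    unfolding e by (simp_all add: vector_3)
qed

text \<open>The hypothesis on the curvature applies to the line \<open>p = p0\<close> of the dual plane. Comparing with
  \<open>S'(p) dp \<and> dq/q\<close> along a section \<open>q = const\<close> of the pencil gives the limit of \<open>S'\<close>.\<close>

lemma limit_at_inflection_slope:
  assumes d: "2 \<le> d" and fol: "foliation d \<Omega>" and nc: "normal_chart d \<Omega> g0 a b"
    and hol: "curvature_holomorphic_along d (legendre_transform d \<Omega>) (gauss_image \<Omega> (transverse_inflection d \<Omega>))"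
    and s0: "poly (fibre_poly a b p0) s0 = 0" "poly (pderiv (fibre_poly a b p0)) s0 = 0" "s0 \<noteq> p0"
  shows "\<exists>l. (deriv (total_height a b) \<longlongrightarrow> l) (at p0)"
proof -
  have d1: "1 \<le> d" using d by simp
  have g0: "invertible g0" using nc by (simp add: normal_chart_def)
  define lin where "lin u = linear_form (g0 *v u)" for u :: "complex^3"
  have lin: "eval3 (lin u) l = dot3 (l v* g0) u" for u l
    unfolding dot3_adjoint by (simp add: lin_def) (simp add: dot3_def mult.commute)
  define K :: "complex^3" where "K = vector [1, p0, 0]"
  have K0: "g0 *v K \<noteq> 0"
  proof -
    have "K \<noteq> 0" by (auto simp: K_def vec_eq_iff forall_3 vector_3)
    then show ?thesis using matrix_vector_eq_0_iff[OF g0] by blast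
  qed
  have "zeros (lin K) \<subseteq> gauss_image \<Omega> (transverse_inflection d \<Omega>)"
    unfolding lin_def K_def by (rule critical_slope_in_gauss_image[OF d1 fol nc s0])
  moreover have "homogeneous3 1 (lin K)" "irreducible (lin K)"
    unfolding lin_def by (rule homogeneous3_linear_form, rule linear_form_irreducible[OF K0])
  ultimately obtain n' r where r: "\<not> lin K dvd r"
    "\<And>l. l \<in> zeros (lin K) - zeros r \<Longrightarrow> curvature_holomorphic_at d (legendre_transform d \<Omega>) l"
    using hol unfolding curvature_holomorphic_along_def by blast
  \<comment> \<open>A line of slope \<open>p0\<close> at which the curvature is holomorphic, and which neither passes through the
    centre of the pencil of invariant lines nor is the line at infinity.\<close>
  define w :: "complex^3" where "w = vector [- p0, 1, 1] v* matrix_inv g0"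
  have wg: "w v* g0 = vector [- p0, 1, 1]" unfolding w_def by (rule invertible_inverse(7)[OF g0])
  have wv: "dot3 (g0 *v K) w = 0"
    using lin[of K w] unfolding wg by (simp add: lin_def) (simp add: K_def dot3_def vector_3)
  have "eval3 (lin (vector [0, 1, 0])) w = 1" "eval3 (lin (vector [0, 0, 1])) w = 1"
    unfolding lin wg by (simp_all add: dot3_def vector_3)
  then have "\<not> lin K dvd lin (vector [0, 1, 0])" "\<not> lin K dvd lin (vector [0, 0, 1])"
    unfolding lin_def[of K] linear_form_dvd_iff[OF K0] using wv by (metis zero_neq_one)+
  then have "\<not> lin K dvd r * (lin (vector [0, 1, 0]) * lin (vector [0, 0, 1]))"
    using r(1) unfolding lin_def[of K] by (simp only: prime_elem_dvd_mult_iff[OF linear_form_prime[OF K0]] simp_thms)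
  then obtain l where l: "dot3 (g0 *v K) l = 0" "eval3 (r * (lin (vector [0, 1, 0]) * lin (vector [0, 0, 1]))) l \<noteq> 0"
    unfolding lin_def[of K] linear_form_dvd_iff[OF K0] by blast
  define l' where "l' = l v* g0"
  have l'12: "l'$1 + p0 * l'$2 = 0"
    using lin[of K l] l(1) unfolding l'_def by (simp add: lin_def) (simp add: K_def dot3_def vector_3 mult.commute)
  have l'23: "l'$2 \<noteq> 0" "l'$3 \<noteq> 0" and rl: "eval3 r l \<noteq> 0"
    using l(2) by (simp_all add: lin l'_def dot3_def vector_3)
  have l0: "l \<noteq> 0"
  proof
    assume "l = 0"
    then have "l' = 0" by (simp add: l'_def)
    then show False using l'23 by simp
  qed
  have "l \<in> zeros (lin K) - zeros r" using l(1) l0 rl by (simp add: zeros_def lin_def)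
  from r(2)[OF this] obtain g m N f where g: "invertible g" "in_dual_chart g l m" "m \<in> N" "holomorphic2_on f N"
    and f: "\<And>x. x \<in> N - discriminant d (legendre_transform d \<Omega> g) \<Longrightarrow> curvature d (legendre_transform d \<Omega> g) x = f x"
    unfolding curvature_holomorphic_at_def by auto
  define M where "M = matrix_inv g ** g0"
  have detM: "det M \<noteq> 0" unfolding M_def using g(1) g0 by (simp add: det_mul invertible_inverse)
  have invM: "invertible M" using detM by (simp add: invertible_det_nz)
  obtain \<mu> where \<mu>: "\<mu> \<noteq> 0" "l v* g = \<mu> *s vector [fst m, -1, - snd m]"
    using g(2) unfolding in_dual_chart_def by blast
  define L where "L = dual_coords M m"
  have L: "\<mu> *s L = l'"
  proof -
    have "\<mu> *s L = (\<mu> *s vector [fst m, -1, - snd m]) v* M"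
      by (rule vec3_eqI) (simp_all add: L_def dual_coords_def vector_matrix_3 algebra_simps)
    also have "\<dots> = ((l v* g) v* matrix_inv g) v* g0"
      unfolding \<mu>(2)[symmetric] M_def by (rule vector_matrix_mul_assoc[symmetric])
    finally show ?thesis by (simp only: invertible_inverse(6)[OF g(1)] l'_def)
  qed
  then have Lj: "\<mu> * L $ j = l' $ j" for j by (simp add: vec_eq_iff)
  have L23: "L$2 \<noteq> 0" "L$3 \<noteq> 0" using Lj[of 2] Lj[of 3] l'23 by auto
  have "\<mu> * (L$1 + p0 * L$2) = 0" using l'12 unfolding Lj[symmetric] by (simp add: algebra_simps)
  then have L1: "L$1 = - p0 * L$2" using \<mu>(1) by (simp add: add_eq_0_iff)
  define q where "q = L$3 / L$2"
  have q0: "q \<noteq> 0" using L23 by (simp add: q_def)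
  define k where "k p = vector [p, -1, - q] v* matrix_inv M" for p
  define x where "x p = (- k p $ 1 / k p $ 2, k p $ 3 / k p $ 2)" for p
  have kj: "k p $ j = p * matrix_inv M $ 1 $ j - matrix_inv M $ 2 $ j - q * matrix_inv M $ 3 $ j" for p j
    by (simp add: k_def vector_matrix_3 vector_3)
  have "((\<lambda>p. k p $ j) \<longlongrightarrow> k p0 $ j) (at p0)" for j unfolding kj by (intro tendsto_intros)
  then have kt: "(k \<longlongrightarrow> k p0) (at p0)" by (rule vec_tendstoI)
  have "k p0 = (- 1 / L$2) *s vector [fst m, -1, - snd m]"
  proof -
    have "vector [p0, -1, - q] = (- 1 / L$2) *s L"
      by (rule vec3_eqI) (use L1 L23 in \<open>simp_all add: vector_3 q_def\<close>)
    then have "k p0 = (- 1 / L$2) *s (L v* matrix_inv M)"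
      unfolding k_def by (intro vec3_eqI) (simp_all add: vector_matrix_3 algebra_simps)
    then show ?thesis unfolding L_def dual_coords_def by (simp only: invertible_inverse(6)[OF invM])
  qed
  then have k0: "k p0 $ 1 = - fst m / L$2" "k p0 $ 2 = 1 / L$2" "k p0 $ 3 = snd m / L$2"
    by (simp_all add: vector_3)
  have k20: "k p0 $ 2 \<noteq> 0" using L23 unfolding k0 by simp
  have x0: "x p0 = m" using L23 unfolding x_def k0 by (simp add: prod_eq_iff)
  have contx: "(x \<longlongrightarrow> m) (at p0)"
    using k20 unfolding x0[symmetric] unfolding x_def by (intro tendsto_intros kt)
  have N: "open N" using g(4) by (simp add: holomorphic2_on_def)
  have "isCont f m"
    using g(3,4) has_derivative_continuous unfolding holomorphic2_on_def by blast
  then have fx: "((\<lambda>p. f (x p)) \<longlongrightarrow> f m) (at p0)" using contx by (rule isCont_tendsto_compose)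
  have "((\<lambda>p. f (x p) * (- q / (det M * k p $ 2 ^ 3))) \<longlongrightarrow> f m * (- q / (det M * k p0 $ 2 ^ 3))) (at p0)"
    using detM k20 by (intro tendsto_intros fx kt) simp_all
  moreover have "\<forall>\<^sub>F p in at p0. f (x p) * (- q / (det M * k p $ 2 ^ 3)) = deriv (total_height a b) p"
  proof -
    have "\<forall>\<^sub>F p in at p0. x p \<in> N" using contx N g(3) by (rule topological_tendstoD)
    moreover have "\<forall>\<^sub>F p in at p0. k p $ 2 \<noteq> 0"
      using tendsto_vec_nth[OF kt, of 2] k20 by (rule tendsto_imp_eventually_ne)
    ultimately show ?thesis using eventually_regular_value[OF d1 nc, of p0]
    proof eventually_elim
      case (elim p)
      note dc = dual_section[OF invM k_def[of p] elim(2), folded x_def]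
      have sl: "slope_at M (x p) = p" unfolding slope_at_def dc using elim(2) by simp
      have c2: "dual_coords M (x p) $ 2 \<noteq> 0" and c3: "dual_coords M (x p) $ 3 \<noteq> 0"
        unfolding dc using elim(2) q0 by simp_all
      note cnc = curvature_normal_chart[OF d fol nc g(1), folded M_def, OF c2 c3, unfolded sl, OF elim(3)]
      have "f (x p) = deriv (total_height a b) p * (- det M * (inverse (1 / k p $ 2) ^ 2 * inverse (q / k p $ 2)))"
        using f[of "x p"] cnc elim(1) unfolding dc by simp
      then show ?case using detM q0 elim(2) by (simp add: field_simps power2_eq_square power3_eq_cube)
    qed
  qed
  ultimately have "(deriv (total_height a b) \<longlongrightarrow> f m * (- q / (det M * k p0 $ 2 ^ 3))) (at p0)"
    by (rule Lim_transform_eventually)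
  then show ?thesis ..
qed

lemma limit_at_radial_slope:
  assumes d: "1 \<le> d" and nc: "normal_chart d \<Omega> g a b" and lead: "coeff a d + p0 * coeff b d \<noteq> 0"
    and radial: "\<And>s. poly (fibre_poly a b p0) s = 0 \<Longrightarrow> poly (pderiv (fibre_poly a b p0)) s = 0 \<Longrightarrow> s = p0"
  shows "\<exists>l. (deriv (total_height a b) \<longlongrightarrow> l) (at p0)"
proof -
  have deg: "degree a \<le> d" "degree b \<le> d" using nc by (simp_all add: normal_chart_def)
  note cop = normal_chart_coprime[OF nc]
  have "degree (fibre_poly a b p0) \<le> d" using deg by (intro degree_add_le order.trans[OF degree_smult_le]) auto
  moreover have "d \<le> degree (fibre_poly a b p0)" using lead by (intro le_degree) simp
  ultimately have dd: "degree (fibre_poly a b p0) = d" by (rule antisym)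
  note ev = eventually_regular_value[OF d nc, of p0]
  have lim: "((\<lambda>p. (p - p0) * total_height a b p) \<longlongrightarrow> 0) (at p0)"
    by (rule radial_limit[OF d deg cop dd radial ev])
  obtain r where r: "0 < r" "\<And>p. p \<noteq> p0 \<Longrightarrow> dist p p0 < r \<Longrightarrow> regular_value d a b p"
    using ev unfolding eventually_at by auto
  have diff: "(total_height a b has_field_derivative deriv (total_height a b) p) (at p)" if "p \<in> ball p0 r - {p0}" for p
    by (rule total_height_differentiable[OF d deg cop]) (use r(2) that in \<open>auto simp: dist_commute\<close>)
  have "total_height a b holomorphic_on ball p0 r - {p0}"
    unfolding holomorphic_on_def field_differentiable_def using diff has_field_derivative_at_within by blast
  moreover have "p0 \<in> interior (ball p0 r)" using r(1) by (simp add: interior_open)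
  ultimately obtain G where G: "G holomorphic_on ball p0 r" "\<And>p. p \<in> ball p0 r - {p0} \<Longrightarrow> G p = total_height a b p"
    using holomorphic_on_extend_lim[of "total_height a b" "ball p0 r" p0] lim by blast
  have "deriv G holomorphic_on ball p0 r" by (rule holomorphic_deriv[OF G(1) open_ball])
  then have "continuous_on (ball p0 r) (deriv G)" by (rule holomorphic_on_imp_continuous_on)
  then have "isCont (deriv G) p0" using r(1) by (simp add: continuous_on_eq_continuous_at)
  then have "(deriv G \<longlongrightarrow> deriv G p0) (at p0)" by (simp add: isCont_def)
  moreover have "\<forall>\<^sub>F p in at p0. deriv G p = deriv (total_height a b) p"
    using eventually_at_ball'[OF r(1), of p0 UNIV]
  proof eventually_elim
    case (elim p)
    have "open (ball p0 r - {p0})" by (intro open_delete open_ball)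
    then have "\<forall>\<^sub>F z in nhds p. z \<in> ball p0 r - {p0}" using elim by (intro eventually_nhds_in_open) auto
    then have "\<forall>\<^sub>F z in nhds p. G z = total_height a b z" by (rule eventually_mono) (rule G(2))
    then show ?case by (rule deriv_cong_ev) (rule refl)
  qed
  ultimately have "(deriv (total_height a b) \<longlongrightarrow> deriv G p0) (at p0)" by (rule Lim_transform_eventually)
  then show ?thesis ..
qed

lemma curvature_limit:
  assumes d: "2 \<le> d" and fol: "foliation d \<Omega>" and nc: "normal_chart d \<Omega> g0 a b"
    and hol: "curvature_holomorphic_along d (legendre_transform d \<Omega>) (gauss_image \<Omega> (transverse_inflection d \<Omega>))"
    and lead: "coeff a d + p0 * coeff b d \<noteq> 0"
  shows "\<exists>l. (deriv (total_height a b) \<longlongrightarrow> l) (at p0)"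
proof (cases "\<exists>s. poly (fibre_poly a b p0) s = 0 \<and> poly (pderiv (fibre_poly a b p0)) s = 0 \<and> s \<noteq> p0")
  case True
  then obtain s where "poly (fibre_poly a b p0) s = 0" "poly (pderiv (fibre_poly a b p0)) s = 0" "s \<noteq> p0" by blast
  then show ?thesis by (rule limit_at_inflection_slope[OF d fol nc hol])
next
  case False
  have "1 \<le> d" using d by simp
  then show ?thesis by (rule limit_at_radial_slope[OF _ nc lead]) (use False in blast)
qed

section \<open>Flatness\<close>

lemma dual_coords_mult: "dual_coords (M ** R) m = dual_coords M m v* R"
  by (simp add: dual_coords_def vector_matrix_mul_assoc)

text \<open>Two normal charts that differ by a rotation compute the same curvature.\<close>

lemma rotated_height:
  assumes d: "2 \<le> d" and fol: "foliation d \<Omega>" and nc: "normal_chart d \<Omega> g a b"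
    and nc': "normal_chart d \<Omega> (g ** rotation s) a' b'" and ps: "p - s \<noteq> 0"
    and reg: "regular_value d a b p" and reg': "regular_value d a' b' (- 1 / (p - s))"
  shows "deriv (total_height a b) p = deriv (total_height a' b') (- 1 / (p - s)) / (p - s) ^ 2"
proof -
  have g: "invertible g" using nc by (simp add: normal_chart_def)
  have "matrix_inv g ** g = mat 1" by (rule invertible_inverse(2)[OF g])
  note cnc = curvature_normal_chart(2)[OF d fol nc g, unfolded this, of "(p, 1)"]
  have dc: "dual_coords (mat 1) (p, 1) $ 1 = p" "dual_coords (mat 1) (p, 1) $ 2 = - 1" "dual_coords (mat 1) (p, 1) $ 3 = - 1"
    by (simp_all add: dual_coords_components mat_def)
  have sl: "slope_at (mat 1) (p, 1) = p" by (simp add: slope_at_def dc)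
  have 1: "curvature d (legendre_transform d \<Omega> g) (p, 1) = deriv (total_height a b) p"
    using cnc reg unfolding sl dc by simp
  have "matrix_inv g ** (g ** rotation s) = rotation s"
    by (simp add: matrix_mul_assoc invertible_inverse(2)[OF g])
  note cnc' = curvature_normal_chart(2)[OF d fol nc' g, unfolded this, of "(p, 1)"]
  have dc': "dual_coords (rotation s) (p, 1) $ 1 = 1" "dual_coords (rotation s) (p, 1) $ 2 = p - s"
    "dual_coords (rotation s) (p, 1) $ 3 = - 1"
    by (simp_all add: dual_coords_def rotation_components vector_3)
  have sl': "slope_at (rotation s) (p, 1) = - 1 / (p - s)" by (simp add: slope_at_def dc')
  have "curvature d (legendre_transform d \<Omega> g) (p, 1)
      = deriv (total_height a' b') (- 1 / (p - s)) * (- 1 * (inverse (p - s) ^ 2 * inverse (- 1)))"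
    using cnc'[unfolded sl' dc' det_rotation, OF ps _ reg'] by simp
  also have "\<dots> = deriv (total_height a' b') (- 1 / (p - s)) / (p - s) ^ 2"
    by (simp add: divide_inverse power_inverse)
  finally show ?thesis unfolding 1 .
qed

text \<open>The derivative of the total height extends to the whole Riemann sphere, with a zero at infinity:
  rotating the affine coordinates reduces each slope, including the infinite one, to a finite slope
  over which the fibre does not contain the direction at infinity.\<close>

lemma total_height_constant:
  assumes d: "2 \<le> d" and fol: "foliation d \<Omega>" and nc: "normal_chart d \<Omega> g a b"
    and hol: "curvature_holomorphic_along d (legendre_transform d \<Omega>) (gauss_image \<Omega> (transverse_inflection d \<Omega>))"
    and reg: "regular_value d a b p"
  shows "deriv (total_height a b) p = 0"
proof -
  have d1: "1 \<le> d" using d by simp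
  have deg: "degree a \<le> d" "degree b \<le> d" using nc by (simp_all add: normal_chart_def)
  note cop = normal_chart_coprime[OF nc]
  let ?T = "deriv (total_height a b)"
  define F where "F = {p. \<not> regular_value d a b p}"
  have F: "finite F" unfolding F_def by (rule finite_critical_values[OF d1 nc])
  have limits: "\<exists>l. (?T \<longlongrightarrow> l) (at p0)" for p0
  proof -
    have "(p0, - 1) \<noteq> (0, 0 :: complex)" by simp
    from good_rotation[OF d1 fol nc this] obtain s a' b' where nc': "normal_chart d \<Omega> (g ** rotation s) a' b'"
      and ps: "p0 + s * - 1 \<noteq> 0" and lead: "coeff a' d + - 1 / (p0 + s * - 1) * coeff b' d \<noteq> 0" by blast
    have ps: "p0 - s \<noteq> 0" and lead: "coeff a' d + - 1 / (p0 - s) * coeff b' d \<noteq> 0" using ps lead by simp_all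
    define u where "u p = - 1 / (p - s)" for p
    obtain l where l: "(deriv (total_height a' b') \<longlongrightarrow> l) (at (u p0))"
      using curvature_limit[OF d fol nc' hol lead] unfolding u_def by blast
    have nes: "\<forall>\<^sub>F p in at p0. p - s \<noteq> 0"
      by (rule tendsto_imp_eventually_ne[OF _ ps]) (intro tendsto_intros)
    have "\<forall>\<^sub>F p in at p0. u p \<noteq> u p0"
      using nes eventually_neq_at_within[of p0 p0 UNIV]
    proof eventually_elim
      case (elim p)
      then show ?case using ps by (simp add: u_def)
    qed
    moreover have "(u \<longlongrightarrow> u p0) (at p0)"
      unfolding u_def using ps by (intro tendsto_intros)
    ultimately have u: "filterlim u (at (u p0)) (at p0)" by (simp add: filterlim_at)
    have "((\<lambda>p. deriv (total_height a' b') (u p) / (p - s) ^ 2) \<longlongrightarrow> l / (p0 - s) ^ 2) (at p0)"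
      using ps by (intro tendsto_intros filterlim_compose[OF l u]) simp
    moreover have "\<forall>\<^sub>F p in at p0. deriv (total_height a' b') (u p) / (p - s) ^ 2 = ?T p"
      using nes eventually_compose_filterlim[OF eventually_regular_value[OF d1 nc', of "u p0"] u]
        eventually_regular_value[OF d1 nc, of p0]
    proof eventually_elim
      case (elim p)
      show ?case
        using rotated_height[OF d fol nc nc' elim(1) elim(3) elim(2)[unfolded u_def]] by (simp only: u_def)
    qed
    ultimately have "(?T \<longlongrightarrow> l / (p0 - s) ^ 2) (at p0)" by (rule Lim_transform_eventually)
    then show ?thesis ..
  qed
  have infinity: "(?T \<longlongrightarrow> 0) at_infinity"
  proof -
    have "(1 :: complex, 0) \<noteq> (0, 0 :: complex)" by simp
    from good_rotation[OF d1 fol nc this] obtain s a' b' where nc': "normal_chart d \<Omega> (g ** rotation s) a' b'"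
      and lead: "coeff a' d + 0 / (1 + s * 0) * coeff b' d \<noteq> 0" by blast
    have lead: "coeff a' d + 0 * coeff b' d \<noteq> 0" using lead by simp
    define u where "u p = - 1 / (p - s)" for p
    obtain l where l: "(deriv (total_height a' b') \<longlongrightarrow> l) (at 0)"
      using curvature_limit[OF d fol nc' hol lead] by blast
    have shift: "filterlim (\<lambda>p. p - s) at_infinity at_infinity"
      using tendsto_add_filterlim_at_infinity'[OF filterlim_ident tendsto_const, of "- s"] by simp
    have nes: "\<forall>\<^sub>F p in at_infinity. p - s \<noteq> 0"
      using eventually_not_equal_at_infinity[of s] by (rule eventually_mono) simp
    have inv: "((\<lambda>p. inverse (p - s)) \<longlongrightarrow> 0) at_infinity"
      by (rule filterlim_compose[OF tendsto_inverse_0 shift])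
    then have "((\<lambda>p. - inverse (p - s)) \<longlongrightarrow> - 0) at_infinity" by (rule tendsto_minus)
    then have "(u \<longlongrightarrow> 0) at_infinity" by (simp add: u_def[abs_def] divide_inverse)
    moreover have "\<forall>\<^sub>F p in at_infinity. u p \<noteq> 0" using nes by (rule eventually_mono) (simp add: u_def)
    ultimately have u: "filterlim u (at 0) at_infinity" by (simp add: filterlim_at)
    have "((\<lambda>p. deriv (total_height a' b') (u p) * inverse (p - s) ^ 2) \<longlongrightarrow> l * 0 ^ 2) at_infinity"
      by (intro tendsto_mult tendsto_power filterlim_compose[OF l u] inv)
    moreover have "\<forall>\<^sub>F p in at_infinity. deriv (total_height a' b') (u p) * inverse (p - s) ^ 2 = ?T p"
    proof -
      have "bounded F" using F by (rule finite_imp_bounded)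
      then obtain B where "\<forall>p\<in>F. norm p \<le> B" unfolding bounded_iff by blast
      then have "\<forall>\<^sub>F p in at_infinity. regular_value d a b p"
        unfolding eventually_at_infinity F_def by (intro exI[of _ "B + 1"]) force
      with nes eventually_compose_filterlim[OF eventually_regular_value[OF d1 nc', of 0] u] show ?thesis
      proof eventually_elim
        case (elim p)
        have "?T p = deriv (total_height a' b') (u p) / (p - s) ^ 2"
          using rotated_height[OF d fol nc nc' elim(1) elim(3) elim(2)[unfolded u_def]] by (simp only: u_def)
        then show ?case by (simp add: divide_inverse power_inverse)
      qed
    qed
    ultimately have "(?T \<longlongrightarrow> l * 0 ^ 2) at_infinity" by (rule Lim_transform_eventually)
    then show ?thesis by simp
  qed
  define E where "E p = (if p \<in> F then Lim (at p) ?T else ?T p)" for p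
  have opn: "open (- F)" using F by (intro open_Compl finite_imp_closed)
  have "total_height a b holomorphic_on - F"
    unfolding holomorphic_on_def field_differentiable_def
  proof (intro ballI exI)
    fix p assume "p \<in> - F"
    then have "regular_value d a b p" by (simp add: F_def)
    from total_height_differentiable[OF d1 deg cop this]
    show "(total_height a b has_field_derivative ?T p) (at p within - F)" by (rule has_field_derivative_at_within)
  qed
  then have "?T holomorphic_on - F" using opn by (rule holomorphic_deriv)
  then have "E holomorphic_on - F" by (rule holomorphic_transform) (simp add: E_def)
  then have "E holomorphic_on UNIV - F" by (simp add: Compl_eq_Diff_UNIV)
  moreover have "(E \<longlongrightarrow> E z) (at z within UNIV)" if z: "z \<in> F" for z
  proof -
    obtain l where l: "(?T \<longlongrightarrow> l) (at z)" using limits by blast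
    have "E z = l" using z tendsto_Lim[OF _ l] by (simp add: E_def)
    moreover have "(E \<longlongrightarrow> l) (at z)"
    proof (rule Lim_transform_eventually[OF l])
      show "\<forall>\<^sub>F p in at z. ?T p = E p"
        using eventually_regular_value[OF d1 nc, of z] by (rule eventually_mono) (simp add: E_def F_def)
    qed
    ultimately show ?thesis by simp
  qed
  ultimately have "E holomorphic_on UNIV" using no_isolated_singularity'[of F E UNIV] F by blast
  moreover have "(E \<longlongrightarrow> 0) at_infinity"
  proof (rule Lim_transform_eventually[OF infinity])
    have "bounded F" using F by (rule finite_imp_bounded)
    then obtain B where "\<forall>p\<in>F. norm p \<le> B" unfolding bounded_iff by blast
    then show "\<forall>\<^sub>F p in at_infinity. ?T p = E p"
      unfolding eventually_at_infinity E_def by (intro exI[of _ "B + 1"]) force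
  qed
  ultimately have "E p = 0" by (rule Liouville_weak_0)
  then show ?thesis using reg by (simp add: E_def F_def)
qed

lemma flat_if_curvature_holomorphic:
  assumes d: "2 \<le> d" and fol: "foliation d \<Omega>" and hom: "homogeneous_foliation \<Omega>"
    and hol: "curvature_holomorphic_along d (legendre_transform d \<Omega>) (gauss_image \<Omega> (transverse_inflection d \<Omega>))"
  shows "flat_web d (legendre_transform d \<Omega>)"
  unfolding flat_web_def
proof (intro allI impI)
  fix g m assume g: "invertible g" and m: "m \<notin> discriminant d (legendre_transform d \<Omega> g)"
  have d1: "1 \<le> d" using d by simp
  obtain g0 a b where nc: "normal_chart d \<Omega> g0 a b" using normal_chart_exists[OF d1 fol hom] by blast
  define M where "M = matrix_inv g ** g0"
  define L where "L = dual_coords M m"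
  obtain N \<theta> where "decomposes d (legendre_transform d \<Omega> g) N \<theta>" "m \<in> N"
    using m unfolding discriminant_def by blast
  from decomposes_nonvanishing[OF d this] obtain t where t: "legendre_transform d \<Omega> g m (1, t) \<noteq> 0" by blast
  have "(L$1, L$2) \<noteq> (0, 0)"
  proof
    assume "(L$1, L$2) = (0, 0)"
    then have "L$1 = 0" "L$2 = 0" by simp_all
    then show False using legendre_transform_infinity[OF fol nc g, of m t] t unfolding L_def M_def by blast
  qed
  from good_rotation[OF d1 fol nc this] obtain s a' b' where nc': "normal_chart d \<Omega> (g0 ** rotation s) a' b'"
    and s: "L$1 + s * L$2 \<noteq> 0" and lead: "coeff a' d + L$2 / (L$1 + s * L$2) * coeff b' d \<noteq> 0" by blast
  define M' where "M' = matrix_inv g ** (g0 ** rotation s)"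
  have "dual_coords M' m = L v* rotation s"
    unfolding M'_def matrix_mul_assoc dual_coords_mult L_def M_def ..
  then have dc: "dual_coords M' m $ 1 = - L$2" "dual_coords M' m $ 2 = L$1 + s * L$2"
    by (simp_all only: rotation_components)
  have L2: "dual_coords M' m $ 2 \<noteq> 0" using s unfolding dc .
  have lead': "coeff a' d + slope_at M' m * coeff b' d \<noteq> 0" using lead unfolding slope_at_def dc by simp
  note off = off_discriminant[OF d fol nc' g m, folded M'_def, OF L2 lead']
  have "deriv (total_height a' b') (slope_at M' m) = 0"
    by (rule total_height_constant[OF d fol nc' hol off(2)])
  then show "curvature d (legendre_transform d \<Omega> g) m = 0"
    using curvature_normal_chart(2)[OF d fol nc' g, folded M'_def, OF L2 off(1) off(2)] by simp
qed

lemma in_dual_chartI: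
  assumes "(l v* g) $ 2 \<noteq> 0"
  shows "in_dual_chart g l (- (l v* g) $ 1 / (l v* g) $ 2, (l v* g) $ 3 / (l v* g) $ 2)"
  unfolding in_dual_chart_def
proof (intro exI conjI)
  show "- (l v* g) $ 2 \<noteq> 0" using assms by simp
  show "l v* g = - (l v* g) $ 2 *s vector [fst (- (l v* g) $ 1 / (l v* g) $ 2, (l v* g) $ 3 / (l v* g) $ 2), - 1,
      - snd (- (l v* g) $ 1 / (l v* g) $ 2, (l v* g) $ 3 / (l v* g) $ 2)]"
    by (rule vec3_eqI) (use assms in \<open>simp_all add: vector_3\<close>)
qed

lemma dual_chart_exists:
  fixes l :: "complex^3"
  assumes "l \<noteq> 0"
  shows "\<exists>g m. invertible g \<and> in_dual_chart g l m"
proof -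
  have sw: "\<exists>g m. invertible g \<and> in_dual_chart g l m" if "det g \<noteq> 0" "(l v* g) $ 2 \<noteq> 0" for g
    using that in_dual_chartI[of l g] invertible_det_nz[of g] by blast
  have "l$1 \<noteq> 0 \<or> l$2 \<noteq> 0 \<or> l$3 \<noteq> 0" using assms by (auto simp: vec_eq_iff forall_3)
  then consider "l$1 \<noteq> 0" | "l$2 \<noteq> 0" | "l$3 \<noteq> 0" by blast
  then show ?thesis
  proof cases
    case 1
    show ?thesis by (rule sw[of "vector [vector [0, 1, 0], vector [1, 0, 0], vector [0, 0, 1]]"])
        (use 1 in \<open>simp_all add: det_3 vector_matrix_3 vector_3\<close>)
  next
    case 2
    show ?thesis by (rule sw[of "mat 1"]) (use 2 in simp_all)
  next
    case 3
    show ?thesis by (rule sw[of "vector [vector [1, 0, 0], vector [0, 0, 1], vector [0, 1, 0]]"])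
        (use 3 in \<open>simp_all add: det_3 vector_matrix_3 vector_3\<close>)
  qed
qed

lemma curvature_holomorphic_if_flat:
  assumes flat: "flat_web k \<W>"
  shows "curvature_holomorphic_along k \<W> C"
  unfolding curvature_holomorphic_along_def
proof (intro allI impI)
  fix n h assume h: "homogeneous3 n h \<and> irreducible h \<and> zeros h \<subseteq> C"
  have "curvature_holomorphic_at k \<W> l" if "l \<in> zeros h - zeros 1" for l
  proof -
    have "l \<noteq> 0" using that by (simp add: zeros_def)
    from dual_chart_exists[OF this] obtain g m where gm: "invertible g" "in_dual_chart g l m" by blast
    have "holomorphic2_on (\<lambda>x. 0) UNIV"
      unfolding holomorphic2_on_def by (auto intro!: exI[of _ 0])
    moreover have "\<forall>x \<in> UNIV - discriminant k (\<W> g). curvature k (\<W> g) x = 0"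
      using flat gm(1) unfolding flat_web_def by blast
    ultimately show ?thesis
      unfolding curvature_holomorphic_at_def using gm by (intro exI[of _ g] exI[of _ m] exI[of _ UNIV] exI conjI UNIV_I)
  qed
  moreover have "\<not> h dvd 1" using h irreducible_not_unit by blast
  ultimately show "\<exists>n' r. homogeneous3 n' r \<and> \<not> h dvd r \<and> (\<forall>l \<in> zeros h - zeros r. curvature_holomorphic_at k \<W> l)"
    using homogeneous3_1 by blast
qed

theorem mainTheorem6:
  fixes d :: nat and \<Omega> :: "poly3^3"
  assumes "d \<ge> 3"
    and "foliation d \<Omega>"
    and "homogeneous_foliation \<Omega>"
  shows "flat_web d (legendre_transform d \<Omega>) \<longleftrightarrow>
         curvature_holomorphic_along d (legendre_transform d \<Omega>)
           (gauss_image \<Omega> (transverse_inflection d \<Omega>))"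
proof
  assume "flat_web d (legendre_transform d \<Omega>)"
  then show "curvature_holomorphic_along d (legendre_transform d \<Omega>) (gauss_image \<Omega> (transverse_inflection d \<Omega>))"
    by (rule curvature_holomorphic_if_flat)
next
  assume hol: "curvature_holomorphic_along d (legendre_transform d \<Omega>) (gauss_image \<Omega> (transverse_inflection d \<Omega>))"
  have "2 \<le> d" using assms(1) by simp
  then show "flat_web d (legendre_transform d \<Omega>)"
    by (rule flat_if_curvature_holomorphic[OF _ assms(2,3) hol])
qed

end
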